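(* Let $(A,\mathfrak{m}_A)$ be an equicharacteristic complete Noetherian local ring and let $K$ be an arbitrary coefficient field of $A$. Then there exist a power series ring $R$ over $K$ (in finitely many indeterminates) and a surjective ring homomorphism $\pi:R\longrightarrow A$ with the following property: for any finite self map $\varphi:A\longrightarrow A$ there exists a finite self map $\psi:R\longrightarrow R$ such that $\varphi\circ\pi=\pi\circ\psi$.
   Context: All rings are commutative with identity. A self map of a ring $S$ is a ring homomorphism $\varphi:S\to S$ (not assumed to be linear over any coefficient field). It is finite if $S$ is a finitely generated module over itself via $\varphi$. A local ring is equicharacteristic if it has the same characteristic as its residue field (equivalently, it contains a field). Complete means complete and separated in the topology of powers of the maximal ideal. A coefficient field of $A$ is a subfield $K\subset A$ such that the composite $K\hookrightarrow A\to A/\mathfrak{m}_A$ is an isomorphism. A power series ring over $K$ means a formal power series ring $K[[X_1,\ldots,X_N]]$ for some integer $N\ge 0$. The pair $(R,\pi)$ is chosen before, and independently of, $\varphi$. *)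

theory Defs
  imports "HOL-Algebra.Algebra" "HOL-Library.Multiset"
begin

definition is_local_ring :: "('a, 'b) ring_scheme \<Rightarrow> 'a set \<Rightarrow> bool" where
  "is_local_ring A \<mm> \<longleftrightarrow> cring A \<and> maximalideal \<mm> A \<and> (\<forall>J. maximalideal J A \<longrightarrow> J = \<mm>)"

text \<open>The characteristic of a ring is \<open>0\<close> if no positive multiple of \<open>\<one>\<close> vanishes.\<close>

definition ring_char :: "('a, 'b) ring_scheme \<Rightarrow> nat" where
  "ring_char A =
     (if \<exists>n::nat. n > 0 \<and> [n] \<cdot>\<^bsub>A\<^esub> \<one>\<^bsub>A\<^esub> = \<zero>\<^bsub>A\<^esub>
      then LEAST n. n > 0 \<and> [n] \<cdot>\<^bsub>A\<^esub> \<one>\<^bsub>A\<^esub> = \<zero>\<^bsub>A\<^esub>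
      else 0)"

definition equicharacteristic :: "('a, 'b) ring_scheme \<Rightarrow> 'a set \<Rightarrow> bool" where
  "equicharacteristic A \<mm> \<longleftrightarrow> ring_char A = ring_char (A Quot \<mm>)"

text \<open>
  Ideal powers are powers in the multiplicative monoid of ideals, whose unit (hence zeroth power)
  is the whole ring. The topology they define is first countable, so that completeness can be
  expressed by sequences.
\<close>

definition adic_cauchy :: "('a, 'b) ring_scheme \<Rightarrow> 'a set \<Rightarrow> (nat \<Rightarrow> 'a) \<Rightarrow> bool" where
  "adic_cauchy A I s \<longleftrightarrow>
     (\<forall>n::nat. \<exists>M. \<forall>i\<ge>M. \<forall>j\<ge>M. s i \<ominus>\<^bsub>A\<^esub> s j \<in> I [^]\<^bsub>ideals_set A\<^esub> n)"

definition adic_limit :: "('a, 'b) ring_scheme \<Rightarrow> 'a set \<Rightarrow> (nat \<Rightarrow> 'a) \<Rightarrow> 'a \<Rightarrow> bool" where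
  "adic_limit A I s x \<longleftrightarrow>
     (\<forall>n::nat. \<exists>M. \<forall>i\<ge>M. s i \<ominus>\<^bsub>A\<^esub> x \<in> I [^]\<^bsub>ideals_set A\<^esub> n)"

definition adic_separated :: "('a, 'b) ring_scheme \<Rightarrow> 'a set \<Rightarrow> bool" where
  "adic_separated A I \<longleftrightarrow> (\<Inter>n::nat. I [^]\<^bsub>ideals_set A\<^esub> n) = {\<zero>\<^bsub>A\<^esub>}"

definition adic_complete :: "('a, 'b) ring_scheme \<Rightarrow> 'a set \<Rightarrow> bool" where
  "adic_complete A I \<longleftrightarrow>
     adic_separated A I \<and>
     (\<forall>s. range s \<subseteq> carrier A \<and> adic_cauchy A I s \<longrightarrow> (\<exists>x\<in>carrier A. adic_limit A I s x))"

definition coefficient_field :: "('a, 'b) ring_scheme \<Rightarrow> 'a set \<Rightarrow> 'a set \<Rightarrow> bool" where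
  "coefficient_field A \<mm> K \<longleftrightarrow>
     subfield K A \<and> (\<lambda>k. \<mm> +>\<^bsub>A\<^esub> k) \<in> ring_iso (A\<lparr>carrier := K\<rparr>) (A Quot \<mm>)"

text \<open>
  The ring \<open>F[[X\<^sub>0, \<dots>, X\<^sub>N\<^sub>-\<^sub>1]]\<close>. As in \<^theory>\<open>HOL-Algebra.Indexed_Polynomials\<close>, a monomial is
  the multiset of its indeterminates, so that multiplication of monomials is addition of multisets
  and \<open>\<subseteq>#\<close> is divisibility. Coefficients at monomials involving other indeterminates are \<open>\<zero>\<close>.
\<close>

definition power_series_ring :: "('a, 'b) ring_scheme \<Rightarrow> nat \<Rightarrow> (nat multiset \<Rightarrow> 'a) ring" where
  "power_series_ring F N =
     \<lparr>carrier = {f. (\<forall>m. f m \<in> carrier F) \<and> (\<forall>m. \<not> set_mset m \<subseteq> {..<N} \<longrightarrow> f m = \<zero>\<^bsub>F\<^esub>)},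
      monoid.mult = (\<lambda>f g m. \<Oplus>\<^bsub>F\<^esub>a\<in>{a. a \<subseteq># m}. f a \<otimes>\<^bsub>F\<^esub> g (m - a)),
      one = (\<lambda>m. if m = {#} then \<one>\<^bsub>F\<^esub> else \<zero>\<^bsub>F\<^esub>),
      ring.zero = (\<lambda>m. \<zero>\<^bsub>F\<^esub>),
      add = (\<lambda>f g m. f m \<oplus>\<^bsub>F\<^esub> g m)\<rparr>"

definition finitely_generated_module :: "('a, 'b) ring_scheme \<Rightarrow> ('a, 'c, 'd) module_scheme \<Rightarrow> bool"
  where
  "finitely_generated_module S M \<longleftrightarrow>
     (\<exists>B. finite B \<and> B \<subseteq> carrier M \<and>
       (\<forall>x\<in>carrier M. \<exists>c\<in>B \<rightarrow> carrier S. x = (\<Oplus>\<^bsub>M\<^esub>b\<in>B. c b \<odot>\<^bsub>M\<^esub> b)))"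

definition module_via :: "('a, 'b) ring_scheme \<Rightarrow> ('a \<Rightarrow> 'a) \<Rightarrow> ('a, 'a) module" where
  "module_via S \<phi> =
     \<lparr>carrier = carrier S, monoid.mult = monoid.mult S, one = one S, ring.zero = ring.zero S, add = add S,
      smult = (\<lambda>r x. \<phi> r \<otimes>\<^bsub>S\<^esub> x)\<rparr>"

definition finite_self_map :: "('a, 'b) ring_scheme \<Rightarrow> ('a \<Rightarrow> 'a) \<Rightarrow> bool" where
  "finite_self_map S \<phi> \<longleftrightarrow>
     \<phi> \<in> ring_hom S S \<and> finitely_generated_module S (module_via S \<phi>)"

end

theory Submission
  imports
    Defs
    "HOL-Computational_Algebra.Primes"
begin

text \<open>
  Let \<open>x\<^sub>0, \<dots>, x\<^sub>n\<^sub>-\<^sub>1\<close> generate the maximal ideal of \<open>A\<close>. Take \<open>R = K[[X\<^sub>0, \<dots>, X\<^sub>2\<^sub>n\<^sub>-\<^sub>1]]\<close> and let \<open>\<pi>\<close> map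
  \<open>X\<^sub>i\<close> to \<open>x\<^sub>i\<close> for \<open>i < n\<close> and to \<open>0\<close> otherwise. A finite self map \<open>\<phi>\<close> is local by Nakayama's lemma,
  and some power of every \<open>x\<^sub>i\<close> lies in the ideal generated by the \<open>\<phi> x\<^sub>l\<close>, because \<open>A\<close> modulo this
  ideal is a finite-dimensional vector space. The restriction of \<open>\<phi>\<close> to \<open>K\<close> lifts to a homomorphism
  from \<open>K\<close> to \<open>R\<close> by formal smoothness of \<open>K\<close> over its prime field, so it remains to lift the elements
  \<open>\<phi> (\<pi> X\<^sub>i)\<close> in such a way that the lifts generate an ideal that is primary to the maximal ideal of
  \<open>R\<close>. The \<open>n\<close> additional indeterminates, which lie in the kernel of \<open>\<pi>\<close>, make this possible without
  any dimension theory.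
\<close>

text \<open>Two constraints shape \<psi>. Since \<phi> need not map K into K, \<psi> cannot send
  constants to constants: their images are series with prescribed values under \<pi>, and they have
  to form a ring homomorphism. As K may be any extension of its prime field, the lift is not built
  along generators of K; a maximal subring is chosen in every square-zero layer of the preimage of
  \<phi>(K), and completeness joins the layers.

  The other constraint is finiteness. For A = K[x]/(x^2) and the K-linear \<phi> with \<phi>(x) = 0,
  the lift \<psi>(X) = 0 on K[[X]] is not finite, so lifts have to be corrected by elements of the
  kernel of \<pi>. The correction uses exponents that depend on \<phi>, but the number of
  indeterminates depends only on the generators of the maximal ideal, so R and \<pi> can be fixed in
  advance. Once R is finitely generated via \<psi> modulo the ideal of the images of the
  indeterminates, a complete form of Nakayama's lemma shows that \<psi> is finite.\<close>

lemma (in abelian_monoid) finsum_Sigma: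
  assumes "finite I" "\<And>i. i \<in> I \<Longrightarrow> finite (A i)"
    and "\<And>i x. i \<in> I \<Longrightarrow> x \<in> A i \<Longrightarrow> f i x \<in> carrier G"
  shows "(\<Oplus>i\<in>I. \<Oplus>x\<in>A i. f i x) = (\<Oplus>p\<in>Sigma I A. f (fst p) (snd p))"
  using assms
proof (induction I rule: finite_induct)
  case empty
  then show ?case by simp
next
  case (insert a I)
  have S: "Sigma (insert a I) A = Pair a ` A a \<union> Sigma I A" by auto
  have "(\<Oplus>p\<in>Pair a ` A a. f (fst p) (snd p)) = (\<Oplus>x\<in>A a. f a x)"
    using insert.prems by (subst finsum_reindex) (auto simp: inj_on_def)
  moreover have "(\<Oplus>p\<in>Pair a ` A a \<union> Sigma I A. f (fst p) (snd p)) =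
      (\<Oplus>p\<in>Pair a ` A a. f (fst p) (snd p)) \<oplus> (\<Oplus>p\<in>Sigma I A. f (fst p) (snd p))"
    using insert by (intro finsum_Un_disjoint) auto
  moreover have "(\<Oplus>i\<in>insert a I. \<Oplus>x\<in>A i. f i x) = (\<Oplus>x\<in>A a. f a x) \<oplus> (\<Oplus>i\<in>I. \<Oplus>x\<in>A i. f i x)"
    using insert by (intro finsum_insert) (auto intro!: finsum_closed)
  ultimately show ?case using insert S by simp
qed

lemma (in additive_subgroup) finsum_mem:
  assumes "ring G" "\<And>i. i \<in> I \<Longrightarrow> f i \<in> H"
  shows "finsum G f I \<in> H"
proof -
  interpret ring G by fact
  have ?thesis if "finite I"
    using that assms(2)
  proof (induction I rule: finite_induct)
    case (insert i I)
    then show ?case using a_Hcarr by (subst finsum_insert) auto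
  qed simp
  then show ?thesis by (cases "finite I") auto
qed

lemma (in ring) uminus_eq_zero_minus: "a \<in> carrier R \<Longrightarrow> \<ominus> a = \<zero> \<ominus> a"
  by (simp add: minus_eq)

text \<open>These rules carry differences outwards until an equation contains no subtraction;
  together with distributivity and reordering, as collected in \<open>ring_identity_simps\<close>,
  they let the simplifier prove the polynomial identities used throughout.\<close>

lemma (in ring) diff_normalize:
  assumes "a \<in> carrier R" "b \<in> carrier R"
  shows "\<And>c. c \<in> carrier R \<Longrightarrow> (a \<ominus> b) \<oplus> c = (a \<oplus> c) \<ominus> b"
    and "\<And>c. c \<in> carrier R \<Longrightarrow> c \<oplus> (a \<ominus> b) = (c \<oplus> a) \<ominus> b"
    and "\<And>c. c \<in> carrier R \<Longrightarrow> (a \<ominus> b) \<ominus> c = a \<ominus> (b \<oplus> c)"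
    and "\<And>c. c \<in> carrier R \<Longrightarrow> c \<ominus> (a \<ominus> b) = (c \<oplus> b) \<ominus> a"
    and "\<And>c. c \<in> carrier R \<Longrightarrow> (a \<ominus> b) \<otimes> c = a \<otimes> c \<ominus> b \<otimes> c"
    and "\<And>c. c \<in> carrier R \<Longrightarrow> c \<otimes> (a \<ominus> b) = c \<otimes> a \<ominus> c \<otimes> b"
    and "\<And>c. c \<in> carrier R \<Longrightarrow> a \<ominus> b = c \<longleftrightarrow> a = c \<oplus> b"
    and "\<And>c. c \<in> carrier R \<Longrightarrow> c = a \<ominus> b \<longleftrightarrow> c \<oplus> b = a"
proof -
  note [simp] = assms
  fix c assume [simp]: "c \<in> carrier R"
  show "(a \<ominus> b) \<oplus> c = (a \<oplus> c) \<ominus> b" "c \<oplus> (a \<ominus> b) = (c \<oplus> a) \<ominus> b"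
    "(a \<ominus> b) \<ominus> c = a \<ominus> (b \<oplus> c)" "c \<ominus> (a \<ominus> b) = (c \<oplus> b) \<ominus> a"
    by (simp_all add: minus_eq minus_add a_ac)
  show "(a \<ominus> b) \<otimes> c = a \<otimes> c \<ominus> b \<otimes> c" "c \<otimes> (a \<ominus> b) = c \<otimes> a \<ominus> c \<otimes> b"
    by (simp_all add: minus_eq l_distr r_distr l_minus r_minus)
  show 1: "a \<ominus> b = c \<longleftrightarrow> a = c \<oplus> b"
    by (auto simp: minus_eq a_assoc l_neg r_neg)
  show "c = a \<ominus> b \<longleftrightarrow> c \<oplus> b = a" using 1 by auto
qed

lemmas (in cring) ring_identity_simps = uminus_eq_zero_minus diff_normalize l_distr r_distr a_ac m_ac

lemma (in cring) finsum_minus: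
  assumes "finite I" "\<And>i. i \<in> I \<Longrightarrow> f i \<in> carrier R" "\<And>i. i \<in> I \<Longrightarrow> g i \<in> carrier R"
  shows "(\<Oplus>i\<in>I. f i) \<ominus> (\<Oplus>i\<in>I. g i) = (\<Oplus>i\<in>I. f i \<ominus> g i)"
  using assms
proof (induction I rule: finite_induct)
  case empty
  then show ?case by (simp add: minus_eq)
next
  case (insert i I)
  have "(a \<oplus> b) \<ominus> (c \<oplus> d) = (a \<ominus> c) \<oplus> (b \<ominus> d)"
    if [simp]: "a \<in> carrier R" "b \<in> carrier R" "c \<in> carrier R" "d \<in> carrier R" for a b c d
    by (simp add: ring_identity_simps)
  from this[of "f i" "finsum R f I" "g i" "finsum R g I"] show ?case
    using insert by (simp add: Pi_def)
qed

text \<open>One abstraction serves both filtrations in play: the powers of the maximal ideal of A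
  and the filtration of power series by order. \<open>G_complete\<close> speaks only of sequences
  whose step at k lies in \<open>G k\<close>, and returns a limit with the matching rate, so that
  estimates carry no moduli of convergence.\<close>

locale complete_filtered_ring = cring R for R (structure) +
  fixes G :: "nat \<Rightarrow> 'a set"
  assumes G_ideal: "ideal (G n) R"
    and G_0: "G 0 = carrier R"
    and G_Suc: "G (Suc n) \<subseteq> G n"
    and G_mult: "\<lbrakk>x \<in> G i; y \<in> G j\<rbrakk> \<Longrightarrow> x \<otimes> y \<in> G (i + j)"
    and G_separated: "(\<Inter>n. G n) \<subseteq> {\<zero>}"
    and G_complete: "\<lbrakk>\<And>k. s k \<in> carrier R; \<And>k. s (Suc k) \<ominus> s k \<in> G k\<rbrakk>
      \<Longrightarrow> \<exists>x\<in>carrier R. \<forall>k. x \<ominus> s k \<in> G k"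
begin

lemma G_subgroup: "additive_subgroup (G n) R"
  using G_ideal by (rule ideal.axioms(1))

lemma G_carrier: "x \<in> G n \<Longrightarrow> x \<in> carrier R"
  by (rule ideal.Icarr[OF G_ideal])

lemma G_add: "\<lbrakk>x \<in> G n; y \<in> G n\<rbrakk> \<Longrightarrow> x \<oplus> y \<in> G n"
  by (rule additive_subgroup.a_closed[OF G_subgroup])

lemma G_zero: "\<zero> \<in> G n"
  by (rule additive_subgroup.zero_closed[OF G_subgroup])

lemma G_uminus: "x \<in> G n \<Longrightarrow> \<ominus> x \<in> G n"
  by (rule additive_subgroup.a_inv_closed[OF G_subgroup])

lemma G_minus: "\<lbrakk>x \<in> G n; y \<in> G n\<rbrakk> \<Longrightarrow> x \<ominus> y \<in> G n"
  by (simp add: minus_eq G_add G_uminus)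

lemma G_lmult: "\<lbrakk>r \<in> carrier R; x \<in> G n\<rbrakk> \<Longrightarrow> r \<otimes> x \<in> G n"
  by (rule ideal.I_l_closed[OF G_ideal])

lemma G_rmult: "\<lbrakk>r \<in> carrier R; x \<in> G n\<rbrakk> \<Longrightarrow> x \<otimes> r \<in> G n"
  by (rule ideal.I_r_closed[OF G_ideal])

lemma G_mono: "m \<le> n \<Longrightarrow> G n \<subseteq> G m"
  using lift_Suc_antimono_le[of G] G_Suc by blast

lemma G_finsum: "(\<And>i. i \<in> I \<Longrightarrow> f i \<in> G n) \<Longrightarrow> finsum R f I \<in> G n"
  using additive_subgroup.finsum_mem[OF ideal.axioms(1)[OF G_ideal] ring_axioms] by blast

lemma G_diff_trans:
  assumes "x \<in> carrier R" "y \<in> carrier R" "z \<in> carrier R" "x \<ominus> y \<in> G n" "y \<ominus> z \<in> G n"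
  shows "x \<ominus> z \<in> G n"
proof -
  note [simp] = assms(1-3)
  have "x \<ominus> z = (x \<ominus> y) \<oplus> (y \<ominus> z)" by (simp add: ring_identity_simps)
  then show ?thesis using assms G_add by simp
qed

lemma G_diff_sym:
  assumes "x \<in> carrier R" "y \<in> carrier R" "x \<ominus> y \<in> G n"
  shows "y \<ominus> x \<in> G n"
proof -
  note [simp] = assms(1-2)
  have "y \<ominus> x = \<ominus> (x \<ominus> y)" by (simp add: ring_identity_simps)
  then show ?thesis using assms G_uminus by simp
qed

lemma G_eqI:
  assumes "x \<in> carrier R" "y \<in> carrier R" "\<And>n. x \<ominus> y \<in> G n"
  shows "x = y"
proof -
  have "x \<ominus> y = \<zero>" using assms(3) G_separated by blast
  then show ?thesis using assms(1,2) by simp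
qed

lemma one_plus_G_Units:
  assumes "g \<in> G 1"
  shows "\<exists>u\<in>carrier R. (\<one> \<oplus> g) \<otimes> u = \<one>"
proof -
  have g [simp]: "g \<in> carrier R" using assms G_carrier by blast
  \<comment> \<open>The partial sums of the geometric series for 1/(1 + g), written as iterates of
    the map sending x to 1 - g x, whose fixed point is the inverse.\<close>
  define s where "s k = rec_nat \<zero> (\<lambda>_ x. \<one> \<ominus> g \<otimes> x) k" for k :: nat
  have s0: "s 0 = \<zero>" and sS: "s (Suc k) = \<one> \<ominus> g \<otimes> s k" for k
    by (simp_all add: s_def)
  have sc: "s k \<in> carrier R" for k by (induction k) (auto simp: s0 sS g)
  have "s (Suc k) \<ominus> s k \<in> G k" for k
  proof (induction k)
    case 0
    then show ?case using sc by (simp add: G_0)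
  next
    case (Suc k)
    have "s (Suc (Suc k)) \<ominus> s (Suc k) = \<ominus> (g \<otimes> (s (Suc k) \<ominus> s k))"
    proof -
      have "(\<one> \<ominus> g \<otimes> a) \<ominus> (\<one> \<ominus> g \<otimes> b) = \<ominus> (g \<otimes> (a \<ominus> b))"
        if [simp]: "a \<in> carrier R" "b \<in> carrier R" for a b
        by (simp add: ring_identity_simps)
      from this[OF sc[of "Suc k"] sc[of k]] show ?thesis by (simp only: sS)
    qed
    then show ?case using G_mult[OF assms Suc] G_uminus by simp
  qed
  then obtain x where x [simp]: "x \<in> carrier R" and x': "\<And>k. x \<ominus> s k \<in> G k" using G_complete[of s] sc by blast
  have "(\<one> \<oplus> g) \<otimes> x = \<one>"
  proof (rule G_eqI)
    fix k
    have "(\<one> \<oplus> g) \<otimes> x \<ominus> \<one> = (x \<ominus> (\<one> \<ominus> g \<otimes> y)) \<oplus> g \<otimes> (x \<ominus> y)"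
      if [simp]: "y \<in> carrier R" for y
      by (simp add: ring_identity_simps)
    then have "(\<one> \<oplus> g) \<otimes> x \<ominus> \<one> = (x \<ominus> s (Suc k)) \<oplus> g \<otimes> (x \<ominus> s k)"
      using sc sS by simp
    then show "(\<one> \<oplus> g) \<otimes> x \<ominus> \<one> \<in> G k"
      using x'[of "Suc k"] x'[of k] G_add G_lmult[OF g] G_Suc[of k] by auto
  qed (use g x in auto)
  then show ?thesis using x by blast
qed

end

section \<open>Power series\<close>

lemma finite_bounded_multisets:
  assumes "finite A"
  shows "finite {m. set_mset m \<subseteq> A \<and> size m < k}"
proof -
  have "{m. set_mset m \<subseteq> A \<and> size m < k} = (\<Union>n<k. multisets_of_size A n)"
    by (auto simp: multisets_of_size_def)
  then show ?thesis using assms by auto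
qed

lemma finite_submultisets: "finite {a. a \<subseteq># m}"
proof (rule finite_subset)
  show "{a. a \<subseteq># m} \<subseteq> {a. set_mset a \<subseteq> set_mset m \<and> size a < Suc (size m)}"
    by (auto dest: mset_subset_eqD size_mset_mono)
qed (rule finite_bounded_multisets, simp)

lemma diff_diff_submultiset: "a \<subseteq># m \<Longrightarrow> m - (m - a) = a"
  by (metis add_diff_cancel_right' subset_mset.add_diff_inverse)

lemma set_mset_eq_Un_Diff: "a \<subseteq># m \<Longrightarrow> set_mset m = set_mset a \<union> set_mset (m - a)"
  by (metis set_mset_union subset_mset.add_diff_inverse)

lemma size_eq_add_Diff: "a \<subseteq># m \<Longrightarrow> size m = size a + size (m - a)"
  by (metis size_union subset_mset.add_diff_inverse)

locale power_series = cring F for F (structure) + fixes N :: nat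
begin

abbreviation P where "P \<equiv> power_series_ring F N"

lemma P_carrier_iff:
  "f \<in> carrier P \<longleftrightarrow> (\<forall>m. f m \<in> carrier F) \<and> (\<forall>m. \<not> set_mset m \<subseteq> {..<N} \<longrightarrow> f m = \<zero>)"
  and P_mult: "(f \<otimes>\<^bsub>P\<^esub> g) m = (\<Oplus>a\<in>{a. a \<subseteq># m}. f a \<otimes> g (m - a))"
  and P_one: "\<one>\<^bsub>P\<^esub> m = (if m = {#} then \<one> else \<zero>)"
  and P_zero: "\<zero>\<^bsub>P\<^esub> m = \<zero>"
  and P_add: "(f \<oplus>\<^bsub>P\<^esub> g) m = f m \<oplus> g m"
  by (auto simp: power_series_ring_def)

lemma P_coeff: "f \<in> carrier P \<Longrightarrow> f m \<in> carrier F"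
  by (simp add: P_carrier_iff)

lemma P_coeff_zero: "\<lbrakk>f \<in> carrier P; \<not> set_mset m \<subseteq> {..<N}\<rbrakk> \<Longrightarrow> f m = \<zero>"
  by (simp add: P_carrier_iff)

lemma P_mult_closed:
  assumes "f \<in> carrier P" "g \<in> carrier P"
  shows "f \<otimes>\<^bsub>P\<^esub> g \<in> carrier P"
  unfolding P_carrier_iff
proof (intro conjI allI impI)
  fix m
  show "(f \<otimes>\<^bsub>P\<^esub> g) m \<in> carrier F"
    unfolding P_mult using assms by (auto intro!: finsum_closed simp: P_coeff)
  assume m: "\<not> set_mset m \<subseteq> {..<N}"
  have "f a \<otimes> g (m - a) = \<zero>" if a: "a \<subseteq># m" for a
  proof (cases "set_mset a \<subseteq> {..<N}")
    case True
    then have "g (m - a) = \<zero>"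
      using m set_mset_eq_Un_Diff[OF a] P_coeff_zero[OF assms(2), of "m - a"] by auto
    then show ?thesis using assms P_coeff by simp
  next
    case False
    then show ?thesis using P_coeff_zero[OF assms(1)] assms P_coeff by simp
  qed
  then show "(f \<otimes>\<^bsub>P\<^esub> g) m = \<zero>"
    unfolding P_mult by (intro add.finprod_one_eqI) auto
qed

lemma P_mult_comm:
  assumes "f \<in> carrier P" "g \<in> carrier P"
  shows "f \<otimes>\<^bsub>P\<^esub> g = g \<otimes>\<^bsub>P\<^esub> f"
proof
  fix m :: "nat multiset"
  have im: "{a. a \<subseteq># m} = (\<lambda>a. m - a) ` {a. a \<subseteq># m}" (is "?S = ?f ` ?S")
  proof
    show "?S \<subseteq> ?f ` ?S"
    proof
      fix a assume "a \<in> ?S"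
      then show "a \<in> ?f ` ?S"
        by (intro image_eqI[of _ _ "m - a"]) (auto simp: diff_diff_submultiset)
    qed
  qed auto
  have inj: "inj_on (\<lambda>a. m - a) {a. a \<subseteq># m}"
    by (rule inj_onI) (metis mem_Collect_eq diff_diff_submultiset)
  have "(\<Oplus>a\<in>{a. a \<subseteq># m}. f a \<otimes> g (m - a)) = (\<Oplus>a\<in>(\<lambda>a. m - a) ` {a. a \<subseteq># m}. f a \<otimes> g (m - a))"
    using im by simp
  also have "\<dots> = (\<Oplus>a\<in>{a. a \<subseteq># m}. f (m - a) \<otimes> g (m - (m - a)))"
    using assms P_coeff by (intro finsum_reindex inj) auto
  also have "\<dots> = (\<Oplus>a\<in>{a. a \<subseteq># m}. g a \<otimes> f (m - a))"
  proof (intro finsum_cong' refl)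
    show "(\<lambda>a. g a \<otimes> f (m - a)) \<in> {a. a \<subseteq># m} \<rightarrow> carrier F"
      using assms P_coeff by auto
    fix a assume "a \<in> {a. a \<subseteq># m}"
    then have "m - (m - a) = a" by (simp add: diff_diff_submultiset)
    then show "f (m - a) \<otimes> g (m - (m - a)) = g a \<otimes> f (m - a)"
      using assms P_coeff m_comm by simp
  qed
  finally show "(f \<otimes>\<^bsub>P\<^esub> g) m = (g \<otimes>\<^bsub>P\<^esub> f) m" by (simp add: P_mult)
qed

lemma P_mult_assoc:
  assumes f: "f \<in> carrier P" and g: "g \<in> carrier P" and h: "h \<in> carrier P"
  shows "(f \<otimes>\<^bsub>P\<^esub> g) \<otimes>\<^bsub>P\<^esub> h = f \<otimes>\<^bsub>P\<^esub> (g \<otimes>\<^bsub>P\<^esub> h)"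
proof
  fix m :: "nat multiset"
  note [simp] = P_coeff[OF f] P_coeff[OF g] P_coeff[OF h]
  let ?S = "\<lambda>m :: nat multiset. {a. a \<subseteq># m}"
  let ?L = "Sigma (?S m) ?S" and ?R = "Sigma (?S m) (\<lambda>b. ?S (m - b))"
  \<comment> \<open>A chain of submultisets b of a of m amounts to a submultiset b of m together
    with the part c = a - b of m - b; \<open>?k\<close> recovers (a, b) from (b, c).\<close>
  let ?k = "\<lambda>p :: nat multiset \<times> nat multiset. (fst p + snd p, fst p)"
  have "((f \<otimes>\<^bsub>P\<^esub> g) \<otimes>\<^bsub>P\<^esub> h) m = (\<Oplus>a\<in>?S m. \<Oplus>b\<in>?S a. f b \<otimes> g (a - b) \<otimes> h (m - a))"
    unfolding P_mult by (intro finsum_cong' refl finsum_ldistr) (auto simp: finite_submultisets intro!: finsum_closed)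
  also have "\<dots> = (\<Oplus>p\<in>?L. f (snd p) \<otimes> g (fst p - snd p) \<otimes> h (m - fst p))"
    by (rule finsum_Sigma) (auto simp: finite_submultisets)
  also have "?L = ?k ` ?R"
  proof
    show "?L \<subseteq> ?k ` ?R"
    proof
      fix p assume "p \<in> ?L"
      then have p: "fst p \<subseteq># m" "snd p \<subseteq># fst p" by auto
      then have "p = ?k (snd p, fst p - snd p)"
        by (metis fst_conv prod.collapse snd_conv subset_mset.add_diff_inverse)
      moreover have "(snd p, fst p - snd p) \<in> ?R"
        using p by (auto simp: subseteq_mset_def intro: order_trans diff_le_mono)
      ultimately show "p \<in> ?k ` ?R" by (rule image_eqI)
    qed
    have "b + c \<subseteq># m" if "b \<subseteq># m" "c \<subseteq># m - b" for b c
      using that by (metis subset_mset.add_left_mono subset_mset.add_diff_inverse)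
    then show "?k ` ?R \<subseteq> ?L" by auto
  qed
  also have "(\<Oplus>p\<in>?k ` ?R. f (snd p) \<otimes> g (fst p - snd p) \<otimes> h (m - fst p))
      = (\<Oplus>p\<in>?R. f (fst p) \<otimes> g (snd p) \<otimes> h (m - (fst p + snd p)))"
    by (subst finsum_reindex) (auto simp: inj_on_def)
  also have "\<dots> = (\<Oplus>p\<in>?R. f (fst p) \<otimes> (g (snd p) \<otimes> h (m - fst p - snd p)))"
    by (intro finsum_cong') (auto simp: m_assoc)
  also have "\<dots> = (\<Oplus>b\<in>?S m. \<Oplus>c\<in>?S (m - b). f b \<otimes> (g c \<otimes> h (m - b - c)))"
    by (rule finsum_Sigma[symmetric]) (auto simp: finite_submultisets)
  also have "\<dots> = (f \<otimes>\<^bsub>P\<^esub> (g \<otimes>\<^bsub>P\<^esub> h)) m"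
    unfolding P_mult by (intro finsum_cong' refl finsum_rdistr[symmetric]) (auto simp: finite_submultisets intro!: finsum_closed)
  finally show "((f \<otimes>\<^bsub>P\<^esub> g) \<otimes>\<^bsub>P\<^esub> h) m = (f \<otimes>\<^bsub>P\<^esub> (g \<otimes>\<^bsub>P\<^esub> h)) m" .
qed

definition const :: "'a \<Rightarrow> nat multiset \<Rightarrow> 'a" where
  "const c m = (if m = {#} then c else \<zero>)"

definition indet :: "nat \<Rightarrow> nat multiset \<Rightarrow> 'a" where
  "indet i m = (if m = {#i#} then \<one> else \<zero>)"

lemma const_closed: "c \<in> carrier F \<Longrightarrow> const c \<in> carrier P"
  by (auto simp: const_def P_carrier_iff)

lemma indet_closed: "i < N \<Longrightarrow> indet i \<in> carrier P"
  by (auto simp: indet_def P_carrier_iff)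

lemma one_eq_const: "\<one>\<^bsub>P\<^esub> = const \<one>"
  by (rule ext) (simp add: const_def P_one)

lemma const_mult:
  assumes "c \<in> carrier F" "f \<in> carrier P"
  shows "(const c \<otimes>\<^bsub>P\<^esub> f) m = c \<otimes> f m"
proof -
  have "(\<Oplus>a\<in>{a. a \<subseteq># m}. const c a \<otimes> f (m - a)) = (\<Oplus>a\<in>{a. a \<subseteq># m}. if {#} = a then c \<otimes> f m else \<zero>)"
    using assms P_coeff by (intro finsum_cong') (auto simp: const_def)
  also have "\<dots> = c \<otimes> f m"
    using assms P_coeff by (intro add.finprod_singleton) (auto simp: finite_submultisets)
  finally show ?thesis by (simp add: P_mult)
qed

lemma indet_mult:
  assumes "f \<in> carrier P"
  shows "(indet i \<otimes>\<^bsub>P\<^esub> f) m = (if i \<in># m then f (m - {#i#}) else \<zero>)"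
proof (cases "i \<in># m")
  case True
  have "(\<Oplus>a\<in>{a. a \<subseteq># m}. indet i a \<otimes> f (m - a)) = (\<Oplus>a\<in>{a. a \<subseteq># m}. if {#i#} = a then f (m - {#i#}) else \<zero>)"
    using assms P_coeff by (intro finsum_cong') (auto simp: indet_def)
  also have "\<dots> = f (m - {#i#})"
    using assms P_coeff True
    by (intro add.finprod_singleton) (auto simp: finite_submultisets)
  finally show ?thesis using True by (simp add: P_mult)
next
  case False
  then have "indet i a \<otimes> f (m - a) = \<zero>" if "a \<subseteq># m" for a
    using that assms P_coeff by (auto simp: indet_def)
  then have "(\<Oplus>a\<in>{a. a \<subseteq># m}. indet i a \<otimes> f (m - a)) = \<zero>"
    by (intro add.finprod_one_eqI) auto
  then show ?thesis using False by (simp add: P_mult)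
qed

lemma P_abelian_group: "abelian_group P"
proof (rule abelian_groupI)
  fix f assume f: "f \<in> carrier P"
  then show "\<exists>g\<in>carrier P. g \<oplus>\<^bsub>P\<^esub> f = \<zero>\<^bsub>P\<^esub>"
    by (intro bexI[of _ "\<lambda>m. \<ominus> f m"] ext) (auto simp: P_add P_zero P_carrier_iff l_neg)
qed (auto simp: fun_eq_iff P_add P_zero P_carrier_iff a_ac)

lemma P_cring: "cring P"
proof (rule cringI[OF P_abelian_group])
  show "comm_monoid P"
  proof (rule comm_monoidI)
    fix f assume "f \<in> carrier P"
    then show "\<one>\<^bsub>P\<^esub> \<otimes>\<^bsub>P\<^esub> f = f"
      by (auto simp: fun_eq_iff one_eq_const const_mult P_coeff)
  qed (simp_all add: P_mult_closed P_mult_assoc one_eq_const const_closed, rule P_mult_comm)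
  fix f g h assume "f \<in> carrier P" "g \<in> carrier P" "h \<in> carrier P"
  then show "(f \<oplus>\<^bsub>P\<^esub> g) \<otimes>\<^bsub>P\<^esub> h = f \<otimes>\<^bsub>P\<^esub> h \<oplus>\<^bsub>P\<^esub> g \<otimes>\<^bsub>P\<^esub> h"
    by (auto simp: fun_eq_iff P_add P_mult l_distr P_coeff finsum_addf Pi_def)
qed

sublocale P: cring P by (rule P_cring)

lemma P_uminus: assumes "f \<in> carrier P" shows "(\<ominus>\<^bsub>P\<^esub> f) m = \<ominus> f m"
proof -
  have "(\<ominus>\<^bsub>P\<^esub> f \<oplus>\<^bsub>P\<^esub> f) m = \<zero>" using assms by (simp add: P.l_neg P_zero)
  then have "(\<ominus>\<^bsub>P\<^esub> f) m \<oplus> f m = \<zero>" by (simp add: P_add)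
  then show ?thesis using minus_equality P_coeff assms by simp
qed

lemma P_minus: "\<lbrakk>f \<in> carrier P; g \<in> carrier P\<rbrakk> \<Longrightarrow> (f \<ominus>\<^bsub>P\<^esub> g) m = f m \<ominus> g m"
  by (simp add: P.minus_eq minus_eq P_add P_uminus)

lemma P_finsum:
  assumes "\<And>i. i \<in> I \<Longrightarrow> f i \<in> carrier P"
  shows "(finsum P f I) m = (\<Oplus>i\<in>I. f i m)"
proof (cases "finite I")
  case True
  then show ?thesis using assms
  proof (induction I rule: finite_induct)
    case (insert i I)
    then show ?case by (subst P.finsum_insert; (subst finsum_insert)?) (auto simp: P_add P_coeff)
  qed (simp add: P_zero)
qed (simp add: P_zero)

lemma const_ring_hom: "const \<in> ring_hom F P"
proof (rule ring_hom_memI)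
  fix x y assume "x \<in> carrier F" "y \<in> carrier F"
  then show "const (x \<otimes> y) = const x \<otimes>\<^bsub>P\<^esub> const y"
    by (auto simp: fun_eq_iff const_mult const_closed) (auto simp: const_def)
  show "const (x \<oplus> y) = const x \<oplus>\<^bsub>P\<^esub> const y"
    by (auto simp: fun_eq_iff P_add const_def)
qed (auto simp: const_closed one_eq_const)

text \<open>This is the k-th power of the ideal generated by the indeterminates. The description by
  coefficients makes completeness a matter of single coefficients; the link with generators is
  \<open>order_ge_Suc_decomp\<close>.\<close>

definition order_ge :: "nat \<Rightarrow> (nat multiset \<Rightarrow> 'a) set" where
  "order_ge k = {f \<in> carrier P. \<forall>m. size m < k \<longrightarrow> f m = \<zero>}"

lemma P_complete: "complete_filtered_ring P order_ge"
proof (rule complete_filtered_ring.intro[OF P_cring], rule complete_filtered_ring_axioms.intro)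
  fix n
  show "ideal (order_ge n) P"
  proof (rule idealI)
    show "ring P" by (rule P.ring_axioms)
    show "subgroup (order_ge n) (add_monoid P)"
    proof (rule P.add.subgroupI)
      show "order_ge n \<subseteq> carrier P" by (auto simp: order_ge_def)
      have "\<zero>\<^bsub>P\<^esub> \<in> order_ge n" by (simp add: order_ge_def P_zero)
      then show "order_ge n \<noteq> {}" by blast
      fix f g assume f: "f \<in> order_ge n" and g: "g \<in> order_ge n"
      show "\<ominus>\<^bsub>P\<^esub> f \<in> order_ge n"
        using f by (simp add: order_ge_def P_uminus)
      show "f \<oplus>\<^bsub>P\<^esub> g \<in> order_ge n"
        using f g by (simp add: order_ge_def P_add)
    qed
    fix f g assume f: "f \<in> order_ge n" and g: "g \<in> carrier P"
    then have fc: "f \<in> carrier P" by (simp add: order_ge_def)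
    have "(f \<otimes>\<^bsub>P\<^esub> g) m = \<zero>" if "size m < n" for m
      unfolding P_mult
    proof (rule add.finprod_one_eqI)
      fix a assume "a \<in> {a. a \<subseteq># m}"
      then have "f a = \<zero>" using f that by (auto simp: order_ge_def dest!: size_mset_mono)
      then show "f a \<otimes> g (m - a) = \<zero>" using g P_coeff by simp
    qed
    then show "f \<otimes>\<^bsub>P\<^esub> g \<in> order_ge n"
      using P_mult_closed[OF fc g] by (simp add: order_ge_def)
    then show "g \<otimes>\<^bsub>P\<^esub> f \<in> order_ge n" using P_mult_comm[OF fc g] by simp
  qed
  show "order_ge (Suc n) \<subseteq> order_ge n" by (auto simp: order_ge_def)
next
  show "order_ge 0 = carrier P" by (auto simp: order_ge_def)
next
  fix f g i j assume f: "f \<in> order_ge i" and g: "g \<in> order_ge j"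
  have "(f \<otimes>\<^bsub>P\<^esub> g) m = \<zero>" if "size m < i + j" for m
    unfolding P_mult
  proof (rule add.finprod_one_eqI)
    fix a assume "a \<in> {a. a \<subseteq># m}"
    then have "size a < i \<or> size (m - a) < j" using that size_eq_add_Diff[of a m] by auto
    then have "f a = \<zero> \<or> g (m - a) = \<zero>" using f g by (auto simp: order_ge_def)
    then show "f a \<otimes> g (m - a) = \<zero>" using f g P_coeff by (auto simp: order_ge_def)
  qed
  then show "f \<otimes>\<^bsub>P\<^esub> g \<in> order_ge (i + j)"
    using f g P_mult_closed by (auto simp: order_ge_def)
next
  have "f m = \<zero>" if "f \<in> (\<Inter>n. order_ge n)" for f m
    using that by (auto simp: order_ge_def dest: spec[of _ "Suc (size m)"])
  then show "(\<Inter>n. order_ge n) \<subseteq> {\<zero>\<^bsub>P\<^esub>}" by (auto simp: fun_eq_iff P_zero)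
next
  fix s :: "nat \<Rightarrow> nat multiset \<Rightarrow> 'a"
  assume sc: "\<And>k. s k \<in> carrier P" and s: "\<And>k. s (Suc k) \<ominus>\<^bsub>P\<^esub> s k \<in> order_ge k"
  have step: "s (Suc k) m = s k m" if "size m < k" for k m
  proof -
    have "s (Suc k) m \<ominus> s k m = \<zero>"
      using s[of k] that sc by (auto simp: order_ge_def P_minus)
    then show ?thesis using sc P_coeff by simp
  qed
  \<comment> \<open>The coefficient at m no longer changes from stage \<open>Suc (size m)\<close>
    on, so this stage supplies the coefficient of the limit.\<close>
  have stable: "s k m = s (Suc (size m)) m" if "Suc (size m) \<le> k" for k m
    using that by (induction k rule: dec_induct) (auto simp: step)
  define x where "x m = s (Suc (size m)) m" for m
  have x: "x \<in> carrier P" using sc by (auto simp: x_def P_carrier_iff)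
  have "x \<ominus>\<^bsub>P\<^esub> s k \<in> order_ge k" for k
    using x sc stable[of _ k] P_coeff by (auto simp: order_ge_def P_minus x_def)
  then show "\<exists>x\<in>carrier P. \<forall>k. x \<ominus>\<^bsub>P\<^esub> s k \<in> order_ge k" using x by blast
qed

sublocale P: complete_filtered_ring P order_ge by (rule P_complete)

lemma indet_order: "i < N \<Longrightarrow> indet i \<in> order_ge 1"
  by (simp add: order_ge_def indet_closed) (simp add: indet_def)

lemma minus_const_order: "f \<in> carrier P \<Longrightarrow> f \<ominus>\<^bsub>P\<^esub> const (f {#}) \<in> order_ge 1"
  by (auto simp: order_ge_def P_minus const_closed P_coeff const_def)

lemma order_ge_Suc_decomp:
  assumes f: "f \<in> order_ge (Suc k)"
  shows "\<exists>g. (\<forall>i<N. g i \<in> order_ge k) \<and> f = (\<Oplus>\<^bsub>P\<^esub>i\<in>{..<N}. indet i \<otimes>\<^bsub>P\<^esub> g i)"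
proof -
  have fc: "f \<in> carrier P" using f by (simp add: order_ge_def)
  \<comment> \<open>Every monomial of positive degree is assigned to its least indeterminate, so no
    term is counted twice: \<open>g i\<close> collects the terms whose least indeterminate is i,
    divided by it.\<close>
  define g where "g i m = (if i = Min (set_mset (add_mset i m)) then f (add_mset i m) else \<zero>)" for i m
  have gk: "g i \<in> order_ge k" if "i < N" for i
  proof -
    have "g i m = \<zero>" if "size m < k" for m
      using f that by (simp add: g_def order_ge_def)
    moreover have "g i m = \<zero>" if "\<not> set_mset m \<subseteq> {..<N}" for m
      using P_coeff_zero[OF fc, of "add_mset i m"] that by (simp add: g_def)
    moreover have "g i m \<in> carrier F" for m using P_coeff[OF fc] by (simp add: g_def)
    ultimately show ?thesis by (simp add: order_ge_def P_carrier_iff)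
  qed
  then have gc: "g i \<in> carrier P" if "i < N" for i using that by (simp add: order_ge_def)
  have "f m = (\<Oplus>\<^bsub>P\<^esub>i\<in>{..<N}. indet i \<otimes>\<^bsub>P\<^esub> g i) m" for m
  proof -
    have "(\<Oplus>\<^bsub>P\<^esub>i\<in>{..<N}. indet i \<otimes>\<^bsub>P\<^esub> g i) m = (\<Oplus>i\<in>{..<N}. (indet i \<otimes>\<^bsub>P\<^esub> g i) m)"
      by (rule P_finsum) (auto intro!: P.m_closed indet_closed gc)
    also have "\<dots> = (\<Oplus>i\<in>{..<N}. if i \<in># m \<and> i = Min (set_mset m) then f m else \<zero>)"
      using P_coeff[OF fc] gc by (intro finsum_cong') (auto simp: indet_mult g_def)
    also have "\<dots> = f m"
    proof (cases "m = {#}")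
      case True
      then have "f m = \<zero>" using f by (simp add: order_ge_def)
      then show ?thesis using True by simp
    next
      case False
      then have min: "Min (set_mset m) \<in># m" by simp
      have "(\<Oplus>i\<in>{..<N}. if i \<in># m \<and> i = Min (set_mset m) then f m else \<zero>)
          = (\<Oplus>i\<in>{..<N}. if Min (set_mset m) = i then f m else \<zero>)"
        using P_coeff[OF fc] min by (intro finsum_cong') auto
      also have "\<dots> = f m"
      proof (cases "set_mset m \<subseteq> {..<N}")
        case True
        then have "Min (set_mset m) \<in> {..<N}" using min by blast
        then show ?thesis using P_coeff[OF fc] by (intro add.finprod_singleton) auto
      next
        case False
        then have "f m = \<zero>" using fc P_coeff_zero by simp
        then show ?thesis by (auto intro: add.finprod_one_eqI)
      qed
      finally show ?thesis .
    qed
    finally show ?thesis by simp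
  qed
  then show ?thesis using gk by blast
qed

end

section \<open>Evaluation of power series in a complete filtered ring\<close>

locale power_series_eval = power_series F N + T: complete_filtered_ring T G
  for F :: "('a, 'b) ring_scheme" (structure) and N :: nat
    and T :: "('c, 'd) ring_scheme" and G :: "nat \<Rightarrow> 'c set" +
  fixes \<tau> :: "'a \<Rightarrow> 'c" and y :: "nat \<Rightarrow> 'c"
  assumes \<tau>: "\<tau> \<in> ring_hom F T"
    and y: "i < N \<Longrightarrow> y i \<in> G 1"
begin

sublocale \<tau>: ring_hom_cring F T \<tau>
  by unfold_locales (rule \<tau>)

lemma y_closed: "i < N \<Longrightarrow> y i \<in> carrier T"
  using y T.G_carrier by blast

definition mon :: "nat multiset \<Rightarrow> 'c" where
  "mon m = (\<Otimes>\<^bsub>T\<^esub>i\<in>{..<N}. y i [^]\<^bsub>T\<^esub> count m i)"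

lemma mon_closed: "mon m \<in> carrier T"
  unfolding mon_def using y_closed by (intro T.finprod_closed) auto

lemma mon_empty: "mon {#} = \<one>\<^bsub>T\<^esub>"
  unfolding mon_def by (rule T.finprod_one_eqI) simp

lemma mon_single: assumes "i < N" shows "mon {#i#} = y i"
proof -
  have "mon {#i#} = (\<Otimes>\<^bsub>T\<^esub>j\<in>{..<N}. if i = j then y j else \<one>\<^bsub>T\<^esub>)"
    unfolding mon_def using y_closed by (intro T.finprod_cong') auto
  also have "\<dots> = y i"
    using assms y_closed by (intro T.finprod_singleton) auto
  finally show ?thesis .
qed

lemma mon_union: "mon (a + b) = mon a \<otimes>\<^bsub>T\<^esub> mon b"
proof -
  have "mon (a + b) = (\<Otimes>\<^bsub>T\<^esub>i\<in>{..<N}. y i [^]\<^bsub>T\<^esub> count a i \<otimes>\<^bsub>T\<^esub> y i [^]\<^bsub>T\<^esub> count b i)"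
    unfolding mon_def using y_closed by (intro T.finprod_cong') (auto simp: T.nat_pow_mult)
  also have "\<dots> = mon a \<otimes>\<^bsub>T\<^esub> mon b"
    unfolding mon_def using y_closed by (intro T.finprod_multf) auto
  finally show ?thesis .
qed

lemma mon_mem: "set_mset m \<subseteq> {..<N} \<Longrightarrow> mon m \<in> G (size m)"
proof (induction m)
  case empty
  then show ?case by (simp add: mon_empty T.G_0)
next
  case (add i m)
  have "mon (add_mset i m) = y i \<otimes>\<^bsub>T\<^esub> mon m"
    using mon_union[of "{#i#}" m] mon_single[of i] add.prems by simp
  then show ?case using T.G_mult[of "y i" 1 "mon m" "size m"] add y[of i] by simp
qed

definition M :: "nat \<Rightarrow> nat multiset set" where
  "M k = {m. set_mset m \<subseteq> {..<N} \<and> size m < k}"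

lemma finite_M: "finite (M k)"
  unfolding M_def by (rule finite_bounded_multisets) simp

definition term_at :: "(nat multiset \<Rightarrow> 'a) \<Rightarrow> nat multiset \<Rightarrow> 'c" where
  "term_at f m = \<tau> (f m) \<otimes>\<^bsub>T\<^esub> mon m"

definition psum :: "nat \<Rightarrow> (nat multiset \<Rightarrow> 'a) \<Rightarrow> 'c" where
  "psum k f = (\<Oplus>\<^bsub>T\<^esub>m\<in>M k. term_at f m)"

lemma term_at_closed: "f \<in> carrier P \<Longrightarrow> term_at f m \<in> carrier T"
  by (simp add: term_at_def mon_closed P_coeff)

lemma term_at_mem: "\<lbrakk>f \<in> carrier P; set_mset m \<subseteq> {..<N}; k \<le> size m\<rbrakk> \<Longrightarrow> term_at f m \<in> G k"
  using mon_mem[of m] T.G_mono[of k "size m"] unfolding term_at_def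
  by (intro T.G_lmult) (auto simp: P_coeff)

lemma psum_closed: "f \<in> carrier P \<Longrightarrow> psum k f \<in> carrier T"
  unfolding psum_def by (intro T.finsum_closed) (auto simp: term_at_closed)

lemma psum_step:
  assumes f: "f \<in> carrier P"
  shows "psum (Suc k) f \<ominus>\<^bsub>T\<^esub> psum k f \<in> G k"
proof -
  let ?D = "{m. set_mset m \<subseteq> {..<N} \<and> size m = k}"
  have fin: "finite ?D" by (rule finite_subset[OF _ finite_M[of "Suc k"]]) (auto simp: M_def)
  have "M (Suc k) = ?D \<union> M k" by (auto simp: M_def)
  then have "psum (Suc k) f = (\<Oplus>\<^bsub>T\<^esub>m\<in>?D. term_at f m) \<oplus>\<^bsub>T\<^esub> psum k f"
    unfolding psum_def using fin finite_M term_at_closed[OF f]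
    by (simp only:, intro T.finsum_Un_disjoint) (auto simp: M_def)
  moreover have "(\<Oplus>\<^bsub>T\<^esub>m\<in>?D. term_at f m) \<in> G k"
    using f by (intro T.G_finsum) (auto intro: term_at_mem)
  ultimately show ?thesis
    using psum_closed[OF f] T.G_carrier by (simp add: T.minus_eq T.a_assoc T.r_neg)
qed

text \<open>The choice is harmless because limits in a separated filtration are unique. The bound
  \<open>k0\<close> in \<open>ev_eqI\<close> permits ignoring truncations too short to contain the
  monomial in question.\<close>

definition ev :: "(nat multiset \<Rightarrow> 'a) \<Rightarrow> 'c" where
  "ev f = (SOME x. x \<in> carrier T \<and> (\<forall>k. x \<ominus>\<^bsub>T\<^esub> psum k f \<in> G k))"

lemma ev: assumes "f \<in> carrier P" shows "ev f \<in> carrier T" "ev f \<ominus>\<^bsub>T\<^esub> psum k f \<in> G k"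
proof -
  have "\<exists>x. x \<in> carrier T \<and> (\<forall>k. x \<ominus>\<^bsub>T\<^esub> psum k f \<in> G k)"
    using T.G_complete[of "\<lambda>k. psum k f"] psum_closed[OF assms] psum_step[OF assms] by blast
  from someI_ex[OF this] show "ev f \<in> carrier T" "ev f \<ominus>\<^bsub>T\<^esub> psum k f \<in> G k"
    by (simp_all add: ev_def)
qed

lemma ev_eqI:
  assumes f: "f \<in> carrier P" and x: "x \<in> carrier T" and "\<And>k. k0 \<le> k \<Longrightarrow> x \<ominus>\<^bsub>T\<^esub> psum k f \<in> G k"
  shows "ev f = x"
proof (rule T.G_eqI[OF ev(1)[OF f] x])
  fix n
  have "x \<ominus>\<^bsub>T\<^esub> psum (max k0 n) f \<in> G n" "ev f \<ominus>\<^bsub>T\<^esub> psum (max k0 n) f \<in> G n"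
    using assms(3)[of "max k0 n"] ev(2)[OF f, of "max k0 n"] T.G_mono[of n "max k0 n"] by auto
  then show "ev f \<ominus>\<^bsub>T\<^esub> x \<in> G n"
    using T.G_diff_trans T.G_diff_sym ev(1)[OF f] x psum_closed[OF f] by meson
qed

lemma ev_eqI':
  assumes f: "f \<in> carrier P" and x: "x \<in> carrier T" and "\<And>k. k0 \<le> k \<Longrightarrow> psum k f = x"
  shows "ev f = x"
  using assms by (intro ev_eqI[of f x k0]) (auto simp: T.minus_eq T.r_neg T.G_zero)

lemma psum_single:
  assumes f: "f \<in> carrier P" and "set_mset m \<subseteq> {..<N}" "size m < k"
    and "\<And>m'. m' \<noteq> m \<Longrightarrow> f m' = \<zero>"
  shows "psum k f = \<tau> (f m) \<otimes>\<^bsub>T\<^esub> mon m"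
proof -
  have "psum k f = (\<Oplus>\<^bsub>T\<^esub>m'\<in>M k. if m = m' then term_at f m' else \<zero>\<^bsub>T\<^esub>)"
    unfolding psum_def using assms term_at_closed[OF f]
    by (intro T.finsum_cong') (auto simp: term_at_def mon_closed)
  also have "\<dots> = term_at f m"
    using assms term_at_closed[OF f] by (intro T.finsum_singleton finite_M) (auto simp: M_def)
  finally show ?thesis by (simp add: term_at_def)
qed

lemma ev_const: assumes c: "c \<in> carrier F" shows "ev (const c) = \<tau> c"
proof (rule ev_eqI'[of _ _ 1])
  fix k :: nat assume "1 \<le> k"
  then show "psum k (const c) = \<tau> c"
    using psum_single[of "const c" "{#}" k] const_closed[OF c] c by (simp add: mon_empty const_def)
qed (use c const_closed in auto)

lemma ev_indet: assumes i: "i < N" shows "ev (indet i) = y i"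
proof (rule ev_eqI'[of _ _ 2])
  fix k :: nat assume "2 \<le> k"
  then show "psum k (indet i) = y i"
    using psum_single[of "indet i" "{#i#}" k] indet_closed[OF i] i y_closed[OF i]
    by (simp add: mon_single indet_def)
qed (use i indet_closed y_closed in auto)

lemma psum_add:
  assumes f: "f \<in> carrier P" and g: "g \<in> carrier P"
  shows "psum k (f \<oplus>\<^bsub>P\<^esub> g) = psum k f \<oplus>\<^bsub>T\<^esub> psum k g"
proof -
  have "psum k (f \<oplus>\<^bsub>P\<^esub> g) = (\<Oplus>\<^bsub>T\<^esub>m\<in>M k. term_at f m \<oplus>\<^bsub>T\<^esub> term_at g m)"
    unfolding psum_def using term_at_closed f g
    by (intro T.finsum_cong') (auto simp: term_at_def P_add T.l_distr P_coeff mon_closed)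
  also have "\<dots> = psum k f \<oplus>\<^bsub>T\<^esub> psum k g"
    unfolding psum_def using term_at_closed f g by (intro T.finsum_addf) auto
  finally show ?thesis .
qed

text \<open>The product of the truncations contains every term of the truncated product, and each
  surplus pair of monomials has total degree at least k.\<close>

lemma psum_mult:
  assumes f: "f \<in> carrier P" and g: "g \<in> carrier P"
  shows "psum k f \<otimes>\<^bsub>T\<^esub> psum k g \<ominus>\<^bsub>T\<^esub> psum k (f \<otimes>\<^bsub>P\<^esub> g) \<in> G k"
proof -
  note [simp] = term_at_closed[OF f] term_at_closed[OF g] mon_closed P_coeff[OF f] P_coeff[OF g]
  let ?t = "\<lambda>p. term_at f (fst p) \<otimes>\<^bsub>T\<^esub> term_at g (snd p)"
  let ?D = "{p \<in> M k \<times> M k. size (fst p) + size (snd p) < k}"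
  let ?E = "{p \<in> M k \<times> M k. k \<le> size (fst p) + size (snd p)}"
  let ?S = "Sigma (M k) (\<lambda>m. {a. a \<subseteq># m})"
  \<comment> \<open>\<open>?D\<close> holds the pairs of total degree below k and \<open>?E\<close>
    the surplus; \<open>?h\<close> reads a pair (a, b) as the divisor a of the monomial a + b, as in
    the convolution formula.\<close>
  let ?h = "\<lambda>p :: nat multiset \<times> nat multiset. (fst p + snd p, fst p)"
  have fin: "finite ?D" "finite ?E" by (auto intro: finite_subset[of _ "M k \<times> M k"] simp: finite_M)
  have "psum k f \<otimes>\<^bsub>T\<^esub> psum k g = (\<Oplus>\<^bsub>T\<^esub>a\<in>M k. term_at f a \<otimes>\<^bsub>T\<^esub> psum k g)"
    unfolding psum_def by (intro T.finsum_ldistr) (auto intro!: T.finsum_closed simp: finite_M)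
  also have "\<dots> = (\<Oplus>\<^bsub>T\<^esub>a\<in>M k. \<Oplus>\<^bsub>T\<^esub>b\<in>M k. term_at f a \<otimes>\<^bsub>T\<^esub> term_at g b)"
    unfolding psum_def
    by (intro T.finsum_cong' refl T.finsum_rdistr) (auto intro!: T.finsum_closed simp: finite_M)
  also have "\<dots> = (\<Oplus>\<^bsub>T\<^esub>p\<in>M k \<times> M k. ?t p)"
    by (rule T.finsum_Sigma) (auto simp: finite_M)
  also have "M k \<times> M k = ?E \<union> ?D" by auto
  also have "(\<Oplus>\<^bsub>T\<^esub>p\<in>?E \<union> ?D. ?t p) = (\<Oplus>\<^bsub>T\<^esub>p\<in>?E. ?t p) \<oplus>\<^bsub>T\<^esub> (\<Oplus>\<^bsub>T\<^esub>p\<in>?D. ?t p)"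
    by (intro T.finsum_Un_disjoint fin) auto
  finally have 1: "psum k f \<otimes>\<^bsub>T\<^esub> psum k g = (\<Oplus>\<^bsub>T\<^esub>p\<in>?E. ?t p) \<oplus>\<^bsub>T\<^esub> (\<Oplus>\<^bsub>T\<^esub>p\<in>?D. ?t p)" .
  have tt: "\<tau> (f a) \<otimes>\<^bsub>T\<^esub> \<tau> (g b) \<otimes>\<^bsub>T\<^esub> mon (a + b) = term_at f a \<otimes>\<^bsub>T\<^esub> term_at g b" for a b
    unfolding term_at_def mon_union by (simp add: T.m_ac)
  have "psum k (f \<otimes>\<^bsub>P\<^esub> g) = (\<Oplus>\<^bsub>T\<^esub>m\<in>M k. \<Oplus>\<^bsub>T\<^esub>a\<in>{a. a \<subseteq># m}. term_at f a \<otimes>\<^bsub>T\<^esub> term_at g (m - a))"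
    unfolding psum_def
  proof (intro T.finsum_cong' refl)
    fix m assume "m \<in> M k"
    have "term_at (f \<otimes>\<^bsub>P\<^esub> g) m
        = (\<Oplus>\<^bsub>T\<^esub>a\<in>{a. a \<subseteq># m}. \<tau> (f a) \<otimes>\<^bsub>T\<^esub> \<tau> (g (m - a))) \<otimes>\<^bsub>T\<^esub> mon m"
      unfolding term_at_def P_mult by (subst \<tau>.hom_finsum) (auto simp: o_def)
    also have "\<dots> = (\<Oplus>\<^bsub>T\<^esub>a\<in>{a. a \<subseteq># m}. \<tau> (f a) \<otimes>\<^bsub>T\<^esub> \<tau> (g (m - a)) \<otimes>\<^bsub>T\<^esub> mon m)"
      by (intro T.finsum_ldistr) (auto simp: finite_submultisets)
    also have "\<dots> = (\<Oplus>\<^bsub>T\<^esub>a\<in>{a. a \<subseteq># m}. term_at f a \<otimes>\<^bsub>T\<^esub> term_at g (m - a))"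
    proof (intro T.finsum_cong' refl)
      fix a assume "a \<in> {a. a \<subseteq># m}"
      then have "a + (m - a) = m" by simp
      then show "\<tau> (f a) \<otimes>\<^bsub>T\<^esub> \<tau> (g (m - a)) \<otimes>\<^bsub>T\<^esub> mon m = term_at f a \<otimes>\<^bsub>T\<^esub> term_at g (m - a)"
        using tt[of a "m - a"] by simp
    qed auto
    finally show "term_at (f \<otimes>\<^bsub>P\<^esub> g) m
        = (\<Oplus>\<^bsub>T\<^esub>a\<in>{a. a \<subseteq># m}. term_at f a \<otimes>\<^bsub>T\<^esub> term_at g (m - a))" .
  qed (auto intro!: T.finsum_closed)
  also have "\<dots> = (\<Oplus>\<^bsub>T\<^esub>p\<in>?S. term_at f (snd p) \<otimes>\<^bsub>T\<^esub> term_at g (fst p - snd p))"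
    by (rule T.finsum_Sigma) (auto simp: finite_M finite_submultisets)
  also have "?S = ?h ` ?D"
  proof
    show "?S \<subseteq> ?h ` ?D"
    proof
      fix p assume "p \<in> ?S"
      then have p: "fst p \<in> M k" "snd p \<subseteq># fst p" by auto
      then have "p = ?h (snd p, fst p - snd p)" by (simp add: prod_eq_iff)
      moreover have "(snd p, fst p - snd p) \<in> ?D"
        using p set_mset_eq_Un_Diff[OF p(2)] size_eq_add_Diff[OF p(2)] by (auto simp: M_def)
      ultimately show "p \<in> ?h ` ?D" by (rule image_eqI)
    qed
    show "?h ` ?D \<subseteq> ?S" by (auto simp: M_def)
  qed
  also have "(\<Oplus>\<^bsub>T\<^esub>p\<in>?h ` ?D. term_at f (snd p) \<otimes>\<^bsub>T\<^esub> term_at g (fst p - snd p)) = (\<Oplus>\<^bsub>T\<^esub>p\<in>?D. ?t p)"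
    by (subst T.finsum_reindex) (auto simp: inj_on_def)
  finally have 2: "psum k (f \<otimes>\<^bsub>P\<^esub> g) = (\<Oplus>\<^bsub>T\<^esub>p\<in>?D. ?t p)" .
  have "?t p \<in> G k" if "p \<in> ?E" for p
  proof -
    have "?t p \<in> G (size (fst p) + size (snd p))"
      using that f g by (intro T.G_mult term_at_mem) (auto simp: M_def)
    then show ?thesis using that T.G_mono by blast
  qed
  then have "(\<Oplus>\<^bsub>T\<^esub>p\<in>?E. ?t p) \<in> G k" by (rule T.G_finsum)
  moreover have "(\<Oplus>\<^bsub>T\<^esub>p\<in>?D. ?t p) \<in> carrier T" by (intro T.finsum_closed) auto
  ultimately show ?thesis
    unfolding 1 2 using T.G_carrier by (simp add: T.minus_eq T.a_assoc T.r_neg)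
qed

lemma ev_ring_hom: "ev \<in> ring_hom P T"
proof (rule ring_hom_memI)
  fix f assume "f \<in> carrier P"
  then show "ev f \<in> carrier T" by (rule ev)
next
  fix f g assume f: "f \<in> carrier P" and g: "g \<in> carrier P"
  show "ev (f \<oplus>\<^bsub>P\<^esub> g) = ev f \<oplus>\<^bsub>T\<^esub> ev g"
  proof (rule ev_eqI[of _ _ 0])
    fix k
    have "(a \<oplus>\<^bsub>T\<^esub> b) \<ominus>\<^bsub>T\<^esub> (c \<oplus>\<^bsub>T\<^esub> d) = (a \<ominus>\<^bsub>T\<^esub> c) \<oplus>\<^bsub>T\<^esub> (b \<ominus>\<^bsub>T\<^esub> d)"
      if [simp]: "a \<in> carrier T" "b \<in> carrier T" "c \<in> carrier T" "d \<in> carrier T" for a b c d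
      by (simp add: T.ring_identity_simps)
    from this[OF ev(1)[OF f] ev(1)[OF g] psum_closed[OF f] psum_closed[OF g]]
    show "ev f \<oplus>\<^bsub>T\<^esub> ev g \<ominus>\<^bsub>T\<^esub> psum k (f \<oplus>\<^bsub>P\<^esub> g) \<in> G k"
      using T.G_add[OF ev(2)[OF f] ev(2)[OF g]] by (simp add: psum_add f g)
  qed (use f g ev in auto)
  show "ev (f \<otimes>\<^bsub>P\<^esub> g) = ev f \<otimes>\<^bsub>T\<^esub> ev g"
  proof (rule ev_eqI[of _ _ 0])
    fix k
    have "a \<otimes>\<^bsub>T\<^esub> b \<ominus>\<^bsub>T\<^esub> c \<otimes>\<^bsub>T\<^esub> d = (a \<ominus>\<^bsub>T\<^esub> c) \<otimes>\<^bsub>T\<^esub> b \<oplus>\<^bsub>T\<^esub> c \<otimes>\<^bsub>T\<^esub> (b \<ominus>\<^bsub>T\<^esub> d)"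
      if [simp]: "a \<in> carrier T" "b \<in> carrier T" "c \<in> carrier T" "d \<in> carrier T" for a b c d
      by (simp add: T.ring_identity_simps)
    from this[OF ev(1)[OF f] ev(1)[OF g] psum_closed[OF f, of k] psum_closed[OF g, of k]]
    have "ev f \<otimes>\<^bsub>T\<^esub> ev g \<ominus>\<^bsub>T\<^esub> psum k f \<otimes>\<^bsub>T\<^esub> psum k g \<in> G k"
      using T.G_add T.G_lmult[OF psum_closed[OF f] ev(2)[OF g]] T.G_rmult[OF ev(1)[OF g] ev(2)[OF f]]
      by simp
    from T.G_diff_trans[OF _ _ _ this psum_mult[OF f g]]
    show "ev f \<otimes>\<^bsub>T\<^esub> ev g \<ominus>\<^bsub>T\<^esub> psum k (f \<otimes>\<^bsub>P\<^esub> g) \<in> G k"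
      using f g ev psum_closed by simp
  qed (use f g ev in auto)
qed (simp add: one_eq_const ev_const)

end

text \<open>Both \<pi> and \<psi> arise from here. The coefficients travel along an arbitrary
  homomorphism: for \<pi> the inclusion of K, for \<psi> the lift of \<phi> on K, whose values are
  in general not constants.\<close>

lemma (in power_series) eval_exists:
  assumes "complete_filtered_ring T G" "\<tau> \<in> ring_hom F T" "\<And>i. i < N \<Longrightarrow> y i \<in> G 1"
  shows "\<exists>h\<in>ring_hom P T. (\<forall>c\<in>carrier F. h (const c) = \<tau> c) \<and> (\<forall>i<N. h (indet i) = y i)"
proof -
  interpret T: complete_filtered_ring T G by fact
  interpret power_series_eval F N T G \<tau> y
    by unfold_locales (use assms in auto)
  show ?thesis using ev_ring_hom ev_const ev_indet by blast
qed

text \<open>Continuity is automatic: a series of order at least k + 1 is a finite combination of the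
  indeterminates with coefficients of order at least k, and any ring homomorphism respects this
  expression.\<close>

lemma (in power_series) hom_order_ge:
  assumes "complete_filtered_ring T G" "h \<in> ring_hom P T" "\<And>i. i < N \<Longrightarrow> h (indet i) \<in> G 1"
  shows "f \<in> order_ge k \<Longrightarrow> h f \<in> G k"
proof (induction k arbitrary: f)
  interpret T: complete_filtered_ring T G by fact
  interpret h: ring_hom_cring P T h by unfold_locales fact
  case 0
  then show ?case using P.G_carrier T.G_0 by simp
next
  interpret T: complete_filtered_ring T G by fact
  interpret h: ring_hom_cring P T h by unfold_locales fact
  case (Suc k)
  then obtain g where g: "\<forall>i<N. g i \<in> order_ge k"
    and f: "f = (\<Oplus>\<^bsub>P\<^esub>i\<in>{..<N}. indet i \<otimes>\<^bsub>P\<^esub> g i)"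
    using order_ge_Suc_decomp by blast
  have gc: "i < N \<Longrightarrow> g i \<in> carrier P" for i using g P.G_carrier by blast
  have "h f = (\<Oplus>\<^bsub>T\<^esub>i\<in>{..<N}. h (indet i \<otimes>\<^bsub>P\<^esub> g i))"
    unfolding f by (subst h.hom_finsum) (auto simp: indet_closed gc o_def)
  also have "\<dots> \<in> G (Suc k)"
  proof (rule T.G_finsum)
    fix i assume "i \<in> {..<N}"
    then show "h (indet i \<otimes>\<^bsub>P\<^esub> g i) \<in> G (Suc k)"
      using T.G_mult[OF assms(3)[of i] Suc.IH[of "g i"]] g gc indet_closed by simp
  qed
  finally show ?case .
qed

text \<open>Write f as a constant plus a combination of indeterminates. If the two homomorphisms
  agree modulo \<open>G k\<close> on the coefficients of this combination, they agree modulo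
  \<open>G (Suc k)\<close> on f, since the indeterminates go into \<open>G 1\<close>. Thus
  \<phi>\<pi> = \<pi>\<psi> needs checking on constants and indeterminates only.\<close>

lemma (in power_series) hom_eqI:
  assumes "complete_filtered_ring T G" "h \<in> ring_hom P T" "h' \<in> ring_hom P T"
    and "\<And>i. i < N \<Longrightarrow> h (indet i) \<in> G 1"
    and const: "\<And>c. c \<in> carrier F \<Longrightarrow> h (const c) = h' (const c)"
    and indet: "\<And>i. i < N \<Longrightarrow> h (indet i) = h' (indet i)"
    and f: "f \<in> carrier P"
  shows "h f = h' f"
proof -
  interpret T: complete_filtered_ring T G by fact
  interpret h: ring_hom_cring P T h by unfold_locales fact
  interpret h': ring_hom_cring P T h' by unfold_locales fact
  have "h f \<ominus>\<^bsub>T\<^esub> h' f \<in> G k" if "f \<in> carrier P" for k f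
    using that
  proof (induction k arbitrary: f)
    case 0
    then show ?case using T.G_0 by simp
  next
    case (Suc k)
    have "f \<ominus>\<^bsub>P\<^esub> const (f {#}) \<in> order_ge (Suc 0)" using minus_const_order[OF Suc.prems] by simp
    then obtain g where g: "\<forall>i<N. g i \<in> order_ge 0"
      and eq: "f \<ominus>\<^bsub>P\<^esub> const (f {#}) = (\<Oplus>\<^bsub>P\<^esub>i\<in>{..<N}. indet i \<otimes>\<^bsub>P\<^esub> g i)"
      using order_ge_Suc_decomp by blast
    have gc: "i < N \<Longrightarrow> g i \<in> carrier P" for i using g P.G_carrier by blast
    have cc: "const (f {#}) \<in> carrier P" using const_closed P_coeff Suc.prems by blast
    let ?s = "\<Oplus>\<^bsub>P\<^esub>i\<in>{..<N}. indet i \<otimes>\<^bsub>P\<^esub> g i"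
    have sc: "?s \<in> carrier P" by (intro P.finsum_closed) (auto simp: indet_closed gc)
    have f: "f = ?s \<oplus>\<^bsub>P\<^esub> const (f {#})"
      unfolding eq[symmetric] using Suc.prems cc by (simp add: P.minus_eq P.a_assoc P.l_neg)
    have hs: "h ?s = (\<Oplus>\<^bsub>T\<^esub>i\<in>{..<N}. h (indet i) \<otimes>\<^bsub>T\<^esub> h (g i))"
      by (subst h.hom_finsum) (auto simp: indet_closed gc o_def intro!: T.finsum_cong')
    have h's: "h' ?s = (\<Oplus>\<^bsub>T\<^esub>i\<in>{..<N}. h (indet i) \<otimes>\<^bsub>T\<^esub> h' (g i))"
      by (subst h'.hom_finsum) (auto simp: indet_closed gc o_def indet intro!: T.finsum_cong')
    have "h ?s \<ominus>\<^bsub>T\<^esub> h' ?s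
        = (\<Oplus>\<^bsub>T\<^esub>i\<in>{..<N}. h (indet i) \<otimes>\<^bsub>T\<^esub> h (g i) \<ominus>\<^bsub>T\<^esub> h (indet i) \<otimes>\<^bsub>T\<^esub> h' (g i))"
      unfolding hs h's by (rule T.finsum_minus) (auto simp: indet_closed gc)
    also have "\<dots> \<in> G (Suc k)"
    proof (rule T.G_finsum)
      fix i assume "i \<in> {..<N}"
      then have i: "i < N" by simp
      have "a \<otimes>\<^bsub>T\<^esub> b \<ominus>\<^bsub>T\<^esub> a \<otimes>\<^bsub>T\<^esub> c = a \<otimes>\<^bsub>T\<^esub> (b \<ominus>\<^bsub>T\<^esub> c)"
        if [simp]: "a \<in> carrier T" "b \<in> carrier T" "c \<in> carrier T" for a b c
        by (simp add: T.ring_identity_simps)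
      from this[of "h (indet i)" "h (g i)" "h' (g i)"]
      show "h (indet i) \<otimes>\<^bsub>T\<^esub> h (g i) \<ominus>\<^bsub>T\<^esub> h (indet i) \<otimes>\<^bsub>T\<^esub> h' (g i) \<in> G (Suc k)"
        using T.G_mult[OF assms(4)[OF i] Suc.IH[OF gc[OF i]]] i indet_closed gc by simp
    qed
    finally have "h ?s \<ominus>\<^bsub>T\<^esub> h' ?s \<in> G (Suc k)" .
    moreover have "(a \<oplus>\<^bsub>T\<^esub> c) \<ominus>\<^bsub>T\<^esub> (b \<oplus>\<^bsub>T\<^esub> c) = a \<ominus>\<^bsub>T\<^esub> b"
      if [simp]: "a \<in> carrier T" "b \<in> carrier T" "c \<in> carrier T" for a b c
      by (simp add: T.ring_identity_simps)
    ultimately have "h (?s \<oplus>\<^bsub>P\<^esub> const (f {#})) \<ominus>\<^bsub>T\<^esub> h' (?s \<oplus>\<^bsub>P\<^esub> const (f {#})) \<in> G (Suc k)"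
      using sc cc const P_coeff[OF Suc.prems, of "{#}"] h'.hom_closed[OF cc] by simp
    then show ?case using f by simp
  qed
  then show ?thesis using f by (intro T.G_eqI) auto
qed

section \<open>A complete form of Nakayama's lemma\<close>

lemma (in abelian_monoid) finsum_swap:
  assumes "finite B" "finite I" "\<And>b i. \<lbrakk>b \<in> B; i \<in> I\<rbrakk> \<Longrightarrow> f b i \<in> carrier G"
  shows "(\<Oplus>b\<in>B. \<Oplus>i\<in>I. f b i) = (\<Oplus>i\<in>I. \<Oplus>b\<in>B. f b i)"
  using assms(1,3)
proof (induction B rule: finite_induct)
  case empty
  then show ?case by simp
next
  case (insert b B)
  have "(\<Oplus>b\<in>insert b B. \<Oplus>i\<in>I. f b i) = (\<Oplus>i\<in>I. f b i) \<oplus> (\<Oplus>b\<in>B. \<Oplus>i\<in>I. f b i)"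
    using insert by (intro finsum_insert) (auto intro!: finsum_closed)
  also have "\<dots> = (\<Oplus>i\<in>I. f b i) \<oplus> (\<Oplus>i\<in>I. \<Oplus>b\<in>B. f b i)"
    using insert by simp
  also have "\<dots> = (\<Oplus>i\<in>I. f b i \<oplus> (\<Oplus>b\<in>B. f b i))"
    using insert by (intro finsum_addf[symmetric]) (auto intro!: finsum_closed)
  also have "\<dots> = (\<Oplus>i\<in>I. \<Oplus>b\<in>insert b B. f b i)"
    using insert by (intro finsum_cong' refl finsum_insert[symmetric]) (auto intro!: finsum_closed)
  finally show ?case .
qed

text \<open>
  Iterating the given decomposition expands the remainders in powers of the indeterminates; the
  coefficients of this expansion converge in the power series ring.
\<close>

lemma (in power_series) generate_by_approximation:
  assumes T: "complete_filtered_ring T G" and \<psi>: "\<psi> \<in> ring_hom P T"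
    and \<psi>_indet: "\<And>i. i < N \<Longrightarrow> \<psi> (indet i) \<in> G 1"
    and B: "finite B" "B \<subseteq> carrier T"
    and dec: "\<And>t. t \<in> carrier T \<Longrightarrow> \<exists>c\<in>B \<rightarrow> carrier P. \<exists>d\<in>{..<N} \<rightarrow> carrier T.
      t = (\<Oplus>\<^bsub>T\<^esub>b\<in>B. \<psi> (c b) \<otimes>\<^bsub>T\<^esub> b) \<oplus>\<^bsub>T\<^esub> (\<Oplus>\<^bsub>T\<^esub>i\<in>{..<N}. \<psi> (indet i) \<otimes>\<^bsub>T\<^esub> d i)"
    and t: "t \<in> carrier T"
  shows "\<exists>c\<in>B \<rightarrow> carrier P. t = (\<Oplus>\<^bsub>T\<^esub>b\<in>B. \<psi> (c b) \<otimes>\<^bsub>T\<^esub> b)"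
proof -
  interpret T: complete_filtered_ring T G by fact
  interpret \<psi>: ring_hom_cring P T \<psi> by unfold_locales fact
  note Bc = subsetD[OF B(2)]
  define Q where "Q t p \<longleftrightarrow> fst p \<in> B \<rightarrow> carrier P \<and> snd p \<in> {..<N} \<rightarrow> carrier T \<and>
      t = (\<Oplus>\<^bsub>T\<^esub>b\<in>B. \<psi> (fst p b) \<otimes>\<^bsub>T\<^esub> b) \<oplus>\<^bsub>T\<^esub> (\<Oplus>\<^bsub>T\<^esub>i\<in>{..<N}. \<psi> (indet i) \<otimes>\<^bsub>T\<^esub> snd p i)" for t p
  have "\<forall>t\<in>carrier T. \<exists>p. Q t p"
  proof
    fix t assume "t \<in> carrier T"
    from dec[OF this] obtain c d where "Q t (c, d)" unfolding Q_def by auto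
    then show "\<exists>p. Q t p" by blast
  qed
  then obtain f where f: "\<forall>t\<in>carrier T. Q t (f t)" by (rule bchoice[THEN exE])
  define C D where "C t = fst (f t)" and "D t = snd (f t)" for t
  have CD: "C t \<in> B \<rightarrow> carrier P" "D t \<in> {..<N} \<rightarrow> carrier T"
    and eq: "t = (\<Oplus>\<^bsub>T\<^esub>b\<in>B. \<psi> (C t b) \<otimes>\<^bsub>T\<^esub> b) \<oplus>\<^bsub>T\<^esub> (\<Oplus>\<^bsub>T\<^esub>i\<in>{..<N}. \<psi> (indet i) \<otimes>\<^bsub>T\<^esub> D t i)"
    if "t \<in> carrier T" for t using f[rule_format, OF that] unfolding Q_def C_def D_def by blast+
  have C: "C t b \<in> carrier P" if "t \<in> carrier T" "b \<in> B" for t b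
    by (rule PiE[OF CD(1)[OF that(1)], of b]) (use that in auto)
  have D: "D t i \<in> carrier T" if "t \<in> carrier T" "i < N" for t i
    by (rule PiE[OF CD(2)[OF that(1)], of i]) (use that in auto)
  \<comment> \<open>\<open>S k t b\<close> is the coefficient of b in the expansion of t to k
    levels. The recursion passes to the remainders \<open>D t i\<close> of t instead of refining the
    last level, so the inductions below vary t.\<close>
  define S where "S = rec_nat (\<lambda>t b. \<zero>\<^bsub>P\<^esub>)
    (\<lambda>_ s t b. C t b \<oplus>\<^bsub>P\<^esub> (\<Oplus>\<^bsub>P\<^esub>i\<in>{..<N}. indet i \<otimes>\<^bsub>P\<^esub> s (D t i) b))"
  have S0: "S 0 t b = \<zero>\<^bsub>P\<^esub>"
    and SS: "S (Suc k) t b = C t b \<oplus>\<^bsub>P\<^esub> (\<Oplus>\<^bsub>P\<^esub>i\<in>{..<N}. indet i \<otimes>\<^bsub>P\<^esub> S k (D t i) b)" for k t b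
    by (simp_all add: S_def)
  have S: "S k t b \<in> carrier P" if "t \<in> carrier T" "b \<in> B" for k t b
    using that
  proof (induction k arbitrary: t)
    case (Suc k)
    have "(\<Oplus>\<^bsub>P\<^esub>i\<in>{..<N}. indet i \<otimes>\<^bsub>P\<^esub> S k (D t i) b) \<in> carrier P"
      using Suc D by (intro P.finsum_closed) (auto intro!: P.m_closed indet_closed)
    then show ?case unfolding SS using C Suc.prems by blast
  qed (simp add: S0)
  have cauchy: "S (Suc k) t b \<ominus>\<^bsub>P\<^esub> S k t b \<in> order_ge k" if "t \<in> carrier T" "b \<in> B" for k t b
    using that
  proof (induction k arbitrary: t)
    case 0
    then show ?case using S[of t b 1] by (simp add: S0 P.G_0)
  next
    case (Suc k)
    let ?f = "\<lambda>k i. indet i \<otimes>\<^bsub>P\<^esub> S k (D t i) b"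
    have fc: "?f k i \<in> carrier P" if "i < N" for k i
      using that Suc.prems D S by (intro P.m_closed indet_closed) auto
    have sc: "(\<Oplus>\<^bsub>P\<^esub>i\<in>{..<N}. ?f k i) \<in> carrier P" for k
      using fc by (intro P.finsum_closed) auto
    have "(a \<oplus>\<^bsub>P\<^esub> x) \<ominus>\<^bsub>P\<^esub> (a \<oplus>\<^bsub>P\<^esub> y) = x \<ominus>\<^bsub>P\<^esub> y"
      if [simp]: "a \<in> carrier P" "x \<in> carrier P" "y \<in> carrier P" for a x y
      by (simp add: P.ring_identity_simps)
    from this[OF C[OF Suc.prems] sc[of "Suc k"] sc[of k]]
    have "S (Suc (Suc k)) t b \<ominus>\<^bsub>P\<^esub> S (Suc k) t b
        = (\<Oplus>\<^bsub>P\<^esub>i\<in>{..<N}. ?f (Suc k) i) \<ominus>\<^bsub>P\<^esub> (\<Oplus>\<^bsub>P\<^esub>i\<in>{..<N}. ?f k i)"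
      unfolding SS[of "Suc k"] SS[of k] .
    also have "\<dots> = (\<Oplus>\<^bsub>P\<^esub>i\<in>{..<N}. ?f (Suc k) i \<ominus>\<^bsub>P\<^esub> ?f k i)"
      using fc by (intro P.finsum_minus) auto
    also have "\<dots> \<in> order_ge (Suc k)"
    proof (rule P.G_finsum)
      fix i assume "i \<in> {..<N}"
      then have i: "i < N" by simp
      note Dt = D[OF Suc.prems(1) i]
      have "?f (Suc k) i \<ominus>\<^bsub>P\<^esub> ?f k i = indet i \<otimes>\<^bsub>P\<^esub> (S (Suc k) (D t i) b \<ominus>\<^bsub>P\<^esub> S k (D t i) b)"
        using indet_closed[OF i] S[OF Dt Suc.prems(2)] by (simp add: P.minus_eq P.r_distr P.r_minus)
      then show "?f (Suc k) i \<ominus>\<^bsub>P\<^esub> ?f k i \<in> order_ge (Suc k)"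
        using P.G_mult[OF indet_order[OF i] Suc.IH[OF Dt Suc.prems(2)]] by simp
    qed
    finally show ?case .
  qed
  define L where "L c = (\<Oplus>\<^bsub>T\<^esub>b\<in>B. \<psi> (c b) \<otimes>\<^bsub>T\<^esub> b)" for c
  have Lc: "L c \<in> carrier T" if "\<And>b. b \<in> B \<Longrightarrow> c b \<in> carrier P" for c
    unfolding L_def using that Bc by (intro T.finsum_closed) auto
  \<comment> \<open>The error of t after k + 1 levels is the combination of the images of the
    indeterminates with the errors of the \<open>D t i\<close> after k levels, hence lies one step
    deeper in the filtration.\<close>
  have rem: "t \<ominus>\<^bsub>T\<^esub> L (S k t) \<in> G k" if "t \<in> carrier T" for k t
    using that
  proof (induction k arbitrary: t)
    case 0
    then show ?case using Lc[of "S 0 t"] S by (simp add: T.G_0)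
  next
    case (Suc k)
    note t = Suc.prems
    let ?x = "\<lambda>i. \<psi> (indet i)"
    have xc: "?x i \<in> carrier T" if "i < N" for i using indet_closed that by simp
    have Dt: "D t i \<in> carrier T" if "i < N" for i using D t that by simp
    have LS: "L (S k (D t i)) \<in> carrier T" if "i < N" for i using Lc S Dt that by simp
    have "L (S (Suc k) t) = (\<Oplus>\<^bsub>T\<^esub>b\<in>B. \<psi> (C t b) \<otimes>\<^bsub>T\<^esub> b \<oplus>\<^bsub>T\<^esub>
        (\<Oplus>\<^bsub>T\<^esub>i\<in>{..<N}. ?x i \<otimes>\<^bsub>T\<^esub> (\<psi> (S k (D t i) b) \<otimes>\<^bsub>T\<^esub> b)))"
      unfolding L_def
    proof (intro T.finsum_cong' refl)
      fix b assume b: "b \<in> B"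
      have bc: "b \<in> carrier T" using Bc b .
      have sc: "S k (D t i) b \<in> carrier P" if "i < N" for i using S Dt b that by simp
      have "\<psi> (\<Oplus>\<^bsub>P\<^esub>i\<in>{..<N}. indet i \<otimes>\<^bsub>P\<^esub> S k (D t i) b)
          = (\<Oplus>\<^bsub>T\<^esub>i\<in>{..<N}. ?x i \<otimes>\<^bsub>T\<^esub> \<psi> (S k (D t i) b))"
        using sc indet_closed by (subst \<psi>.hom_finsum) (auto simp: o_def intro!: T.finsum_cong')
      then have "\<psi> (S (Suc k) t b) \<otimes>\<^bsub>T\<^esub> b = \<psi> (C t b) \<otimes>\<^bsub>T\<^esub> b \<oplus>\<^bsub>T\<^esub>
          (\<Oplus>\<^bsub>T\<^esub>i\<in>{..<N}. ?x i \<otimes>\<^bsub>T\<^esub> \<psi> (S k (D t i) b)) \<otimes>\<^bsub>T\<^esub> b"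
        unfolding SS using C[OF t b] sc indet_closed bc xc
        by (subst \<psi>.hom_add) (auto simp: T.l_distr intro!: P.finsum_closed T.finsum_closed)
      also have "(\<Oplus>\<^bsub>T\<^esub>i\<in>{..<N}. ?x i \<otimes>\<^bsub>T\<^esub> \<psi> (S k (D t i) b)) \<otimes>\<^bsub>T\<^esub> b
          = (\<Oplus>\<^bsub>T\<^esub>i\<in>{..<N}. ?x i \<otimes>\<^bsub>T\<^esub> (\<psi> (S k (D t i) b) \<otimes>\<^bsub>T\<^esub> b))"
        using sc xc bc by (subst T.finsum_ldistr) (auto simp: T.m_assoc intro!: T.finsum_cong')
      finally show "\<psi> (S (Suc k) t b) \<otimes>\<^bsub>T\<^esub> b = \<psi> (C t b) \<otimes>\<^bsub>T\<^esub> b \<oplus>\<^bsub>T\<^esub>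
          (\<Oplus>\<^bsub>T\<^esub>i\<in>{..<N}. ?x i \<otimes>\<^bsub>T\<^esub> (\<psi> (S k (D t i) b) \<otimes>\<^bsub>T\<^esub> b))" .
    qed (use C[OF t] S[OF Dt] xc Bc in \<open>auto intro!: T.finsum_closed\<close>)
    also have "\<dots> = L (C t) \<oplus>\<^bsub>T\<^esub>
        (\<Oplus>\<^bsub>T\<^esub>b\<in>B. \<Oplus>\<^bsub>T\<^esub>i\<in>{..<N}. ?x i \<otimes>\<^bsub>T\<^esub> (\<psi> (S k (D t i) b) \<otimes>\<^bsub>T\<^esub> b))"
      unfolding L_def using C[OF t] S[OF Dt] xc Bc
      by (intro T.finsum_addf) (auto intro!: T.finsum_closed)
    also have "(\<Oplus>\<^bsub>T\<^esub>b\<in>B. \<Oplus>\<^bsub>T\<^esub>i\<in>{..<N}. ?x i \<otimes>\<^bsub>T\<^esub> (\<psi> (S k (D t i) b) \<otimes>\<^bsub>T\<^esub> b))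
        = (\<Oplus>\<^bsub>T\<^esub>i\<in>{..<N}. \<Oplus>\<^bsub>T\<^esub>b\<in>B. ?x i \<otimes>\<^bsub>T\<^esub> (\<psi> (S k (D t i) b) \<otimes>\<^bsub>T\<^esub> b))"
      using S[OF Dt] xc Bc B by (intro T.finsum_swap) auto
    also have "\<dots> = (\<Oplus>\<^bsub>T\<^esub>i\<in>{..<N}. ?x i \<otimes>\<^bsub>T\<^esub> L (S k (D t i)))"
      unfolding L_def using S[OF Dt] xc Bc B
      by (intro T.finsum_cong' refl T.finsum_rdistr[symmetric]) (auto intro!: T.finsum_closed T.m_closed)
    finally have L1: "L (S (Suc k) t) = L (C t) \<oplus>\<^bsub>T\<^esub> (\<Oplus>\<^bsub>T\<^esub>i\<in>{..<N}. ?x i \<otimes>\<^bsub>T\<^esub> L (S k (D t i)))" .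
    let ?u = "\<Oplus>\<^bsub>T\<^esub>i\<in>{..<N}. ?x i \<otimes>\<^bsub>T\<^esub> D t i" and ?v = "\<Oplus>\<^bsub>T\<^esub>i\<in>{..<N}. ?x i \<otimes>\<^bsub>T\<^esub> L (S k (D t i))"
    have uv: "L (C t) \<in> carrier T" "?u \<in> carrier T" "?v \<in> carrier T"
      using Lc C[OF t] xc Dt LS by (auto intro!: T.finsum_closed)
    have "t = L (C t) \<oplus>\<^bsub>T\<^esub> ?u" unfolding L_def by (rule eq[OF t])
    then have t_eq: "t \<ominus>\<^bsub>T\<^esub> L (S (Suc k) t) = (L (C t) \<oplus>\<^bsub>T\<^esub> ?u) \<ominus>\<^bsub>T\<^esub> (L (C t) \<oplus>\<^bsub>T\<^esub> ?v)"
      unfolding L1 by (rule arg_cong[where f = "\<lambda>z. z \<ominus>\<^bsub>T\<^esub> (L (C t) \<oplus>\<^bsub>T\<^esub> ?v)"])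
    have "(a \<oplus>\<^bsub>T\<^esub> x) \<ominus>\<^bsub>T\<^esub> (a \<oplus>\<^bsub>T\<^esub> y) = x \<ominus>\<^bsub>T\<^esub> y"
      if [simp]: "a \<in> carrier T" "x \<in> carrier T" "y \<in> carrier T" for a x y
      by (simp add: T.ring_identity_simps)
    from this[OF uv] have "t \<ominus>\<^bsub>T\<^esub> L (S (Suc k) t) = ?u \<ominus>\<^bsub>T\<^esub> ?v" unfolding t_eq .
    also have "\<dots> = (\<Oplus>\<^bsub>T\<^esub>i\<in>{..<N}. ?x i \<otimes>\<^bsub>T\<^esub> D t i \<ominus>\<^bsub>T\<^esub> ?x i \<otimes>\<^bsub>T\<^esub> L (S k (D t i)))"
      using xc Dt LS by (intro T.finsum_minus) auto
    also have "\<dots> \<in> G (Suc k)"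
    proof (rule T.G_finsum)
      fix i assume "i \<in> {..<N}"
      then have i: "i < N" by simp
      have "?x i \<otimes>\<^bsub>T\<^esub> D t i \<ominus>\<^bsub>T\<^esub> ?x i \<otimes>\<^bsub>T\<^esub> L (S k (D t i)) = ?x i \<otimes>\<^bsub>T\<^esub> (D t i \<ominus>\<^bsub>T\<^esub> L (S k (D t i)))"
        using xc[OF i] Dt[OF i] LS[OF i] by (simp add: T.minus_eq T.r_distr T.r_minus)
      then show "?x i \<otimes>\<^bsub>T\<^esub> D t i \<ominus>\<^bsub>T\<^esub> ?x i \<otimes>\<^bsub>T\<^esub> L (S k (D t i)) \<in> G (Suc k)"
        using T.G_mult[OF \<psi>_indet[OF i] Suc.IH[OF Dt[OF i]]] by simp
    qed
    finally show ?case .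
  qed
  have "\<exists>c. \<forall>b\<in>B. c b \<in> carrier P \<and> (\<forall>k. c b \<ominus>\<^bsub>P\<^esub> S k t b \<in> order_ge k)"
  proof (intro bchoice ballI)
    fix b assume "b \<in> B"
    then show "\<exists>x. x \<in> carrier P \<and> (\<forall>k. x \<ominus>\<^bsub>P\<^esub> S k t b \<in> order_ge k)"
      using P.G_complete[of "\<lambda>k. S k t b"] S[OF t] cauchy[OF t] by blast
  qed
  then obtain c where c: "\<And>b. b \<in> B \<Longrightarrow> c b \<in> carrier P"
    and lim: "\<And>b k. b \<in> B \<Longrightarrow> c b \<ominus>\<^bsub>P\<^esub> S k t b \<in> order_ge k" by blast
  have Lcc: "L c \<in> carrier T" using Lc[of c] c by blast
  have LSk: "L (S k t) \<in> carrier T" for k using Lc[of "S k t"] S[OF t] by blast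
  have "t = L c"
  proof (rule T.G_eqI[OF t Lcc])
    fix k
    have "L c \<ominus>\<^bsub>T\<^esub> L (S k t) = (\<Oplus>\<^bsub>T\<^esub>b\<in>B. \<psi> (c b) \<otimes>\<^bsub>T\<^esub> b \<ominus>\<^bsub>T\<^esub> \<psi> (S k t b) \<otimes>\<^bsub>T\<^esub> b)"
      unfolding L_def using B c S[OF t] Bc by (intro T.finsum_minus) auto
    also have "\<dots> \<in> G k"
    proof (rule T.G_finsum)
      fix b assume b: "b \<in> B"
      have "\<psi> (c b) \<otimes>\<^bsub>T\<^esub> b \<ominus>\<^bsub>T\<^esub> \<psi> (S k t b) \<otimes>\<^bsub>T\<^esub> b = \<psi> (c b \<ominus>\<^bsub>P\<^esub> S k t b) \<otimes>\<^bsub>T\<^esub> b"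
        using c[OF b] S[OF t b] Bc[OF b] by (simp add: T.minus_eq P.minus_eq T.l_distr T.l_minus)
      then show "\<psi> (c b) \<otimes>\<^bsub>T\<^esub> b \<ominus>\<^bsub>T\<^esub> \<psi> (S k t b) \<otimes>\<^bsub>T\<^esub> b \<in> G k"
        using hom_order_ge[OF T \<psi> \<psi>_indet lim[OF b]] Bc[OF b] T.G_rmult by simp
    qed
    finally have "L c \<ominus>\<^bsub>T\<^esub> L (S k t) \<in> G k" .
    then show "t \<ominus>\<^bsub>T\<^esub> L c \<in> G k"
      by (rule T.G_diff_trans[OF t LSk Lcc rem[OF t] T.G_diff_sym[OF Lcc LSk]])
  qed
  then show ?thesis unfolding L_def using c by (intro bexI[of _ c]) auto
qed

section \<open>Lifting homomorphisms of fields\<close>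

lemma (in cring) binomial_finsum:
  assumes x: "x \<in> carrier R" and y: "y \<in> carrier R"
  shows "(x \<oplus> y) [^] (n::nat) = (\<Oplus>k\<in>{..n}. [(n choose k)] \<cdot> (x [^] k \<otimes> y [^] (n - k)))"
proof (induction n)
  case 0
  then show ?case using x y by simp
next
  case (Suc n)
  note [simp] = x y
  let ?t = "\<lambda>n k. x [^] (k::nat) \<otimes> y [^] ((n::nat) - k)"
  let ?A = "\<Oplus>k\<in>{..n}. [(n choose k)] \<cdot> ?t (Suc n) (Suc k)"
  let ?B = "\<Oplus>k\<in>{..n}. [(n choose Suc k)] \<cdot> ?t (Suc n) (Suc k)"
  let ?C = "\<Oplus>k\<in>{..n}. [(n choose k)] \<cdot> ?t (Suc n) k"
  have [simp]: "?A \<in> carrier R" "?B \<in> carrier R" "?C \<in> carrier R" by (auto intro!: finsum_closed)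
  have "?C = (\<Oplus>k\<in>{..Suc n}. [(n choose k)] \<cdot> ?t (Suc n) k)"
    by (subst finsum_Suc) (auto simp: binomial_eq_0)
  also have "\<dots> = ?B \<oplus> y [^] Suc n"
    by (subst finsum_Suc2) auto
  finally have C: "?C = ?B \<oplus> y [^] Suc n" .
  have "(\<Oplus>k\<in>{..Suc n}. [(Suc n choose k)] \<cdot> ?t (Suc n) k)
      = (\<Oplus>k\<in>{..n}. [(Suc n choose Suc k)] \<cdot> ?t (Suc n) (Suc k)) \<oplus> y [^] Suc n"
    by (subst finsum_Suc2) auto
  also have "(\<Oplus>k\<in>{..n}. [(Suc n choose Suc k)] \<cdot> ?t (Suc n) (Suc k)) = ?A \<oplus> ?B"
    by (subst finsum_addf[symmetric]) (auto simp: add.nat_pow_mult intro!: finsum_cong')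
  finally have R: "(\<Oplus>k\<in>{..Suc n}. [(Suc n choose k)] \<cdot> ?t (Suc n) k) = ?A \<oplus> ?C"
    unfolding C by (simp add: a_assoc)
  have "(\<Oplus>k\<in>{..n}. [(n choose k)] \<cdot> ?t n k) \<otimes> x = ?A"
    by (subst finsum_ldistr) (auto simp: add_pow_ldistr add_pow_rdistr m_ac intro!: finsum_cong')
  moreover have "(\<Oplus>k\<in>{..n}. [(n choose k)] \<cdot> ?t n k) \<otimes> y = ?C"
    by (subst finsum_ldistr) (auto simp: add_pow_ldistr m_assoc Suc_diff_le intro!: finsum_cong')
  ultimately have "(x \<oplus> y) [^] Suc n = ?A \<oplus> ?C"
    by (simp add: Suc.IH r_distr)
  then show ?case using R by simp
qed

lemma (in cring) add_pow_one_mult: "x \<in> carrier R \<Longrightarrow> [(n::nat)] \<cdot> x = [n] \<cdot> \<one> \<otimes> x"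
  by (simp add: add_pow_ldistr)

lemma (in cring) frobenius_add:
  assumes "Factorial_Ring.prime (p::nat)" "[p] \<cdot> \<one> = \<zero>" and x: "x \<in> carrier R" and y: "y \<in> carrier R"
  shows "(x \<oplus> y) [^] p = x [^] p \<oplus> y [^] p"
proof -
  note [simp] = x y
  let ?t = "\<lambda>k. [(p choose k)] \<cdot> (x [^] k \<otimes> y [^] (p - k))"
  \<comment> \<open>Writing p as q + 2 separates the two extreme terms of the binomial sum from
    those whose coefficient is divisible by p.\<close>
  obtain q where p: "p = Suc (Suc q)"
    using prime_ge_2_nat[OF assms(1)] by (metis Suc_le_D numeral_2_eq_2 Suc_le_mono)
  have zero: "?t (Suc k) = \<zero>" if "k \<le> q" for k
  proof -
    have "p dvd (p choose Suc k)"
      by (rule dvd_choose_prime) (use that p assms(1) in auto)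
    then obtain r where r: "p choose Suc k = p * r" by (auto elim: dvdE)
    have "[(p choose Suc k)] \<cdot> \<one> = [r] \<cdot> ([p] \<cdot> \<one>)"
      unfolding r by (rule add.nat_pow_pow[symmetric]) simp
    then have "[(p choose Suc k)] \<cdot> \<one> = \<zero>" using assms(2) by simp
    then show ?thesis
      by (subst add_pow_one_mult) auto
  qed
  have "(x \<oplus> y) [^] p = (\<Oplus>k\<in>{..Suc (Suc q)}. ?t k)"
    using binomial_finsum[OF x y, of p] p by simp
  also have "\<dots> = ?t (Suc (Suc q)) \<oplus> ((\<Oplus>k\<in>{..q}. ?t (Suc k)) \<oplus> ?t 0)"
    by (subst finsum_Suc, force, subst finsum_Suc2, force) simp
  also have "(\<Oplus>k\<in>{..q}. ?t (Suc k)) = \<zero>"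
    by (intro add.finprod_one_eqI) (use zero in auto)
  finally show ?thesis using p by simp
qed

lemma (in cring) frobenius_uminus:
  assumes "Factorial_Ring.prime (p::nat)" "[p] \<cdot> \<one> = \<zero>" and x: "x \<in> carrier R"
  shows "(\<ominus> x) [^] p = \<ominus> (x [^] p)"
proof -
  have "p \<noteq> 0" using assms(1) by auto
  then have "(\<ominus> x) [^] p \<oplus> x [^] p = \<zero>"
    using frobenius_add[OF assms(1,2), of "\<ominus> x" x] x by (simp add: l_neg nat_pow_zero)
  then show ?thesis using x by (simp add: minus_equality)
qed

section \<open>Polynomial values and first-order Taylor expansion\<close>

lemma (in cring) taylor_pow:
  assumes I: "ideal I R" and e: "e \<in> carrier R" and h: "h \<in> carrier R" "h \<otimes> h \<in> I"
  shows "\<exists>r\<in>I. (e \<oplus> h) [^] (Suc n) = e [^] Suc n \<oplus> h \<otimes> ([Suc n] \<cdot> \<one> \<otimes> e [^] n) \<oplus> r"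
proof -
  interpret I: ideal I R by fact
  note [simp] = e h(1)
  show ?thesis
  proof (induction n)
    case 0
    then show ?case by (intro bexI[of _ \<zero>]) auto
  next
    case (Suc n)
    then obtain r where r: "r \<in> I"
      "(e \<oplus> h) [^] (Suc n) = e [^] Suc n \<oplus> h \<otimes> ([Suc n] \<cdot> \<one> \<otimes> e [^] n) \<oplus> r" by blast
    have [simp]: "r \<in> carrier R" using r(1) by (rule I.Icarr)
    have "(a \<otimes> e \<oplus> h \<otimes> (b \<otimes> a) \<oplus> r) \<otimes> (e \<oplus> h)
       = a \<otimes> e \<otimes> e \<oplus> h \<otimes> ((b \<oplus> \<one>) \<otimes> (a \<otimes> e)) \<oplus> (r \<otimes> (e \<oplus> h) \<oplus> h \<otimes> h \<otimes> (b \<otimes> a))"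
      if [simp]: "a \<in> carrier R" "b \<in> carrier R" for a b
      by (simp add: ring_identity_simps)
    from this[of "e [^] n" "[Suc n] \<cdot> \<one>"]
    have "(e \<oplus> h) [^] Suc (Suc n) = e [^] Suc (Suc n) \<oplus> h \<otimes> ([Suc (Suc n)] \<cdot> \<one> \<otimes> e [^] Suc n)
        \<oplus> (r \<otimes> (e \<oplus> h) \<oplus> h \<otimes> h \<otimes> ([Suc n] \<cdot> \<one> \<otimes> e [^] n))"
      using r(2) by simp
    moreover have "r \<otimes> (e \<oplus> h) \<oplus> h \<otimes> h \<otimes> ([Suc n] \<cdot> \<one> \<otimes> e [^] n) \<in> I"
      by (rule I.a_closed; rule I.I_r_closed) (use r(1) h(2) in auto)
    ultimately show ?case by blast
  qed
qed

text \<open>The value at e of a polynomial of degree less than n. The coefficients form a function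
  on all naturals, so that n can vary while c stays the same.\<close>

definition (in ring) comb :: "nat \<Rightarrow> (nat \<Rightarrow> 'a) \<Rightarrow> 'a \<Rightarrow> 'a" where
  "comb n c e = (\<Oplus>i\<in>{..<n}. c i \<otimes> e [^] i)"

context cring begin

lemma comb_0: "comb 0 c e = \<zero>"
  by (simp add: comb_def)

lemma comb_Suc:
  assumes "\<And>i. c i \<in> carrier R" "e \<in> carrier R"
  shows "comb (Suc n) c e = c n \<otimes> e [^] n \<oplus> comb n c e"
  unfolding comb_def lessThan_Suc using assms by (subst finsum_insert) auto

lemma comb_closed: "\<lbrakk>\<And>i. c i \<in> carrier R; e \<in> carrier R\<rbrakk> \<Longrightarrow> comb n c e \<in> carrier R"
  unfolding comb_def by (intro finsum_closed) auto

lemma comb_add: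
  assumes "\<And>i. c i \<in> carrier R" "\<And>i. d i \<in> carrier R" "e \<in> carrier R"
  shows "comb n (\<lambda>i. c i \<oplus> d i) e = comb n c e \<oplus> comb n d e"
  unfolding comb_def using assms
  by (subst finsum_addf[symmetric]) (auto simp: l_distr intro!: finsum_cong')

lemma comb_smult:
  assumes "\<And>i. c i \<in> carrier R" "a \<in> carrier R" "e \<in> carrier R"
  shows "comb n (\<lambda>i. a \<otimes> c i) e = a \<otimes> comb n c e"
  unfolding comb_def using assms
  by (subst finsum_rdistr) (auto simp: m_assoc intro!: finsum_cong')

lemma comb_mem_ideal:
  assumes "ideal I R" "e \<in> carrier R" "\<And>i. i < n \<Longrightarrow> c i \<in> I"
  shows "comb n c e \<in> I"
  unfolding comb_def
proof (rule additive_subgroup.finsum_mem[OF ideal.axioms(1)[OF assms(1)] ring_axioms])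
  fix i assume "i \<in> {..<n}"
  then show "c i \<otimes> e [^] i \<in> I" using assms by (intro ideal.I_r_closed[OF assms(1)]) auto
qed

lemma comb_shift:
  assumes "\<And>i. c i \<in> carrier R" "e \<in> carrier R"
  shows "e \<otimes> comb n c e = comb (Suc n) (case_nat \<zero> c) e"
proof (induction n)
  case 0
  have "case_nat \<zero> c i \<in> carrier R" for i using assms by (cases i) auto
  then show ?case using assms by (subst comb_Suc) (auto simp: comb_0)
next
  case (Suc n)
  have cc: "case_nat \<zero> c i \<in> carrier R" for i using assms by (cases i) auto
  note [simp] = assms comb_closed[OF assms]
  have "e \<otimes> comb (Suc n) c e = e \<otimes> (c n \<otimes> e [^] n) \<oplus> e \<otimes> comb n c e"
    by (simp add: comb_Suc[OF assms] r_distr)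
  also have "\<dots> = comb (Suc (Suc n)) (case_nat \<zero> c) e"
    unfolding Suc.IH by (subst (2) comb_Suc[OF cc assms(2)]) (simp add: m_ac)
  finally show ?case .
qed

lemma comb_diff_mem:
  assumes I: "ideal I R" and c: "\<And>i. c i \<in> carrier R" and e: "e \<in> carrier R" and h: "h \<in> I"
  shows "comb n c (e \<oplus> h) \<ominus> comb n c e \<in> I"
proof -
  interpret I: ideal I R by fact
  note [simp] = c e I.Icarr[OF h] comb_closed[of c]
  show ?thesis
  proof (induction n)
    case 0
    then show ?case by (simp add: comb_0 minus_eq)
  next
    case (Suc n)
    have hh: "(e \<oplus> h) [^] n \<ominus> e [^] n \<in> I" for n :: nat
    proof (induction n)
      case 0
      then show ?case by (simp add: minus_eq r_neg)
    next
      case (Suc n)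
      have "a \<otimes> (e \<oplus> h) \<ominus> b \<otimes> e = (a \<ominus> b) \<otimes> e \<oplus> a \<otimes> h"
        if [simp]: "a \<in> carrier R" "b \<in> carrier R" for a b
        by (simp add: ring_identity_simps)
      from this[of "(e \<oplus> h) [^] n" "e [^] n"] show ?case
        using I.I_r_closed[OF Suc.IH e] I.I_l_closed[OF h, of "(e \<oplus> h) [^] n"] I.a_closed by simp
    qed
    have "(z \<otimes> u \<oplus> a) \<ominus> (z \<otimes> v \<oplus> b) = z \<otimes> (u \<ominus> v) \<oplus> (a \<ominus> b)"
      if [simp]: "a \<in> carrier R" "b \<in> carrier R" "u \<in> carrier R" "v \<in> carrier R" "z \<in> carrier R"
      for a b u v z
      by (simp add: ring_identity_simps)
    from this[of "comb n c (e \<oplus> h)" "comb n c e" "(e \<oplus> h) [^] n" "e [^] n" "c n"] show ?case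
      using I.I_l_closed[OF hh, of "c n"] Suc.IH I.a_closed by (simp add: comb_Suc)
  qed
qed

text \<open>All terms of second and higher order in h are multiples of h^2 and fall into I. The
  factor of h is the formal derivative at e, of degree below n because the polynomial itself has
  degree at most n. This is the expansion behind the Newton step.\<close>

lemma taylor_comb:
  assumes I: "ideal I R" and c: "\<And>i. c i \<in> carrier R" and e: "e \<in> carrier R"
    and h: "h \<in> carrier R" "h \<otimes> h \<in> I"
  shows "\<exists>r\<in>I. comb (Suc n) c (e \<oplus> h)
    = comb (Suc n) c e \<oplus> h \<otimes> comb n (\<lambda>i. [Suc i] \<cdot> \<one> \<otimes> c (Suc i)) e \<oplus> r"
proof -
  interpret I: ideal I R by fact
  note [simp] = c e h(1) comb_closed[of c]
  let ?d = "\<lambda>i. [Suc i] \<cdot> \<one> \<otimes> c (Suc i)"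
  have d [simp]: "?d i \<in> carrier R" for i by simp
  note [simp del] = add.nat_pow_Suc nat_pow_Suc
  show ?thesis
  proof (induction n)
    case 0
    then show ?case by (intro bexI[of _ \<zero>]) (auto simp: comb_Suc comb_0)
  next
    case (Suc n)
    then obtain r where r: "r \<in> I" "comb (Suc n) c (e \<oplus> h) = comb (Suc n) c e \<oplus> h \<otimes> comb n ?d e \<oplus> r"
      by blast
    obtain s where s: "s \<in> I"
      "(e \<oplus> h) [^] Suc n = e [^] Suc n \<oplus> h \<otimes> ([Suc n] \<cdot> \<one> \<otimes> e [^] n) \<oplus> s"
      using taylor_pow[OF I e h] by blast
    have [simp]: "r \<in> carrier R" "s \<in> carrier R" "comb n ?d e \<in> carrier R"
      using r(1) s(1) I.Icarr by (auto intro!: comb_closed)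
    have "z \<otimes> (a \<oplus> h \<otimes> (m \<otimes> b) \<oplus> s) \<oplus> (u \<oplus> h \<otimes> v \<oplus> r)
        = z \<otimes> a \<oplus> u \<oplus> h \<otimes> (m \<otimes> z \<otimes> b \<oplus> v) \<oplus> (z \<otimes> s \<oplus> r)"
      if [simp]: "a \<in> carrier R" "b \<in> carrier R" "u \<in> carrier R" "v \<in> carrier R" "z \<in> carrier R"
        "m \<in> carrier R" for a b u v z m
      by (simp add: ring_identity_simps)
    note ident = this
    define p p' where "p = e [^] Suc n" and "p' = (e \<oplus> h) [^] Suc n"
    have [simp]: "p \<in> carrier R" "p' \<in> carrier R" unfolding p_def p'_def by simp_all
    have "comb (Suc (Suc n)) c (e \<oplus> h) = c (Suc n) \<otimes> p' \<oplus> comb (Suc n) c (e \<oplus> h)"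
      "comb (Suc (Suc n)) c e = c (Suc n) \<otimes> p \<oplus> comb (Suc n) c e"
      "comb (Suc n) ?d e = ?d n \<otimes> e [^] n \<oplus> comb n ?d e"
      unfolding p_def p'_def by (rule comb_Suc; simp)+
    then have "comb (Suc (Suc n)) c (e \<oplus> h)
      = comb (Suc (Suc n)) c e \<oplus> h \<otimes> comb (Suc n) ?d e \<oplus> (c (Suc n) \<otimes> s \<oplus> r)"
      using ident[of p "e [^] n" "comb (Suc n) c e" "comb n ?d e" "c (Suc n)" "[Suc n] \<cdot> \<one>"]
      by (simp add: r(2) s(2)[folded p_def p'_def])
    moreover have "c (Suc n) \<otimes> s \<oplus> r \<in> I" using r(1) s(1) by (intro I.a_closed I.I_l_closed) auto
    ultimately show ?case by blast
  qed
qed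

end

text \<open>
  A maximal subring \<open>L\<close> meeting \<open>I\<close> only in \<open>I'\<close> and containing all \<open>q\<close>-th powers represents every
  residue of \<open>E\<close> modulo \<open>I\<close>. Let \<open>f\<close> be the minimal polynomial of the residue of \<open>e\<close>. If \<open>f' e\<close> is a
  unit, one Newton step turns \<open>e\<close> into a root of \<open>f\<close> modulo \<open>I'\<close>. Otherwise \<open>f\<close> has degree \<open>q\<close>, the
  characteristic, and \<open>e\<^sup>q \<in> L\<close>. In characteristic zero one takes \<open>q = 0\<close>, so that \<open>power\<close> is void.
\<close>

locale square_zero_lift = cring R for R (structure) +
  fixes E I I' L :: "'a set" and q :: nat
  assumes E: "subring E R" and I: "ideal I R" and I': "ideal I' R"
    and I'_I: "I' \<subseteq> I" and I_E: "I \<subseteq> E"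
    and sq: "\<lbrakk>a \<in> I; b \<in> I\<rbrakk> \<Longrightarrow> a \<otimes> b \<in> I'"
    and one: "\<one> \<notin> I"
    and inverse: "\<lbrakk>e \<in> E; e \<notin> I\<rbrakk> \<Longrightarrow> \<exists>u\<in>E. e \<otimes> u = \<one>"
    and char: "(\<forall>n::nat. 0 < n \<longrightarrow> [n] \<cdot> \<one> \<notin> I) \<or> Factorial_Ring.prime q \<and> [q] \<cdot> \<one> = \<zero>"
    and L: "subring L R" and I'_L: "I' \<subseteq> L" and L_E: "L \<subseteq> E" and L_I: "L \<inter> I \<subseteq> I'"
    and power: "x \<in> E \<Longrightarrow> x [^] q \<in> L"
    and max: "\<lbrakk>subring L' R; L \<subseteq> L'; L' \<subseteq> E; L' \<inter> I \<subseteq> I'\<rbrakk> \<Longrightarrow> L' \<subseteq> L"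
begin

sublocale I: ideal I R by (rule I)
sublocale I': ideal I' R by (rule I')

lemma E_carrier: "x \<in> E \<Longrightarrow> x \<in> carrier R"
  using subringE(1)[OF E] by blast

lemma L_carrier: "x \<in> L \<Longrightarrow> x \<in> carrier R"
  using subringE(1)[OF L] by blast

lemma not_I_mult:
  assumes "s \<in> E" "t \<in> E" "s \<notin> I" "t \<notin> I"
  shows "s \<otimes> t \<notin> I"
proof
  assume st: "s \<otimes> t \<in> I"
  obtain u where u: "u \<in> E" "s \<otimes> u = \<one>" using inverse assms by blast
  note [simp] = assms(1,2)[THEN E_carrier] u(1)[THEN E_carrier]
  have "u \<otimes> (s \<otimes> t) = (s \<otimes> u) \<otimes> t" by (simp add: m_ac)
  then have "t \<in> I" using u(2) I.I_l_closed[OF st, of u] by simp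
  then show False using assms by blast
qed

text \<open>The fractions of elements of L with denominators in L outside I, taken inside E, form a
  subring. If such a fraction lies in I, so does its numerator, which is then in I', and dividing by
  a unit of E keeps it there. Maximality absorbs these fractions into L.\<close>

lemma L_inverse:
  assumes l: "l \<in> L" "l \<notin> I"
  shows "\<exists>u\<in>L. l \<otimes> u = \<one>"
proof -
  define L' where "L' = {x \<in> E. \<exists>s\<in>L - I. x \<otimes> s \<in> L}"
  have "subring L' R"
  proof (rule subringI)
    show "L' \<subseteq> carrier R" using E_carrier by (auto simp: L'_def)
    have "\<one> \<in> L - I" using subringE(3)[OF L] one by simp
    moreover have "\<one> \<otimes> \<one> \<in> L" using subringE(3)[OF L] by simp
    ultimately show "\<one> \<in> L'" unfolding L'_def using subringE(3)[OF E] by blast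
  next
    fix x assume "x \<in> L'"
    then obtain s where x: "x \<in> E" and s: "s \<in> L - I" "x \<otimes> s \<in> L" by (auto simp: L'_def)
    have "(\<ominus> x) \<otimes> s = \<ominus> (x \<otimes> s)" using E_carrier[OF x] s(1) L_carrier by (simp add: l_minus)
    then have "(\<ominus> x) \<otimes> s \<in> L" using subringE(5)[OF L s(2)] by simp
    then show "\<ominus> x \<in> L'" unfolding L'_def using s(1) subringE(5)[OF E x] by blast
  next
    fix x y assume "x \<in> L'" "y \<in> L'"
    then obtain s t where x: "x \<in> E" and s: "s \<in> L - I" "x \<otimes> s \<in> L"
      and y: "y \<in> E" and t: "t \<in> L - I" "y \<otimes> t \<in> L" by (auto simp: L'_def)
    note [simp] = E_carrier[OF x] E_carrier[OF y]
    have [simp]: "s \<in> carrier R" "t \<in> carrier R" using s t L_carrier by auto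
    have st: "s \<otimes> t \<in> L - I"
      using s(1) t(1) not_I_mult[of s t] L_E subringE(6)[OF L] by auto
    have "x \<otimes> y \<otimes> (s \<otimes> t) = (x \<otimes> s) \<otimes> (y \<otimes> t)" by (simp add: m_ac)
    then have "x \<otimes> y \<otimes> (s \<otimes> t) \<in> L" using subringE(6)[OF L s(2) t(2)] by simp
    then show "x \<otimes> y \<in> L'" unfolding L'_def using st subringE(6)[OF E x y] by blast
    have "(x \<oplus> y) \<otimes> (s \<otimes> t) = (x \<otimes> s) \<otimes> t \<oplus> (y \<otimes> t) \<otimes> s" by (simp add: l_distr r_distr m_ac)
    moreover have "(x \<otimes> s) \<otimes> t \<oplus> (y \<otimes> t) \<otimes> s \<in> L"
      using s t subringE(7)[OF L subringE(6)[OF L s(2), of t] subringE(6)[OF L t(2), of s]] by simp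
    ultimately have "(x \<oplus> y) \<otimes> (s \<otimes> t) \<in> L" by simp
    then show "x \<oplus> y \<in> L'" unfolding L'_def using st subringE(7)[OF E x y] by blast
  qed
  moreover have "L \<subseteq> L'"
  proof
    fix x assume x: "x \<in> L"
    then have "x \<otimes> \<one> \<in> L" using L_carrier by simp
    moreover have "\<one> \<in> L - I" using subringE(3)[OF L] one by simp
    ultimately show "x \<in> L'" unfolding L'_def using x L_E by blast
  qed
  moreover have "L' \<inter> I \<subseteq> I'"
  proof
    fix x assume "x \<in> L' \<inter> I"
    then obtain s where x: "x \<in> E" "x \<in> I" and s: "s \<in> L - I" "x \<otimes> s \<in> L" by (auto simp: L'_def)
    obtain u where u: "u \<in> E" "s \<otimes> u = \<one>" using inverse s(1) L_E by blast
    have c [simp]: "s \<in> carrier R" "u \<in> carrier R" "x \<in> carrier R"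
      using s(1) u(1) x(1) L_carrier E_carrier by auto
    have "x \<otimes> s \<in> I'" using s L_I I.I_r_closed[OF x(2) c(1)] by blast
    then have "(x \<otimes> s) \<otimes> u \<in> I'" by (rule I'.I_r_closed) simp
    then show "x \<in> I'" using u(2) by (simp add: m_assoc)
  qed
  ultimately have L': "L' \<subseteq> L" by (intro max) (auto simp: L'_def)
  obtain u where u: "u \<in> E" "l \<otimes> u = \<one>" using inverse l L_E by blast
  then have "u \<otimes> l \<in> L" using subringE(3)[OF L] m_comm[of u l] E_carrier[OF u(1)] L_carrier[OF l(1)] by simp
  then have "u \<in> L'" using u(1) l by (auto simp: L'_def)
  then show ?thesis using L' u(2) by blast
qed

definition span :: "nat \<Rightarrow> 'a \<Rightarrow> 'a set" where
  "span n e = {comb n c e |c. \<forall>i. c i \<in> L}"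

lemma spanI: "(\<And>i. c i \<in> L) \<Longrightarrow> comb n c e \<in> span n e"
  by (auto simp: span_def)

lemma span_E: "e \<in> E \<Longrightarrow> span n e \<subseteq> E"
proof
  fix x assume e: "e \<in> E" and "x \<in> span n e"
  then obtain c where c: "\<And>i. c i \<in> L" and x: "x = comb n c e" by (auto simp: span_def)
  have pow: "e [^] k \<in> E" for k :: nat
    by (induction k) (use e subringE(3,6)[OF E] in auto)
  have "comb n c e \<in> E"
  proof (induction n)
    case 0
    then show ?case using subringE(2)[OF E] by (simp add: comb_0)
  next
    case (Suc n)
    have "c n \<otimes> e [^] n \<in> E" using subringE(6)[OF E _ pow] c L_E by blast
    then show ?case
      using Suc subringE(7)[OF E] comb_Suc[of c e n] c L_carrier E_carrier[OF e] by simp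
  qed
  then show "x \<in> E" using x by simp
qed

lemma span_mono:
  assumes e: "e \<in> E" and "m \<le> n"
  shows "span m e \<subseteq> span n e"
  using assms(2)
proof (induction n rule: dec_induct)
  case (step n)
  have "span n e \<subseteq> span (Suc n) e"
  proof
    fix x assume "x \<in> span n e"
    then obtain c where c: "\<And>i. c i \<in> L" and x: "x = comb n c e" by (auto simp: span_def)
    let ?c = "\<lambda>i. if i < n then c i else \<zero>"
    have cc: "?c i \<in> L" for i using c subringE(2)[OF L] by simp
    have "comb n ?c e = x" unfolding x comb_def
      using c L_carrier E_carrier[OF e] by (intro finsum_cong') auto
    then have "comb (Suc n) ?c e = x"
      using comb_Suc[of ?c e n] cc L_carrier E_carrier[OF e] comb_closed[of ?c e n] by simp
    then show "x \<in> span (Suc n) e" using spanI[of ?c "Suc n" e] cc by simp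
  qed
  then show ?case using step by blast
qed simp

lemma span_add: "\<lbrakk>e \<in> E; x \<in> span n e; y \<in> span n e\<rbrakk> \<Longrightarrow> x \<oplus> y \<in> span n e"
  unfolding span_def
proof clarify
  fix c d :: "nat \<Rightarrow> 'a" assume e: "e \<in> E" and c: "\<forall>i. c i \<in> L" and d: "\<forall>i. d i \<in> L"
  then have "comb n c e \<oplus> comb n d e = comb n (\<lambda>i. c i \<oplus> d i) e"
    using L_carrier E_carrier by (intro comb_add[symmetric]) auto
  then show "\<exists>b. comb n c e \<oplus> comb n d e = comb n b e \<and> (\<forall>i. b i \<in> L)"
    using c d subringE(7)[OF L] by blast
qed

lemma span_smult: "\<lbrakk>e \<in> E; l \<in> L; x \<in> span n e\<rbrakk> \<Longrightarrow> l \<otimes> x \<in> span n e"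
  unfolding span_def
proof clarify
  fix c :: "nat \<Rightarrow> 'a" assume e: "e \<in> E" and l: "l \<in> L" and c: "\<forall>i. c i \<in> L"
  then have "l \<otimes> comb n c e = comb n (\<lambda>i. l \<otimes> c i) e"
    using L_carrier E_carrier by (intro comb_smult[symmetric]) auto
  then show "\<exists>b. l \<otimes> comb n c e = comb n b e \<and> (\<forall>i. b i \<in> L)"
    using c l subringE(6)[OF L] by blast
qed

lemma L_span: "e \<in> E \<Longrightarrow> 0 < n \<Longrightarrow> L \<subseteq> span n e"
proof -
  assume e: "e \<in> E" and n: "0 < n"
  have "l \<in> span 1 e" if "l \<in> L" for l
    using that spanI[of "\<lambda>_. l" 1 e] comb_Suc[of "\<lambda>_. l" e 0] L_carrier E_carrier[OF e]
    by (simp add: comb_0)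
  then show ?thesis using span_mono[OF e, of 1 n] n by fastforce
qed

lemma span_shift: "\<lbrakk>e \<in> E; x \<in> span n e\<rbrakk> \<Longrightarrow> e \<otimes> x \<in> span (Suc n) e"
  unfolding span_def
proof clarify
  fix c :: "nat \<Rightarrow> 'a" assume e: "e \<in> E" and c: "\<forall>i. c i \<in> L"
  have "e \<otimes> comb n c e = comb (Suc n) (case_nat \<zero> c) e"
    using c e L_carrier E_carrier by (intro comb_shift) auto
  moreover have "case_nat \<zero> c i \<in> L" for i using c subringE(2)[OF L] by (cases i) auto
  ultimately show "\<exists>b. e \<otimes> comb n c e = comb (Suc n) b e \<and> (\<forall>i. b i \<in> L)" by blast
qed

lemma span_shift_closed:
  assumes e: "e \<in> E" and en: "e [^] n \<in> span n e" and x: "x \<in> span n e"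
  shows "e \<otimes> x \<in> span n e"
proof -
  have "e \<otimes> x \<in> span (Suc n) e" by (rule span_shift[OF e x])
  then obtain d where d: "\<And>i. d i \<in> L" and ex: "e \<otimes> x = comb (Suc n) d e"
    by (auto simp: span_def)
  have "e \<otimes> x = d n \<otimes> e [^] n \<oplus> comb n d e"
    unfolding ex using d e L_carrier E_carrier by (intro comb_Suc) auto
  then show ?thesis using span_add[OF e span_smult[OF e d en] spanI[of d n e]] d by simp
qed

text \<open>An L-module stable under multiplication by e is stable under every polynomial in e over
  L; as the elements of M are themselves such polynomials, M is closed under products. One statement
  covers both the algebraic and the transcendental case.\<close>

lemma subring_of_span:
  assumes e: "e \<in> E" and ME: "M \<subseteq> E" and LM: "L \<subseteq> M"
    and add: "\<And>x y. \<lbrakk>x \<in> M; y \<in> M\<rbrakk> \<Longrightarrow> x \<oplus> y \<in> M"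
    and smult: "\<And>l x. \<lbrakk>l \<in> L; x \<in> M\<rbrakk> \<Longrightarrow> l \<otimes> x \<in> M"
    and shift: "\<And>x. x \<in> M \<Longrightarrow> e \<otimes> x \<in> M"
    and span: "\<And>x. x \<in> M \<Longrightarrow> \<exists>n. x \<in> span n e"
  shows "subring M R"
proof (rule subringI)
  have Mc: "x \<in> carrier R" if "x \<in> M" for x using that ME E_carrier by blast
  then show "M \<subseteq> carrier R" by blast
  show "\<one> \<in> M" using LM subringE(3)[OF L] by blast
  fix x assume x: "x \<in> M"
  have "\<ominus> \<one> \<in> L" using subringE(5)[OF L subringE(3)[OF L]] .
  then have "\<ominus> \<one> \<otimes> x \<in> M" using smult x by blast
  then show "\<ominus> x \<in> M" using Mc[OF x] by (simp add: l_minus)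
  fix y assume y: "y \<in> M"
  show "x \<oplus> y \<in> M" by (rule add[OF x y])
  obtain n c where c: "\<And>i. c i \<in> L" and xc: "x = comb n c e"
    using span[OF x] by (auto simp: span_def)
  note [simp] = c[THEN L_carrier] E_carrier[OF e] Mc[OF y] comb_closed[of c]
  have pow: "e [^] k \<otimes> y \<in> M" for k :: nat
  proof (induction k)
    case (Suc k)
    have "e [^] Suc k \<otimes> y = e \<otimes> (e [^] k \<otimes> y)" by (simp add: m_ac)
    then show ?case using shift[OF Suc] by simp
  qed (use y in simp)
  have "comb n c e \<otimes> y \<in> M"
  proof (induction n)
    case 0
    then show ?case using LM subringE(2)[OF L] by (auto simp: comb_0)
  next
    case (Suc n)
    have "comb (Suc n) c e \<otimes> y = c n \<otimes> (e [^] n \<otimes> y) \<oplus> comb n c e \<otimes> y"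
      by (simp add: comb_Suc l_distr m_assoc)
    then show ?case using add[OF smult[OF c pow] Suc] by simp
  qed
  then show "x \<otimes> y \<in> M" using xc by simp
qed

text \<open>By \<open>L_inverse\<close>, L modulo its intersection with I is a field; the condition
  says that the residues of 1, e, ..., e^(n-1) are linearly independent over it.\<close>

definition indep :: "nat \<Rightarrow> 'a \<Rightarrow> bool" where
  "indep n e \<longleftrightarrow> (\<forall>c. (\<forall>i. c i \<in> L) \<longrightarrow> comb n c e \<in> I \<longrightarrow> (\<forall>i<n. c i \<in> I))"

text \<open>Independence puts the coefficients of an element of I into L and I at once, hence into
  I'. This is the condition under which maximality of L applies to a ring spanned by powers of
  e.\<close>

lemma indep_span_I:
  assumes "indep n e" "e \<in> E"
  shows "span n e \<inter> I \<subseteq> I'"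
proof
  fix x assume x: "x \<in> span n e \<inter> I"
  then obtain c where c: "\<forall>i. c i \<in> L" and xc: "x = comb n c e" by (auto simp: span_def)
  then have "\<forall>i<n. c i \<in> I'" using assms(1) x L_I unfolding indep_def by blast
  then show "x \<in> I'" unfolding xc using E_carrier[OF assms(2)] by (intro comb_mem_ideal[OF I']) auto
qed

lemma indepI:
  assumes e: "e \<in> E" and min: "\<And>k c. \<lbrakk>k < n; \<And>i. c i \<in> L\<rbrakk> \<Longrightarrow> e [^] k \<oplus> comb k c e \<notin> I"
  shows "indep n e"
  using min
proof (induction n)
  case 0
  then show ?case by (simp add: indep_def)
next
  case (Suc n)
  show ?case unfolding indep_def
  proof (intro allI impI)
    fix c i assume c: "\<forall>i. c i \<in> L" and cI: "comb (Suc n) c e \<in> I" and i: "i < Suc n"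
    note [simp] = c[rule_format, THEN L_carrier] E_carrier[OF e] comb_closed[of c]
    have S: "comb (Suc n) c e = c n \<otimes> e [^] n \<oplus> comb n c e" by (simp add: comb_Suc)
    have cn: "c n \<in> I"
    proof (rule ccontr)
      assume "c n \<notin> I"
      then obtain u where u: "u \<in> L" "c n \<otimes> u = \<one>" using L_inverse c by blast
      have [simp]: "u \<in> carrier R" using u L_carrier by simp
      have "u \<otimes> comb (Suc n) c e = (c n \<otimes> u) \<otimes> e [^] n \<oplus> u \<otimes> comb n c e"
        unfolding S by (simp add: r_distr m_ac)
      also have "\<dots> = e [^] n \<oplus> comb n (\<lambda>i. u \<otimes> c i) e"
        using u(2) by (simp add: comb_smult)
      finally have "e [^] n \<oplus> comb n (\<lambda>i. u \<otimes> c i) e \<in> I" using I.I_l_closed[OF cI, of u] by simp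
      moreover have "u \<otimes> c i \<in> L" for i using subringE(6)[OF L u(1)] c by blast
      ultimately show False using Suc.prems[of n "\<lambda>i. u \<otimes> c i"] by simp
    qed
    have "comb n c e = comb (Suc n) c e \<ominus> c n \<otimes> e [^] n"
      unfolding S by (simp add: a_comm[of "c n \<otimes> e [^] n"] a_assoc minus_eq r_neg)
    then have "comb n c e \<in> I"
      using cI I.I_r_closed[OF cn, of "e [^] n"] I.a_closed I.a_inv_closed by (simp add: minus_eq)
    then show "c i \<in> I"
      using Suc.IH Suc.prems c cn i unfolding indep_def by (metis less_Suc_eq)
  qed
qed

lemma indep_cong:
  assumes "indep n e" "e \<in> E" "h \<in> I"
  shows "indep n (e \<oplus> h)"
  unfolding indep_def
proof (intro allI impI)
  fix c i assume c: "\<forall>i. c i \<in> L" and cI: "comb n c (e \<oplus> h) \<in> I" and i: "i < n"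
  note [simp] = c[rule_format, THEN L_carrier] E_carrier[OF assms(2)] comb_closed[of c] I.Icarr[OF assms(3)]
  have d: "comb n c (e \<oplus> h) \<ominus> comb n c e \<in> I"
    by (rule comb_diff_mem[OF I _ _ assms(3)]) auto
  have "a = b \<ominus> (b \<ominus> a)" if [simp]: "a \<in> carrier R" "b \<in> carrier R" for a b
    by (simp add: ring_identity_simps)
  from this[of "comb n c e" "comb n c (e \<oplus> h)"] have "comb n c e \<in> I"
    using I.a_closed[OF cI I.a_inv_closed[OF d]] by (simp add: minus_eq)
  then show "c i \<in> I" using assms(1) c i unfolding indep_def by blast
qed

text \<open>A monic relation of degree n that holds exactly in the ring, not only modulo I, makes
  \<open>span n e\<close> equal to L[e]. Independence keeps its intersection with I inside I', so it
  cannot exceed the maximal L.\<close>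

lemma absorb:
  assumes e: "e \<in> E" and ind: "indep n e" and n: "0 < n" and en: "e [^] n \<in> span n e"
  shows "e \<in> L"
proof -
  have "subring (span n e) R"
  proof (rule subring_of_span[OF e])
    show "\<And>x. x \<in> span n e \<Longrightarrow> e \<otimes> x \<in> span n e" by (rule span_shift_closed[OF e en])
  qed (rule span_E[OF e], rule L_span[OF e n], erule (1) span_add[OF e], erule (1) span_smult[OF e], blast)
  then have sL: "span n e \<subseteq> L"
    by (rule max[OF _ L_span[OF e n] span_E[OF e] indep_span_I[OF ind e]])
  have "\<one> \<in> span n e" using L_span[OF e n] subringE(3)[OF L] by blast
  then have "e \<otimes> \<one> \<in> span n e" by (rule span_shift_closed[OF e en])
  then show ?thesis using sL E_carrier[OF e] by auto
qed

text \<open>The same argument for a transcendental residue, where L[e] is the union of all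
  spans.\<close>

lemma absorb_transcendental:
  assumes e: "e \<in> E" and ind: "\<And>n. indep n e"
  shows "e \<in> L"
proof -
  let ?M = "\<Union>n. span n e"
  have "subring ?M R"
  proof (rule subring_of_span[OF e])
    show "?M \<subseteq> E" using span_E[OF e] by blast
    show "L \<subseteq> ?M" using L_span[OF e, of 1] by auto
    fix x y assume "x \<in> ?M" "y \<in> ?M"
    then obtain m n where "x \<in> span m e" "y \<in> span n e" by blast
    then have "x \<in> span (max m n) e" "y \<in> span (max m n) e"
      using span_mono[OF e, of m "max m n"] span_mono[OF e, of n "max m n"] by auto
    then show "x \<oplus> y \<in> ?M" using span_add[OF e] by blast
  next
    show "\<And>x. x \<in> ?M \<Longrightarrow> e \<otimes> x \<in> ?M" using span_shift[OF e] by blast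
    show "\<And>l x. l \<in> L \<Longrightarrow> x \<in> ?M \<Longrightarrow> l \<otimes> x \<in> ?M" using span_smult[OF e] by blast
  qed blast
  moreover have "?M \<inter> I \<subseteq> I'" using indep_span_I[OF ind e] by blast
  ultimately have M_L: "?M \<subseteq> L"
    using span_E[OF e] L_span[OF e, of 1] by (intro max) auto
  have "\<one> \<in> span 1 e" using L_span[OF e, of 1] subringE(3)[OF L] by auto
  then have "e \<otimes> \<one> \<in> span (Suc 1) e" by (rule span_shift[OF e])
  then show ?thesis using M_L E_carrier[OF e] by auto
qed

lemma add_pow_one_mem: "[(n::nat)] \<cdot> \<one> \<in> L"
proof (induction n)
  case (Suc n)
  then show ?case using subringE(3,7)[OF L] by simp
qed (use subringE(2)[OF L] in simp)

text \<open>If q did not divide n, a Bezout relation n x = q y + 1 would turn 1 into a multiple of n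
  times 1, hence an element of I.\<close>

lemma char_dvd:
  assumes "0 < n" "[(n::nat)] \<cdot> \<one> \<in> I"
  shows "Factorial_Ring.prime q \<and> q dvd n"
proof -
  have q: "Factorial_Ring.prime q" "[q] \<cdot> \<one> = \<zero>" using char assms by auto
  have "q dvd n"
  proof (rule ccontr)
    assume "\<not> q dvd n"
    then have "coprime n q" using q(1) prime_imp_coprime[of q n] by (simp add: coprime_commute)
    then obtain x y where xy: "n * x = q * y + 1"
      using bezout_nat[of n q] assms(1) by auto
    have "[(q * y + 1)] \<cdot> \<one> = [(q * y)] \<cdot> \<one> \<oplus> \<one>" by simp
    also have "[(q * y)] \<cdot> \<one> = [y] \<cdot> ([q] \<cdot> \<one>)" by (rule add.nat_pow_pow[symmetric]) simp
    finally have "[(q * y + 1)] \<cdot> \<one> = \<one>" using q(2) by simp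
    moreover have "[(n * x)] \<cdot> \<one> = [x] \<cdot> ([n] \<cdot> \<one>)" by (rule add.nat_pow_pow[symmetric]) simp
    moreover have "[x] \<cdot> ([n] \<cdot> \<one>) \<in> I"
      using assms(2) I.I_l_closed[OF assms(2), of "[x] \<cdot> \<one>"] add_pow_one_mult[of "[n] \<cdot> \<one>" x] by simp
    ultimately show False using one xy by simp
  qed
  then show ?thesis using q by blast
qed

theorem residues_lift:
  assumes e: "e \<in> E"
  shows "\<exists>l\<in>L. \<exists>i\<in>I. e = l \<oplus> i"
proof (cases "\<exists>n c. (\<forall>i. c i \<in> L) \<and> e [^] n \<oplus> comb n c e \<in> I")
  case False
  then have "e \<in> L" by (intro absorb_transcendental indepI e) blast
  then show ?thesis using E_carrier[OF e] I.zero_closed by (intro bexI[of _ e] bexI[of _ \<zero>]) auto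
next
  case True
  \<comment> \<open>The degree of the minimal polynomial of the residue of e over the residue field
    of L.\<close>
  define n where "n = (LEAST n. \<exists>c. (\<forall>i. c i \<in> L) \<and> e [^] n \<oplus> comb n c e \<in> I)"
  from True have "\<exists>c. (\<forall>i. c i \<in> L) \<and> e [^] n \<oplus> comb n c e \<in> I"
    unfolding n_def by (rule LeastI_ex)
  then obtain b where b: "\<And>i. b i \<in> L" and rel_I: "e [^] n \<oplus> comb n b e \<in> I" by blast
  have least: "n \<le> k" if "\<And>i. c i \<in> L" "e [^] k \<oplus> comb k c e \<in> I" for k c
    unfolding n_def by (rule Least_le) (use that in blast)
  have ind: "indep n e"
    by (rule indepI[OF e]) (use least in \<open>meson not_less\<close>)
  have n0: "n \<noteq> 0"
  proof
    assume "n = 0"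
    then show False using rel_I one by (simp add: comb_0)
  qed
  then obtain m where m: "n = Suc m" by (cases n) auto
  note [simp] = E_carrier[OF e]
  \<comment> \<open>The full coefficient sequence of the minimal polynomial; b holds the
    coefficients below the leading 1.\<close>
  define c where "c i = (if i = n then \<one> else b i)" for i
  have cL: "c i \<in> L" for i using b subringE(3)[OF L] by (simp add: c_def)
  note cc [simp] = cL[THEN L_carrier]
  have bc [simp]: "b i \<in> carrier R" for i using b L_carrier by blast
  have cb: "comb (Suc n) c x = x [^] n \<oplus> comb n b x" if [simp]: "x \<in> carrier R" for x
  proof -
    have "comb n c x = comb n b x"
      unfolding comb_def c_def by (intro finsum_cong') auto
    then show ?thesis by (simp add: comb_Suc) (simp add: c_def)
  qed
  let ?d = "\<lambda>i. [Suc i] \<cdot> \<one> \<otimes> c (Suc i)"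
  have dL: "?d i \<in> L" for i by (intro subringE(6)[OF L] add_pow_one_mem cL)
  define f where "f = comb (Suc n) c e"
  define d where "d = comb n ?d e"
  have fI: "f \<in> I" using rel_I cb by (simp add: f_def)
  have dE: "d \<in> E" using span_E[OF e] spanI[of ?d n e] dL unfolding d_def by blast
  show ?thesis
  proof (cases "d \<in> I")
    case True
    \<comment> \<open>Independence applies to the derivative, which has degree below n. Its top
      coefficient is n times 1, whence q divides n.\<close>
    then have "?d m \<in> I"
      using ind[unfolded indep_def, rule_format, of ?d m] dL m unfolding d_def by blast
    then have "[n] \<cdot> \<one> \<in> I" using m by (simp add: c_def)
    then have q: "Factorial_Ring.prime q" "q dvd n" using char_dvd[of n] n0 by auto
    obtain q' where q': "q = Suc q'" using prime_gt_0_nat[OF q(1)] by (cases q) auto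
    have eq: "e [^] q \<in> L" by (rule power[OF e])
    \<comment> \<open>The coefficients of T^q - e^q below the leading one. This monic polynomial
      over L vanishes at e, which bounds n by q.\<close>
    let ?c = "\<lambda>i. if i = 0 then \<ominus> (e [^] q) else \<zero>"
    have cL': "?c i \<in> L" for i using eq subringE(2,5)[OF L] by simp
    have "comb (Suc k) ?c e = \<ominus> (e [^] q)" for k
      by (induction k) (subst comb_Suc; simp add: comb_0)+
    then have "e [^] q \<oplus> comb q ?c e = \<zero>" unfolding q' by (simp add: r_neg)
    then have "n \<le> q" using least[of ?c q, OF cL'] by simp
    then have "q = n" using dvd_imp_le[OF q(2)] n0 by simp
    then have "e [^] n \<in> span n e" using L_span[OF e, of n] n0 eq by auto
    then have "e \<in> L" using absorb[OF e ind] n0 by simp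
    then show ?thesis using I.zero_closed by (intro bexI[of _ e] bexI[of _ \<zero>]) auto
  next
    case False
    then obtain u where u: "u \<in> E" "d \<otimes> u = \<one>" using inverse dE by blast
    note [simp] = E_carrier[OF u(1)] E_carrier[OF dE] I.Icarr[OF fI]
    \<comment> \<open>The Newton correction -f(e)/f'(e); it lies in I because f(e) does.\<close>
    define h where "h = \<ominus> (u \<otimes> f)"
    have hI: "h \<in> I" unfolding h_def by (intro I.a_inv_closed I.I_l_closed fI) simp
    note [simp] = I.Icarr[OF hI]
    have eh: "e \<oplus> h \<in> E" using subringE(7)[OF E e] hI I_E by blast
    obtain r where r: "r \<in> I'" "comb (Suc n) c (e \<oplus> h) = f \<oplus> h \<otimes> d \<oplus> r"
      using taylor_comb[where c = c and n = n, OF I' cc E_carrier[OF e] I.Icarr[OF hI] sq[OF hI hI]]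
      unfolding f_def d_def by blast
    have [simp]: "r \<in> carrier R" by (rule I'.Icarr[OF r(1)])
    have "h \<otimes> d = \<ominus> ((d \<otimes> u) \<otimes> f)" unfolding h_def by (simp add: l_minus r_minus m_ac)
    then have hd: "h \<otimes> d = \<ominus> f" unfolding u(2) by simp
    have "comb (Suc n) c (e \<oplus> h) = r" unfolding r(2) hd by (simp add: r_neg)
    \<comment> \<open>The corrected value r need not vanish: it lies in I', hence in L, and can be
      moved into the constant term of a monic relation over L.\<close>
    then have rel: "(e \<oplus> h) [^] n \<oplus> comb n b (e \<oplus> h) = r" using cb[of "e \<oplus> h"] by simp
    have bc': "comb n b (e \<oplus> h) \<in> carrier R" by (intro comb_closed) auto
    have "a = a \<oplus> b \<oplus> (\<ominus> \<one>) \<otimes> b" if [simp]: "a \<in> carrier R" "b \<in> carrier R" for a b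
      by (simp add: ring_identity_simps)
    from this[of "(e \<oplus> h) [^] n", OF _ bc'] have "(e \<oplus> h) [^] n = r \<oplus> (\<ominus> \<one>) \<otimes> comb n b (e \<oplus> h)"
      unfolding rel by simp
    moreover have "r \<in> span n (e \<oplus> h)" using L_span[OF eh, of n] n0 r(1) I'_L by auto
    moreover have "\<ominus> \<one> \<otimes> comb n b (e \<oplus> h) \<in> span n (e \<oplus> h)"
      by (rule span_smult[OF eh subringE(5)[OF L subringE(3)[OF L]] spanI[OF b]])
    ultimately have "(e \<oplus> h) [^] n \<in> span n (e \<oplus> h)" using span_add[OF eh] by metis
    then have "e \<oplus> h \<in> L" using absorb[OF eh indep_cong[OF ind e hI]] n0 by simp
    moreover have "e = (e \<oplus> h) \<oplus> \<ominus> h" by (simp add: a_assoc r_neg)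
    moreover have "\<ominus> h \<in> I" by (rule I.a_inv_closed[OF hI])
    ultimately show ?thesis by blast
  qed
qed

end

section \<open>Maximal subrings and towers of square-zero layers\<close>

lemma (in ring) subring_Union_chain:
  assumes "C \<noteq> {}" "subset.chain {L. subring L R} C"
  shows "subring (\<Union>C) R"
proof (rule subringI)
  have sub: "\<And>L. L \<in> C \<Longrightarrow> subring L R" and chain: "\<And>L M. L \<in> C \<Longrightarrow> M \<in> C \<Longrightarrow> L \<subseteq> M \<or> M \<subseteq> L"
    using assms(2) by (auto simp: subset_chain_def)
  show "\<Union>C \<subseteq> carrier R" using subringE(1)[OF sub] by blast
  show "\<one> \<in> \<Union>C" using assms(1) subringE(3)[OF sub] by blast
  fix x assume "x \<in> \<Union>C"
  then obtain L where L: "L \<in> C" "x \<in> L" by blast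
  show "\<ominus> x \<in> \<Union>C" using L subringE(5)[OF sub] by blast
  fix y assume "y \<in> \<Union>C"
  then obtain M where M: "M \<in> C" "y \<in> M" by blast
  obtain D where D: "D \<in> C" "x \<in> D" "y \<in> D" using L M chain[OF L(1) M(1)] by blast
  show "x \<otimes> y \<in> \<Union>C" "x \<oplus> y \<in> \<Union>C"
    using D subringE(6,7)[OF sub[OF D(1)] D(2,3)] by blast+
qed

text \<open>Zorn's lemma provides the maximal subring to which \<open>residues_lift\<close> applies,
  once some subring containing I' and the q-th powers, and meeting I only in I', is available to
  start from. Invertibility in L is part of the conclusion so that L can be the E of the next
  layer.\<close>

lemma (in cring) square_zero_residues_lift:
  assumes E: "subring E R" and I: "ideal I R" and I': "ideal I' R"
    and I'_I: "I' \<subseteq> I" and I_E: "I \<subseteq> E"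
    and sq: "\<And>a b. \<lbrakk>a \<in> I; b \<in> I\<rbrakk> \<Longrightarrow> a \<otimes> b \<in> I'"
    and one: "\<one> \<notin> I"
    and inverse: "\<And>e. \<lbrakk>e \<in> E; e \<notin> I\<rbrakk> \<Longrightarrow> \<exists>u\<in>E. e \<otimes> u = \<one>"
    and char: "(\<forall>n::nat. 0 < n \<longrightarrow> [n] \<cdot> \<one> \<notin> I) \<or> (\<exists>q::nat. Factorial_Ring.prime q \<and> [q] \<cdot> \<one> = \<zero>)"
  shows "\<exists>L. subring L R \<and> I' \<subseteq> L \<and> L \<subseteq> E \<and> L \<inter> I \<subseteq> I' \<and>
    (\<forall>e\<in>E. \<exists>l\<in>L. \<exists>i\<in>I. e = l \<oplus> i) \<and> (\<forall>l\<in>L. l \<notin> I \<longrightarrow> (\<exists>u\<in>L. l \<otimes> u = \<one>))"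
proof -
  interpret I: ideal I R by fact
  interpret I': ideal I' R by fact
  have Ec: "x \<in> carrier R" if "x \<in> E" for x using that subringE(1)[OF E] by blast
  obtain q L0 where L0: "subring L0 R" "I' \<subseteq> L0" "L0 \<subseteq> E" "L0 \<inter> I \<subseteq> I'"
    and power: "\<And>x. x \<in> E \<Longrightarrow> x [^] (q::nat) \<in> L0"
    and q: "(\<forall>n::nat. 0 < n \<longrightarrow> [n] \<cdot> \<one> \<notin> I) \<or> Factorial_Ring.prime q \<and> [q] \<cdot> \<one> = \<zero>"
    using char
  proof (elim disjE exE conjE)
    assume 0: "\<forall>n::nat. 0 < n \<longrightarrow> [n] \<cdot> \<one> \<notin> I"
    \<comment> \<open>The integer multiples of 1 together with I'. A nonzero integer stays outside
      I, so only the multiple by 0 contributes to the intersection with I. With exponent 0 every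
      power is 1.\<close>
    define L0 where "L0 = {x. \<exists>z::int. \<exists>i\<in>I'. x = [z] \<cdot> \<one> \<oplus> i}"
    have L0I: "[z] \<cdot> \<one> \<oplus> i \<in> L0" if "i \<in> I'" for z :: int and i using that by (auto simp: L0_def)
    have nat_E: "[n] \<cdot> \<one> \<in> E" for n :: nat
      by (induction n) (use subringE(2,3,7)[OF E] in auto)
    have int_E: "[z] \<cdot> \<one> \<in> E" for z :: int
      using nat_E subringE(5)[OF E] by (cases "0 \<le> z") (auto simp: add_pow_int_ge add_pow_int_lt)
    have "subring L0 R"
    proof (rule subringI)
      show "L0 \<subseteq> carrier R" by (auto simp: L0_def)
      have "\<one> = [(1::int)] \<cdot> \<one> \<oplus> \<zero>" by (simp add: add_pow_int_ge)
      then show "\<one> \<in> L0" using L0I[of \<zero> 1] by simp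
      fix x assume "x \<in> L0"
      then obtain z :: int and i where x: "i \<in> I'" "x = [z] \<cdot> \<one> \<oplus> i" unfolding L0_def by auto
      note [simp] = I'.Icarr[OF x(1)]
      have "\<ominus> x = [(- z)] \<cdot> \<one> \<oplus> (\<ominus> i)"
        unfolding x by (simp add: minus_add add.int_pow_neg)
      then show "\<ominus> x \<in> L0" using L0I[of "\<ominus> i" "- z"] x by simp
      fix y assume "y \<in> L0"
      then obtain w :: int and j where y: "j \<in> I'" "y = [w] \<cdot> \<one> \<oplus> j" unfolding L0_def by auto
      note [simp] = I'.Icarr[OF y(1)]
      have "(a \<oplus> i) \<otimes> (b \<oplus> j) = a \<otimes> b \<oplus> (a \<otimes> j \<oplus> i \<otimes> (b \<oplus> j))"
        if [simp]: "a \<in> carrier R" "b \<in> carrier R" for a b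
        by (simp add: ring_identity_simps)
      moreover have "[z] \<cdot> \<one> \<otimes> [w] \<cdot> \<one> = [(w * z)] \<cdot> \<one>"
        by (simp add: add_pow_ldistr_int add.int_pow_pow)
      ultimately have "x \<otimes> y = [(w * z)] \<cdot> \<one> \<oplus> ([z] \<cdot> \<one> \<otimes> j \<oplus> i \<otimes> ([w] \<cdot> \<one> \<oplus> j))"
        unfolding x y by simp
      moreover have "[z] \<cdot> \<one> \<otimes> j \<oplus> i \<otimes> ([w] \<cdot> \<one> \<oplus> j) \<in> I'"
        using x y by (intro I'.a_closed I'.I_l_closed I'.I_r_closed) auto
      ultimately show "x \<otimes> y \<in> L0" using L0I by simp
      have "(a \<oplus> i) \<oplus> (b \<oplus> j) = (a \<oplus> b) \<oplus> (i \<oplus> j)"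
        if [simp]: "a \<in> carrier R" "b \<in> carrier R" for a b
        by (simp add: ring_identity_simps)
      then have "x \<oplus> y = [(z + w)] \<cdot> \<one> \<oplus> (i \<oplus> j)"
        unfolding x y by (simp add: add.int_pow_mult)
      then show "x \<oplus> y \<in> L0" using L0I[OF I'.a_closed[OF x(1) y(1)]] by simp
    qed
    moreover have "I' \<subseteq> L0"
    proof
      fix i assume i: "i \<in> I'"
      then have "i = [(0::int)] \<cdot> \<one> \<oplus> i" by (simp add: add_pow_int_ge I'.Icarr)
      then show "i \<in> L0" using L0I[OF i, of 0] by simp
    qed
    moreover have "L0 \<subseteq> E" using int_E subringE(7)[OF E] I'_I I_E by (auto simp: L0_def)
    moreover have "L0 \<inter> I \<subseteq> I'"
    proof
      fix x assume x: "x \<in> L0 \<inter> I"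
      then obtain z :: int and i where z: "i \<in> I'" "x = [z] \<cdot> \<one> \<oplus> i" unfolding L0_def by auto
      note [simp] = I'.Icarr[OF z(1)]
      have "[z] \<cdot> \<one> = x \<ominus> i" unfolding z by (simp add: minus_eq a_assoc r_neg)
      then have zI: "[z] \<cdot> \<one> \<in> I" using x z(1) I'_I I.a_closed I.a_inv_closed by (auto simp: minus_eq)
      have "\<not> 0 < z" using zI 0 by (auto simp: add_pow_int_ge)
      moreover have "\<not> z < 0"
      proof
        assume "z < 0"
        then have "[(nat (- z))] \<cdot> \<one> = \<ominus> ([z] \<cdot> \<one>)" by (simp add: add_pow_int_lt)
        then have "[(nat (- z))] \<cdot> \<one> \<in> I" using I.a_inv_closed[OF zI] by (simp only:)
        moreover have "0 < nat (- z)" using \<open>z < 0\<close> by simp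
        ultimately show False using 0 by blast
      qed
      ultimately have "z = 0" by simp
      then show "x \<in> I'" using z by (simp add: add_pow_int_ge)
    qed
    moreover have "e [^] (0::nat) \<in> L0" if "e \<in> E" for e
      using L0I[of \<zero> 1] by (simp add: add_pow_int_ge)
    ultimately show ?thesis using 0 by - (rule that[of L0 0], assumption+, blast+)
  next
    fix q :: nat assume q: "Factorial_Ring.prime q" "[q] \<cdot> \<one> = \<zero>"
    \<comment> \<open>The q-th powers modulo I'; they are closed under addition by the Frobenius
      identity.\<close>
    define L0 where "L0 = {x. \<exists>e\<in>E. \<exists>i\<in>I'. x = e [^] q \<oplus> i}"
    have L0I: "e [^] q \<oplus> i \<in> L0" if "e \<in> E" "i \<in> I'" for e i using that by (auto simp: L0_def)
    have pow_E: "e [^] n \<in> E" if "e \<in> E" for e and n :: nat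
      by (induction n) (use that subringE(3,6)[OF E] in auto)
    obtain q' where q': "q = Suc (Suc q')"
      using prime_ge_2_nat[OF q(1)] by (metis Suc_le_D numeral_2_eq_2 Suc_le_mono)
    have "subring L0 R"
    proof (rule subringI)
      show "L0 \<subseteq> carrier R" using Ec by (auto simp: L0_def)
      have "\<one> = \<one> [^] q \<oplus> \<zero>" by simp
      then show "\<one> \<in> L0" using L0I[of \<one> \<zero>] subringE(3)[OF E] by simp
      fix x assume "x \<in> L0"
      then obtain e i where x: "e \<in> E" "i \<in> I'" "x = e [^] q \<oplus> i" unfolding L0_def by auto
      note [simp] = Ec[OF x(1)] I'.Icarr[OF x(2)]
      have "\<ominus> x = (\<ominus> e) [^] q \<oplus> (\<ominus> i)"
        unfolding x using frobenius_uminus[OF q, of e] by (simp add: minus_add)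
      then show "\<ominus> x \<in> L0" using L0I[of "\<ominus> e" "\<ominus> i"] subringE(5)[OF E] x by simp
      fix y assume "y \<in> L0"
      then obtain f j where y: "f \<in> E" "j \<in> I'" "y = f [^] q \<oplus> j" unfolding L0_def by auto
      note [simp] = Ec[OF y(1)] I'.Icarr[OF y(2)]
      have "(a \<oplus> i) \<otimes> (b \<oplus> j) = a \<otimes> b \<oplus> (a \<otimes> j \<oplus> i \<otimes> (b \<oplus> j))"
        if [simp]: "a \<in> carrier R" "b \<in> carrier R" for a b
        by (simp add: ring_identity_simps)
      then have "x \<otimes> y = (e \<otimes> f) [^] q \<oplus> (e [^] q \<otimes> j \<oplus> i \<otimes> (f [^] q \<oplus> j))"
        unfolding x y by (simp add: nat_pow_distrib)
      moreover have "e [^] q \<otimes> j \<oplus> i \<otimes> (f [^] q \<oplus> j) \<in> I'"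
        using x y by (intro I'.a_closed I'.I_l_closed I'.I_r_closed) auto
      ultimately show "x \<otimes> y \<in> L0" using L0I[OF subringE(6)[OF E x(1) y(1)]] by simp
      have "(a \<oplus> i) \<oplus> (b \<oplus> j) = (a \<oplus> b) \<oplus> (i \<oplus> j)"
        if [simp]: "a \<in> carrier R" "b \<in> carrier R" for a b
        by (simp add: ring_identity_simps)
      then have "x \<oplus> y = (e \<oplus> f) [^] q \<oplus> (i \<oplus> j)"
        unfolding x y using frobenius_add[OF q, of e f] by simp
      then show "x \<oplus> y \<in> L0" using L0I[OF subringE(7)[OF E x(1) y(1)] I'.a_closed[OF x(2) y(2)]] by simp
    qed
    moreover have "I' \<subseteq> L0"
    proof
      fix i assume i: "i \<in> I'"
      then have "i = \<zero> [^] q \<oplus> i" by (simp add: q' nat_pow_zero I'.Icarr)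
      then show "i \<in> L0" using L0I[OF subringE(2)[OF E] i] by simp
    qed
    moreover have "L0 \<subseteq> E" using pow_E subringE(7)[OF E] I'_I I_E by (auto simp: L0_def)
    moreover have "L0 \<inter> I \<subseteq> I'"
    proof
      fix x assume x: "x \<in> L0 \<inter> I"
      then obtain e i where e: "e \<in> E" "i \<in> I'" "x = e [^] q \<oplus> i" unfolding L0_def by auto
      note [simp] = Ec[OF e(1)] I'.Icarr[OF e(2)]
      have "e [^] q = x \<ominus> i" unfolding e by (simp add: minus_eq a_assoc r_neg)
      then have eI: "e [^] q \<in> I" using x e(2) I'_I I.a_closed I.a_inv_closed by (auto simp: minus_eq)
      have "e \<in> I"
      proof (rule ccontr)
        assume "e \<notin> I"
        then obtain u where u: "u \<in> E" "e \<otimes> u = \<one>" using inverse e by blast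
        have "e [^] q \<otimes> u [^] q = \<one>" using nat_pow_distrib[of e u q] Ec u by simp
        then show False using I.I_r_closed[OF eI, of "u [^] q"] Ec[OF u(1)] one by simp
      qed
      \<comment> \<open>Since q is at least 2, the power e^q is a multiple of e^2.\<close>
      then have "e \<otimes> e \<in> I'" using sq by blast
      then have "e [^] q' \<otimes> (e \<otimes> e) \<in> I'" by (rule I'.I_l_closed) simp
      then show "x \<in> I'" unfolding e using e(2) by (simp add: q' m_assoc I'.a_closed)
    qed
    moreover have "e [^] q \<in> L0" if "e \<in> E" for e using L0I[OF that, of \<zero>] Ec[OF that] by simp
    ultimately show ?thesis using q by - (rule that[of L0 q], assumption+, blast+)
  qed
  \<comment> \<open>Containing \<open>L0\<close> is imposed on all members, so the maximal one
    inherits I' and all q-th powers.\<close>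
  let ?S = "{L. subring L R \<and> L0 \<subseteq> L \<and> L \<subseteq> E \<and> L \<inter> I \<subseteq> I'}"
  have "\<exists>L\<in>?S. \<forall>M\<in>?S. L \<subseteq> M \<longrightarrow> M = L"
  proof (rule subset_Zorn_nonempty)
    show "?S \<noteq> {}" using L0 by blast
    fix C assume C: "C \<noteq> {}" "subset.chain ?S C"
    then have "subset.chain {L. subring L R} C" by (auto simp: subset_chain_def)
    then have "subring (\<Union>C) R" by (rule subring_Union_chain[OF C(1)])
    moreover have "L0 \<subseteq> L" "L \<subseteq> E" "L \<inter> I \<subseteq> I'" if "L \<in> C" for L
      using C(2) that by (auto simp: subset_chain_def)
    ultimately show "\<Union>C \<in> ?S" using C(1) by blast
  qed
  then obtain L where LS: "L \<in> ?S" and max': "\<forall>M\<in>?S. L \<subseteq> M \<longrightarrow> M = L" by (rule bexE)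
  from LS have L: "subring L R" "L0 \<subseteq> L" "L \<subseteq> E" "L \<inter> I \<subseteq> I'" by simp_all
  have max: "M \<subseteq> L" if M: "subring M R" "L \<subseteq> M" "M \<subseteq> E" "M \<inter> I \<subseteq> I'" for M
  proof -
    have "M \<in> ?S" using M order_trans[OF L(2) M(2)] by simp
    then have "M = L" using max' M(2) by simp
    then show ?thesis by simp
  qed
  interpret L: square_zero_lift R E I I' L q
  proof (rule square_zero_lift.intro[OF cring_axioms], rule square_zero_lift_axioms.intro)
    show "\<And>e. \<lbrakk>e \<in> E; e \<notin> I\<rbrakk> \<Longrightarrow> \<exists>u\<in>E. e \<otimes> u = \<one>" by (rule inverse)
    show "\<And>x. x \<in> E \<Longrightarrow> x [^] q \<in> L" using power L(2) by blast
    show "I' \<subseteq> L" using L(2) L0(2) by blast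
    show "\<And>M. \<lbrakk>subring M R; L \<subseteq> M; M \<subseteq> E; M \<inter> I \<subseteq> I'\<rbrakk> \<Longrightarrow> M \<subseteq> L" by (rule max)
  qed fact+
  show ?thesis
    using L(1,3,4) L.I'_L L.residues_lift L.L_inverse by (intro exI[of _ L] conjI ballI impI) auto
qed

text \<open>The layers of J cut out by consecutive filtration steps have square zero relative to the
  next one. They give a decreasing chain of subrings whose intersection with J shrinks to zero,
  while each still represents all residues of E modulo J. Completeness and closedness of J let the
  intersection of the chain represent them as well.\<close>

lemma (in complete_filtered_ring) residues_lift_tower:
  assumes E: "subring E R" and J: "ideal J R" and J_E: "J \<subseteq> E" and J_G: "J \<subseteq> G 1"
    and closed: "\<And>x. \<lbrakk>x \<in> carrier R; \<And>k. \<exists>j\<in>J. x \<ominus> j \<in> G k\<rbrakk> \<Longrightarrow> x \<in> J"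
    and one: "\<one> \<notin> J"
    and inverse: "\<And>e. \<lbrakk>e \<in> E; e \<notin> J\<rbrakk> \<Longrightarrow> \<exists>u\<in>E. e \<otimes> u = \<one>"
    and char: "(\<forall>n::nat. 0 < n \<longrightarrow> [n] \<cdot> \<one> \<notin> J) \<or> (\<exists>q::nat. Factorial_Ring.prime q \<and> [q] \<cdot> \<one> = \<zero>)"
  shows "\<exists>L. subring L R \<and> L \<subseteq> E \<and> L \<inter> J \<subseteq> {\<zero>} \<and> (\<forall>e\<in>E. \<exists>l\<in>L. \<exists>j\<in>J. e = l \<oplus> j)"
proof -
  interpret J: ideal J R by fact
  have Ec: "x \<in> carrier R" if "x \<in> E" for x using that subringE(1)[OF E] by blast
  \<comment> \<open>For a good subring the intersection with J is exactly J cut with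
    \<open>G (Suc k)\<close>. The index is shifted because J lies in \<open>G 1\<close>, so that E
    itself is good at 0.\<close>
  define good where "good k L \<longleftrightarrow> subring L R \<and> L \<subseteq> E \<and> J \<inter> G (Suc k) \<subseteq> L \<and> L \<inter> J \<subseteq> G (Suc k) \<and>
    (\<forall>l\<in>L. l \<notin> J \<longrightarrow> (\<exists>u\<in>L. l \<otimes> u = \<one>))" for k L
  have good0: "good 0 E" unfolding good_def using E J_E J_G inverse by auto
  have step: "\<exists>L'. good (Suc k) L' \<and> (L' \<subseteq> L \<and> (\<forall>l\<in>L. \<exists>l'\<in>L'. l \<ominus> l' \<in> J \<inter> G (Suc k)))"
    if "good k L" for k L
  proof -
    have L: "subring L R" "L \<subseteq> E" "J \<inter> G (Suc k) \<subseteq> L" "L \<inter> J \<subseteq> G (Suc k)"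
      and Linv: "\<And>l. \<lbrakk>l \<in> L; l \<notin> J\<rbrakk> \<Longrightarrow> \<exists>u\<in>L. l \<otimes> u = \<one>"
      using that unfolding good_def by auto
    have "\<exists>L'. subring L' R \<and> J \<inter> G (Suc (Suc k)) \<subseteq> L' \<and> L' \<subseteq> L \<and> L' \<inter> (J \<inter> G (Suc k)) \<subseteq> J \<inter> G (Suc (Suc k)) \<and>
      (\<forall>e\<in>L. \<exists>l\<in>L'. \<exists>i\<in>J \<inter> G (Suc k). e = l \<oplus> i) \<and> (\<forall>l\<in>L'. l \<notin> J \<inter> G (Suc k) \<longrightarrow> (\<exists>u\<in>L'. l \<otimes> u = \<one>))"
    proof (rule square_zero_residues_lift[OF L(1)])
      show "ideal (J \<inter> G (Suc k)) R" "ideal (J \<inter> G (Suc (Suc k))) R"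
        by (intro i_intersect J G_ideal)+
      show "J \<inter> G (Suc (Suc k)) \<subseteq> J \<inter> G (Suc k)" using G_Suc by blast
      show "J \<inter> G (Suc k) \<subseteq> L" by (rule L)
      show "\<one> \<notin> J \<inter> G (Suc k)" using one by blast
      show "(\<forall>n::nat. 0 < n \<longrightarrow> [n] \<cdot> \<one> \<notin> J \<inter> G (Suc k)) \<or> (\<exists>q::nat. Factorial_Ring.prime q \<and> [q] \<cdot> \<one> = \<zero>)"
        using char by blast
      fix a b assume a: "a \<in> J \<inter> G (Suc k)" and b: "b \<in> J \<inter> G (Suc k)"
      have "a \<otimes> b \<in> G (Suc k + Suc k)" using a b by (intro G_mult) auto
      moreover have "G (Suc k + Suc k) \<subseteq> G (Suc (Suc k))" by (rule G_mono) simp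
      moreover have "a \<otimes> b \<in> J" using a b G_carrier by (intro J.I_l_closed) auto
      ultimately show "a \<otimes> b \<in> J \<inter> G (Suc (Suc k))" by blast
    next
      \<comment> \<open>Inside L, avoiding the current layer is the same as avoiding J.\<close>
      fix e assume "e \<in> L" "e \<notin> J \<inter> G (Suc k)"
      then show "\<exists>u\<in>L. e \<otimes> u = \<one>" using Linv L(4) by blast
    qed
    then obtain L' where L': "subring L' R" "J \<inter> G (Suc (Suc k)) \<subseteq> L'" "L' \<subseteq> L"
        "L' \<inter> (J \<inter> G (Suc k)) \<subseteq> J \<inter> G (Suc (Suc k))"
      and dec: "\<And>e. e \<in> L \<Longrightarrow> \<exists>l\<in>L'. \<exists>i\<in>J \<inter> G (Suc k). e = l \<oplus> i"
      and inv: "\<And>l. \<lbrakk>l \<in> L'; l \<notin> J \<inter> G (Suc k)\<rbrakk> \<Longrightarrow> \<exists>u\<in>L'. l \<otimes> u = \<one>" by blast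
    have "good (Suc k) L'" unfolding good_def
    proof (intro conjI ballI impI)
      show "L' \<subseteq> E" using L'(3) L(2) by blast
      show "L' \<inter> J \<subseteq> G (Suc (Suc k))" using L'(3,4) L(4) by blast
      show "\<exists>u\<in>L'. l \<otimes> u = \<one>" if "l \<in> L'" "l \<notin> J" for l using inv that by simp
    qed (rule L')+
    moreover have "\<exists>l'\<in>L'. l \<ominus> l' \<in> J \<inter> G (Suc k)" if l: "l \<in> L" for l
    proof -
      obtain l' i where l': "l' \<in> L'" and i: "i \<in> J \<inter> G (Suc k)" and eq: "l = l' \<oplus> i" using dec[OF l] by blast
      have [simp]: "l' \<in> carrier R" "i \<in> carrier R" using l' i L'(3) L(2) Ec G_carrier by auto
      have "l' \<oplus> i \<ominus> l' = i" by (simp add: ring_identity_simps)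
      then have "l \<ominus> l' = i" unfolding eq .
      then show ?thesis using l' i by metis
    qed
    ultimately show ?thesis using L'(3) by blast
  qed
  have "\<exists>L. \<forall>k. (good k (L k) \<and> (k = 0 \<longrightarrow> L k = E)) \<and>
    (L (Suc k) \<subseteq> L k \<and> (\<forall>l\<in>L k. \<exists>l'\<in>L (Suc k). l \<ominus> l' \<in> J \<inter> G (Suc k)))"
  proof (rule dependent_nat_choice)
    show "\<exists>L. good 0 L \<and> (0 = (0::nat) \<longrightarrow> L = E)" using good0 by blast
    fix L k assume "good k L \<and> (k = 0 \<longrightarrow> L = E)"
    then have "good k L" ..
    from step[OF this] show "\<exists>L'. (good (Suc k) L' \<and> (Suc k = 0 \<longrightarrow> L' = E)) \<and>
        (L' \<subseteq> L \<and> (\<forall>l\<in>L. \<exists>l'\<in>L'. l \<ominus> l' \<in> J \<inter> G (Suc k)))"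
      by simp
  qed
  then obtain L where "\<forall>k. (good k (L k) \<and> (k = 0 \<longrightarrow> L k = E)) \<and>
    (L (Suc k) \<subseteq> L k \<and> (\<forall>l\<in>L k. \<exists>l'\<in>L (Suc k). l \<ominus> l' \<in> J \<inter> G (Suc k)))" ..
  then have good: "good k (L k)" and L0: "L 0 = E"
    and dec: "L (Suc k) \<subseteq> L k" "l \<in> L k \<Longrightarrow> \<exists>l'\<in>L (Suc k). l \<ominus> l' \<in> J \<inter> G (Suc k)" for k l
    by simp_all
  have L: "subring (L k) R" "L k \<subseteq> E" "J \<inter> G (Suc k) \<subseteq> L k" "L k \<inter> J \<subseteq> G (Suc k)" for k
    using good[of k] unfolding good_def by auto
  have "subring (\<Inter>k. L k) R" by (rule subring_Inter) (use L in auto)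
  moreover have "(\<Inter>k. L k) \<subseteq> E" using L0 by blast
  moreover have "(\<Inter>k. L k) \<inter> J \<subseteq> {\<zero>}"
  proof
    fix x assume x: "x \<in> (\<Inter>k. L k) \<inter> J"
    have "x \<in> G k" for k using x L(4)[of k] G_Suc[of k] by blast
    then show "x \<in> {\<zero>}" using G_separated by blast
  qed
  moreover have "\<exists>l\<in>(\<Inter>k. L k). \<exists>j\<in>J. e = l \<oplus> j" if e: "e \<in> E" for e
  proof -
    \<comment> \<open>Successive representatives of e: each lies in the next smaller subring and
      differs from its predecessor by an element of the current layer.\<close>
    have "\<exists>s. \<forall>k. (s k \<in> L k \<and> (k = 0 \<longrightarrow> s k = e)) \<and> s k \<ominus> s (Suc k) \<in> J \<inter> G (Suc k)"
    proof (rule dependent_nat_choice)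
      show "\<exists>x. x \<in> L 0 \<and> (0 = (0::nat) \<longrightarrow> x = e)" using e L0 by simp
      fix x k assume "x \<in> L k \<and> (k = 0 \<longrightarrow> x = e)"
      then have "x \<in> L k" ..
      from dec(2)[OF this]
      show "\<exists>y. (y \<in> L (Suc k) \<and> (Suc k = 0 \<longrightarrow> y = e)) \<and> x \<ominus> y \<in> J \<inter> G (Suc k)" by auto
    qed
    then obtain s where "\<forall>k. (s k \<in> L k \<and> (k = 0 \<longrightarrow> s k = e)) \<and> s k \<ominus> s (Suc k) \<in> J \<inter> G (Suc k)" ..
    then have s: "s k \<in> L k" and s0: "s 0 = e" and ss: "s k \<ominus> s (Suc k) \<in> J \<inter> G (Suc k)" for k
      by simp_all
    have sc: "s k \<in> carrier R" for k using s L(2) Ec by blast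
    have ss': "s (Suc k) \<ominus> s k \<in> J \<inter> G (Suc k)" for k
    proof -
      have "s (Suc k) \<ominus> s k = \<ominus> (s k \<ominus> s (Suc k))"
        using sc by (simp add: minus_eq minus_add a_comm)
      then show ?thesis using ss[of k] J.a_inv_closed G_uminus by simp
    qed
    have "\<exists>x\<in>carrier R. \<forall>k. x \<ominus> s k \<in> G k"
      by (rule G_complete[OF sc]) (use ss' G_Suc in blast)
    then obtain x where xc: "x \<in> carrier R" and x: "\<And>k. x \<ominus> s k \<in> G k" by blast
    have tele: "(a \<ominus> b) \<oplus> (b \<ominus> c) = a \<ominus> c"
      if [simp]: "a \<in> carrier R" "b \<in> carrier R" "c \<in> carrier R" for a b c
      by (simp add: ring_identity_simps)
    have sJ: "s (k + m) \<ominus> s k \<in> J" for k m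
    proof (induction m)
      case 0
      then show ?case using sc J.zero_closed by (simp add: minus_eq r_neg)
    next
      case (Suc m)
      have "(s (k + Suc m) \<ominus> s (k + m)) \<oplus> (s (k + m) \<ominus> s k) \<in> J"
        using ss'[of "k + m"] Suc J.a_closed by simp
      then show ?case by (simp only: tele[OF sc sc sc])
    qed
    \<comment> \<open>The differences of the approximations from \<open>s k\<close> stay in J and
      converge to \<open>x \<ominus> s k\<close>, so closedness of J applies.\<close>
    have xJ: "x \<ominus> s k \<in> J" for k
    proof (rule closed)
      show "x \<ominus> s k \<in> carrier R" using xc sc by simp
      fix m
      have "(x \<ominus> b) \<ominus> (a \<ominus> b) = x \<ominus> a" if [simp]: "a \<in> carrier R" "b \<in> carrier R" for a b
        using xc[simp] by (simp add: ring_identity_simps)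
      then have "(x \<ominus> s k) \<ominus> (s (k + m) \<ominus> s k) = x \<ominus> s (k + m)" using sc by simp
      then have "(x \<ominus> s k) \<ominus> (s (k + m) \<ominus> s k) \<in> G m" using x[of "k + m"] G_mono[of m "k + m"] by auto
      then show "\<exists>j\<in>J. (x \<ominus> s k) \<ominus> j \<in> G m" using sJ by blast
    qed
    \<comment> \<open>The rate of convergence only gives \<open>G k\<close>, one step short. Passing
      through \<open>s (Suc k)\<close> gains that step and puts the difference into the part of J
      that \<open>L k\<close> contains.\<close>
    have "x \<in> L k" for k
    proof -
      have "x \<ominus> s k = (x \<ominus> s (Suc k)) \<oplus> (s (Suc k) \<ominus> s k)" using tele xc sc by simp
      then have "x \<ominus> s k \<in> G (Suc k)" using x[of "Suc k"] ss'[of k] G_add by simp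
      then have "x \<ominus> s k \<in> L k" using xJ L(3) by blast
      moreover have "x = (x \<ominus> s k) \<oplus> s k" using xc sc by (simp add: minus_eq a_assoc l_neg)
      ultimately show ?thesis using subringE(7)[OF L(1) _ s] by metis
    qed
    moreover have "e = x \<oplus> \<ominus> (x \<ominus> s 0)" using xc Ec[OF e] unfolding s0
      by (simp add: minus_add minus_eq a_assoc[symmetric] r_neg)
    moreover have "\<ominus> (x \<ominus> s 0) \<in> J" by (rule J.a_inv_closed[OF xJ])
    ultimately show ?thesis by blast
  qed
  ultimately show ?thesis by blast
qed

lemma (in ring_hom_cring) hom_add_pow_one: "h ([(n::nat)] \<cdot>\<^bsub>R\<^esub> \<one>\<^bsub>R\<^esub>) = [n] \<cdot>\<^bsub>S\<^esub> \<one>\<^bsub>S\<^esub>"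
  by (induction n) auto

text \<open>Inside the preimage E of g(K), the kernel J of \<pi> is a maximal ideal with quotient
  g(K). A subring L of E that represents all residues modulo J and meets J only in zero is mapped
  bijectively onto g(K) by \<pi>; following g by the inverse of this bijection gives \<tau>.\<close>

lemma (in complete_filtered_ring) field_hom_lift:
  assumes A: "complete_filtered_ring A H" and K: "field K" and g: "g \<in> ring_hom K A" and \<pi>: "\<pi> \<in> ring_hom R A"
    and \<pi>_G: "\<And>k x. x \<in> G k \<Longrightarrow> \<pi> x \<in> H k"
    and img: "g ` carrier K \<subseteq> \<pi> ` carrier R"
    and nontriv: "\<one>\<^bsub>A\<^esub> \<noteq> \<zero>\<^bsub>A\<^esub>"
    and ker: "\<And>x. \<lbrakk>x \<in> carrier R; \<pi> x = \<zero>\<^bsub>A\<^esub>\<rbrakk> \<Longrightarrow> x \<in> G 1"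
    and char: "(\<forall>n::nat. 0 < n \<longrightarrow> [n] \<cdot>\<^bsub>A\<^esub> \<one>\<^bsub>A\<^esub> \<noteq> \<zero>\<^bsub>A\<^esub>) \<or> (\<exists>q::nat. Factorial_Ring.prime q \<and> [q] \<cdot> \<one> = \<zero>)"
  shows "\<exists>\<tau>\<in>ring_hom K R. \<forall>k\<in>carrier K. \<pi> (\<tau> k) = g k"
proof -
  interpret A: complete_filtered_ring A H by fact
  interpret K: field K by fact
  interpret \<pi>: ring_hom_cring R A \<pi> by unfold_locales fact
  interpret g: ring_hom_cring K A g by unfold_locales fact
  have g0: "k = \<zero>\<^bsub>K\<^esub>" if k: "k \<in> carrier K" "g k = \<zero>\<^bsub>A\<^esub>" for k
  proof (rule ccontr)
    assume "k \<noteq> \<zero>\<^bsub>K\<^esub>"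
    then have "k \<in> Units K" using k K.field_Units by blast
    then have "k \<otimes>\<^bsub>K\<^esub> inv\<^bsub>K\<^esub> k = \<one>\<^bsub>K\<^esub>" "inv\<^bsub>K\<^esub> k \<in> carrier K" by auto
    then have "g k \<otimes>\<^bsub>A\<^esub> g (inv\<^bsub>K\<^esub> k) = \<one>\<^bsub>A\<^esub>" using k g.hom_mult g.hom_one by metis
    then show False using k nontriv \<open>inv\<^bsub>K\<^esub> k \<in> carrier K\<close> by simp
  qed
  have img': "\<exists>r\<in>carrier R. \<pi> r = g k" if "k \<in> carrier K" for k
  proof -
    have "g k \<in> \<pi> ` carrier R" using img that by blast
    then obtain r where "g k = \<pi> r" "r \<in> carrier R" by (rule imageE)
    then show ?thesis by (intro bexI[of _ r]) simp_all
  qed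
  define J where "J = {x \<in> carrier R. \<pi> x = \<zero>\<^bsub>A\<^esub>}"
  define E where "E = {x \<in> carrier R. \<pi> x \<in> g ` carrier K}"
  have EI: "x \<in> E" if "x \<in> carrier R" "k \<in> carrier K" "\<pi> x = g k" for x k
    using that by (auto simp: E_def)
  have Jid: "ideal J R"
  proof (rule idealI[OF ring_axioms])
    show "subgroup J (add_monoid R)"
    proof (rule add.subgroupI)
      have "\<zero> \<in> J" by (simp add: J_def)
      then show "J \<noteq> {}" by blast
    qed (auto simp: J_def)
  qed (auto simp: J_def)
  have JI: "x \<in> J" if "x \<in> carrier R" "\<pi> x = \<zero>\<^bsub>A\<^esub>" for x using that by (simp add: J_def)
  have JD: "x \<in> carrier R" "\<pi> x = \<zero>\<^bsub>A\<^esub>" if "x \<in> J" for x using that by (simp_all add: J_def)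
  have "\<exists>L. subring L R \<and> L \<subseteq> E \<and> L \<inter> J \<subseteq> {\<zero>} \<and> (\<forall>e\<in>E. \<exists>l\<in>L. \<exists>j\<in>J. e = l \<oplus> j)"
  proof (rule residues_lift_tower[OF _ Jid])
    show "subring E R"
    proof (rule subringI)
      show "E \<subseteq> carrier R" by (auto simp: E_def)
      show "\<one> \<in> E" by (rule EI[of _ "\<one>\<^bsub>K\<^esub>"]) auto
      fix x assume "x \<in> E"
      then obtain k where x: "x \<in> carrier R" "k \<in> carrier K" "\<pi> x = g k" by (auto simp: E_def)
      then show "\<ominus> x \<in> E" by (intro EI[of _ "\<ominus>\<^bsub>K\<^esub> k"]) auto
      fix y assume "y \<in> E"
      then obtain k' where y: "y \<in> carrier R" "k' \<in> carrier K" "\<pi> y = g k'" by (auto simp: E_def)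
      show "x \<otimes> y \<in> E" using x y by (intro EI[of _ "k \<otimes>\<^bsub>K\<^esub> k'"]) auto
      show "x \<oplus> y \<in> E" using x y by (intro EI[of _ "k \<oplus>\<^bsub>K\<^esub> k'"]) auto
    qed
    show "J \<subseteq> E"
    proof
      fix x assume "x \<in> J"
      then show "x \<in> E" using EI[of x "\<zero>\<^bsub>K\<^esub>"] JD[of x] by simp
    qed
    show "J \<subseteq> G 1" using ker JD by blast
    show "\<one> \<notin> J" using nontriv JD(2)[of \<one>] by auto
    have "[n] \<cdot> \<one> \<notin> J" if "[n] \<cdot>\<^bsub>A\<^esub> \<one>\<^bsub>A\<^esub> \<noteq> \<zero>\<^bsub>A\<^esub>" for n :: nat
      using JD(2)[of "[n] \<cdot> \<one>"] that by (auto simp: \<pi>.hom_add_pow_one)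
    then show "(\<forall>n::nat. 0 < n \<longrightarrow> [n] \<cdot> \<one> \<notin> J) \<or> (\<exists>q::nat. Factorial_Ring.prime q \<and> [q] \<cdot> \<one> = \<zero>)"
      using char by blast
  next
    \<comment> \<open>The kernel is closed because \<pi> respects the filtrations and that of A is
      separated.\<close>
    fix x assume x: "x \<in> carrier R" and near: "\<And>k. \<exists>j\<in>J. x \<ominus> j \<in> G k"
    have "\<pi> x \<in> H k" for k
    proof -
      obtain j where j: "j \<in> J" "x \<ominus> j \<in> G k" using near by blast
      have "\<pi> (x \<ominus> j) = \<pi> x" using JD[OF j(1)] x by (simp add: minus_eq A.minus_eq)
      then show ?thesis using \<pi>_G[OF j(2)] by simp
    qed
    then have "\<pi> x = \<zero>\<^bsub>A\<^esub>" using A.G_separated by blast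
    then show "x \<in> J" by (rule JI[OF x])
  next
    fix e assume e: "e \<in> E" "e \<notin> J"
    then obtain k where k: "e \<in> carrier R" "k \<in> carrier K" "\<pi> e = g k" by (auto simp: E_def)
    then have "k \<noteq> \<zero>\<^bsub>K\<^esub>" using e JI[of e] by auto
    then have "k \<in> Units K" using k K.field_Units by blast
    then have ik: "k \<otimes>\<^bsub>K\<^esub> inv\<^bsub>K\<^esub> k = \<one>\<^bsub>K\<^esub>" "inv\<^bsub>K\<^esub> k \<in> carrier K" by auto
    then obtain v where v: "v \<in> carrier R" "\<pi> v = g (inv\<^bsub>K\<^esub> k)" using img'[OF ik(2)] by blast
    have ev: "\<pi> (e \<otimes> v) = \<one>\<^bsub>A\<^esub>" using k v ik g.hom_mult[of k "inv\<^bsub>K\<^esub> k"] by simp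
    then have "\<pi> (e \<otimes> v \<ominus> \<one>) = \<zero>\<^bsub>A\<^esub>" using k v by (simp add: minus_eq A.r_neg)
    \<comment> \<open>A lift v of the inverse residue inverts e only modulo J. The geometric series
      supplies a factor u that makes it exact; u maps to 1, so v u stays in E.\<close>
    then have "e \<otimes> v \<ominus> \<one> \<in> G 1" using ker k v by simp
    then obtain u where u: "u \<in> carrier R" "(\<one> \<oplus> (e \<otimes> v \<ominus> \<one>)) \<otimes> u = \<one>" using one_plus_G_Units by blast
    have "\<one> \<oplus> (a \<ominus> \<one>) = a" if [simp]: "a \<in> carrier R" for a
      by (simp add: ring_identity_simps)
    then have evu: "e \<otimes> v \<otimes> u = \<one>" using u(2) k v by simp
    have "\<pi> (e \<otimes> v) \<otimes>\<^bsub>A\<^esub> \<pi> u = \<pi> (e \<otimes> v \<otimes> u)" using k v u by simp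
    then have "\<pi> (e \<otimes> v) \<otimes>\<^bsub>A\<^esub> \<pi> u = \<one>\<^bsub>A\<^esub>" unfolding evu by simp
    then have "\<pi> u = \<one>\<^bsub>A\<^esub>" unfolding ev using u by simp
    then have "v \<otimes> u \<in> E" using EI[of "v \<otimes> u" "inv\<^bsub>K\<^esub> k"] v u ik by simp
    moreover have "e \<otimes> (v \<otimes> u) = \<one>" using evu k v u by (simp add: m_assoc)
    ultimately show "\<exists>u\<in>E. e \<otimes> u = \<one>" by blast
  qed
  then obtain L where L: "subring L R" "L \<subseteq> E" "L \<inter> J \<subseteq> {\<zero>}"
    and dec: "\<And>e. e \<in> E \<Longrightarrow> \<exists>l\<in>L. \<exists>j\<in>J. e = l \<oplus> j" by blast
  have Lc: "x \<in> carrier R" if "x \<in> L" for x using that subringE(1)[OF L(1)] by blast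
  have ex: "\<exists>l\<in>L. \<pi> l = g k" if k: "k \<in> carrier K" for k
  proof -
    obtain e where e: "e \<in> carrier R" "\<pi> e = g k" using img'[OF k] by blast
    then obtain l j where l: "l \<in> L" and j: "j \<in> J" and eq: "e = l \<oplus> j"
      using dec[OF EI[OF e(1) k e(2)]] by blast
    have "\<pi> e = \<pi> l" using JD[OF j] Lc[OF l] unfolding eq by simp
    then show ?thesis using l e by auto
  qed
  have unique: "l = l'" if "l \<in> L" "l' \<in> L" "\<pi> l = \<pi> l'" for l l'
  proof -
    have "l \<ominus> l' \<in> L" using that subringE(5,7)[OF L(1)] by (simp add: minus_eq)
    moreover have "l \<ominus> l' \<in> J" using that Lc by (intro JI) (auto simp: minus_eq A.r_neg)
    ultimately have "l \<ominus> l' = \<zero>" using L(3) by blast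
    then show ?thesis using that Lc by simp
  qed
  obtain \<tau> where \<tau>: "\<And>k. k \<in> carrier K \<Longrightarrow> \<tau> k \<in> L \<and> \<pi> (\<tau> k) = g k" using ex by metis
  have "\<tau> \<in> ring_hom K R"
  proof (rule ring_hom_memI)
    fix k assume k: "k \<in> carrier K"
    show "\<tau> k \<in> carrier R" using \<tau>[OF k] Lc by blast
    fix k' assume k': "k' \<in> carrier K"
    show "\<tau> (k \<otimes>\<^bsub>K\<^esub> k') = \<tau> k \<otimes> \<tau> k'"
      using \<tau>[OF k] \<tau>[OF k'] \<tau>[of "k \<otimes>\<^bsub>K\<^esub> k'"] k k' Lc subringE(6)[OF L(1)] by (intro unique) auto
    show "\<tau> (k \<oplus>\<^bsub>K\<^esub> k') = \<tau> k \<oplus> \<tau> k'"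
      using \<tau>[OF k] \<tau>[OF k'] \<tau>[of "k \<oplus>\<^bsub>K\<^esub> k'"] k k' Lc subringE(7)[OF L(1)] by (intro unique) auto
  next
    show "\<tau> \<one>\<^bsub>K\<^esub> = \<one>" using \<tau>[of "\<one>\<^bsub>K\<^esub>"] subringE(3)[OF L(1)] by (intro unique) auto
  qed
  then show ?thesis using \<tau> by blast
qed

section \<open>Finite homomorphisms\<close>

text \<open>The submodule generated by B when S acts on T through \<phi>. Building combinations term
  by term allows a generator to recur, which turns closure properties into plain inductions;
  \<open>hspan_imp_finsum\<close> later collects the terms for finite B.\<close>

inductive_set hom_span :: "('a, 'b) ring_scheme \<Rightarrow> ('c, 'd) ring_scheme \<Rightarrow> ('a \<Rightarrow> 'c) \<Rightarrow> 'c set \<Rightarrow> 'c set"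
  for S :: "('a, 'b) ring_scheme" and T :: "('c, 'd) ring_scheme" and \<phi> :: "'a \<Rightarrow> 'c" and B :: "'c set" where
  zero: "\<zero>\<^bsub>T\<^esub> \<in> hom_span S T \<phi> B"
| add: "\<lbrakk>b \<in> B; p \<in> carrier S; s \<in> hom_span S T \<phi> B\<rbrakk> \<Longrightarrow> \<phi> p \<otimes>\<^bsub>T\<^esub> b \<oplus>\<^bsub>T\<^esub> s \<in> hom_span S T \<phi> B"

context ring_hom_cring
begin

abbreviation hspan where "hspan \<equiv> hom_span R S h"

lemma hspan_closed:
  assumes "B \<subseteq> carrier S" "s \<in> hspan B"
  shows "s \<in> carrier S"
  using assms(2) by induction (use assms(1) in auto)

lemma hspan_plus:
  assumes B: "B \<subseteq> carrier S" and "s \<in> hspan B" and t: "t \<in> hspan B"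
  shows "s \<oplus>\<^bsub>S\<^esub> t \<in> hspan B"
  using assms(2)
proof induction
  case zero
  then show ?case using t hspan_closed[OF B t] by simp
next
  case (add b p s)
  have "b \<in> carrier S" "s \<in> carrier S" "t \<in> carrier S" using add B hspan_closed[OF B] t by auto
  then have "h p \<otimes>\<^bsub>S\<^esub> b \<oplus>\<^bsub>S\<^esub> s \<oplus>\<^bsub>S\<^esub> t = h p \<otimes>\<^bsub>S\<^esub> b \<oplus>\<^bsub>S\<^esub> (s \<oplus>\<^bsub>S\<^esub> t)"
    using add(2) by (simp add: S.a_assoc)
  then show ?case using hom_span.add[OF add(1,2,4)] by simp
qed

lemma hspan_smult:
  assumes B: "B \<subseteq> carrier S" and q: "q \<in> carrier R" and "s \<in> hspan B"
  shows "h q \<otimes>\<^bsub>S\<^esub> s \<in> hspan B"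
  using assms(3)
proof induction
  case zero
  then show ?case using q by (simp add: hom_span.zero)
next
  case (add b p s)
  have "b \<in> carrier S" "s \<in> carrier S" using add B hspan_closed[OF B] by auto
  then have "h q \<otimes>\<^bsub>S\<^esub> (h p \<otimes>\<^bsub>S\<^esub> b \<oplus>\<^bsub>S\<^esub> s) = h (q \<otimes> p) \<otimes>\<^bsub>S\<^esub> b \<oplus>\<^bsub>S\<^esub> h q \<otimes>\<^bsub>S\<^esub> s"
    using add(2) q by (simp add: S.r_distr S.m_assoc)
  then show ?case using hom_span.add[OF add(1) R.m_closed[OF q add(2)] add(4)] by simp
qed

lemma hspan_uminus:
  assumes B: "B \<subseteq> carrier S" and s: "s \<in> hspan B"
  shows "\<ominus>\<^bsub>S\<^esub> s \<in> hspan B"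
proof -
  have "h (\<ominus> \<one>) \<otimes>\<^bsub>S\<^esub> s = \<ominus>\<^bsub>S\<^esub> s" using hspan_closed[OF B s] by (simp add: S.l_minus)
  then show ?thesis using hspan_smult[OF B _ s, of "\<ominus> \<one>"] by simp
qed

lemma hspan_base: "\<lbrakk>B \<subseteq> carrier S; b \<in> B\<rbrakk> \<Longrightarrow> b \<in> hspan B"
  using hom_span.add[OF _ R.one_closed hom_span.zero, of b B S h] by (auto simp: subset_iff)

lemma hspan_trans:
  assumes B: "B \<subseteq> carrier S" and B': "B' \<subseteq> hspan B" and "s \<in> hspan B'"
  shows "s \<in> hspan B"
  using assms(3)
proof induction
  case (add b p s)
  then show ?case using hspan_plus[OF B hspan_smult[OF B]] B' by blast
qed (rule hom_span.zero)

lemma hspan_mono: "\<lbrakk>B \<subseteq> carrier S; B' \<subseteq> B; s \<in> hspan B'\<rbrakk> \<Longrightarrow> s \<in> hspan B"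
  using hspan_trans[of B B' s] hspan_base by blast

lemma hspan_mult:
  assumes B: "B \<subseteq> carrier S" and z: "z \<in> carrier S" and "s \<in> hspan B"
  shows "z \<otimes>\<^bsub>S\<^esub> s \<in> hspan ((\<lambda>b. z \<otimes>\<^bsub>S\<^esub> b) ` B)"
  using assms(3)
proof induction
  case zero
  then show ?case using z by (simp add: hom_span.zero)
next
  case (add b p s)
  have "b \<in> carrier S" "s \<in> carrier S" using add B hspan_closed[OF B] by auto
  then have "z \<otimes>\<^bsub>S\<^esub> (h p \<otimes>\<^bsub>S\<^esub> b \<oplus>\<^bsub>S\<^esub> s) = h p \<otimes>\<^bsub>S\<^esub> (z \<otimes>\<^bsub>S\<^esub> b) \<oplus>\<^bsub>S\<^esub> z \<otimes>\<^bsub>S\<^esub> s"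
    using add(2) z by (simp add: S.r_distr S.m_lcomm)
  then show ?case using hom_span.add[OF imageI[OF add(1)] add(2,4)] by simp
qed

lemma hspan_insert:
  assumes B: "insert b B \<subseteq> carrier S" and "s \<in> hspan (insert b B)"
  shows "\<exists>p\<in>carrier R. \<exists>t\<in>hspan B. s = h p \<otimes>\<^bsub>S\<^esub> b \<oplus>\<^bsub>S\<^esub> t"
  using assms(2)
proof induction
  case zero
  then show ?case using B by (intro bexI[of _ \<zero>] bexI[of _ "\<zero>\<^bsub>S\<^esub>"]) (auto simp: hom_span.zero)
next
  case (add b' q s)
  then obtain p t where p: "p \<in> carrier R" and t: "t \<in> hspan B" and s: "s = h p \<otimes>\<^bsub>S\<^esub> b \<oplus>\<^bsub>S\<^esub> t" by blast
  have c: "b \<in> carrier S" "b' \<in> carrier S" "t \<in> carrier S" using B add(1) t hspan_closed[of B] by auto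
  show ?case
  proof (cases "b' = b")
    case True
    then have "h q \<otimes>\<^bsub>S\<^esub> b' \<oplus>\<^bsub>S\<^esub> s = h (q \<oplus> p) \<otimes>\<^bsub>S\<^esub> b \<oplus>\<^bsub>S\<^esub> t"
      unfolding s using c p add(2) by (simp add: S.l_distr S.a_assoc)
    then show ?thesis using t p add(2) by blast
  next
    case False
    then have "h q \<otimes>\<^bsub>S\<^esub> b' \<oplus>\<^bsub>S\<^esub> t \<in> hspan B" using add(1,2) t hom_span.add[of b' B q R t S h] by blast
    moreover have "h q \<otimes>\<^bsub>S\<^esub> b' \<oplus>\<^bsub>S\<^esub> s = h p \<otimes>\<^bsub>S\<^esub> b \<oplus>\<^bsub>S\<^esub> (h q \<otimes>\<^bsub>S\<^esub> b' \<oplus>\<^bsub>S\<^esub> t)"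
      unfolding s using c p add(2) by (simp add: S.a_lcomm)
    ultimately show ?thesis using p by blast
  qed
qed

lemma finsum_in_hspan:
  assumes B: "B \<subseteq> carrier S" and "finite B" "c \<in> B \<rightarrow> carrier R"
  shows "(\<Oplus>\<^bsub>S\<^esub>b\<in>B. h (c b) \<otimes>\<^bsub>S\<^esub> b) \<in> hspan B"
  using assms(2,1,3)
proof (induction B rule: finite_induct)
  case empty
  then show ?case by (simp add: hom_span.zero)
next
  case (insert b B)
  have "(\<Oplus>\<^bsub>S\<^esub>b\<in>insert b B. h (c b) \<otimes>\<^bsub>S\<^esub> b) = h (c b) \<otimes>\<^bsub>S\<^esub> b \<oplus>\<^bsub>S\<^esub> (\<Oplus>\<^bsub>S\<^esub>b\<in>B. h (c b) \<otimes>\<^bsub>S\<^esub> b)"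
    using insert by (intro S.finsum_insert) auto
  moreover have "(\<Oplus>\<^bsub>S\<^esub>b\<in>B. h (c b) \<otimes>\<^bsub>S\<^esub> b) \<in> hspan (insert b B)"
    using insert by (intro hspan_mono[of "insert b B" B]) auto
  ultimately show ?case using insert.prems by (simp add: hom_span.add)
qed

lemma hspan_imp_finsum:
  assumes "finite B" "B \<subseteq> carrier S" "s \<in> hspan B"
  shows "\<exists>c\<in>B \<rightarrow> carrier R. s = (\<Oplus>\<^bsub>S\<^esub>b\<in>B. h (c b) \<otimes>\<^bsub>S\<^esub> b)"
  using assms
proof (induction B arbitrary: s rule: finite_induct)
  case empty
  from empty(2) have "s = \<zero>\<^bsub>S\<^esub>" by induction auto
  then show ?case by simp
next
  case (insert b B)
  obtain p t where p: "p \<in> carrier R" and t: "t \<in> hspan B" and s: "s = h p \<otimes>\<^bsub>S\<^esub> b \<oplus>\<^bsub>S\<^esub> t"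
    using hspan_insert[OF insert.prems] by blast
  obtain c where c: "c \<in> B \<rightarrow> carrier R" and tc: "t = (\<Oplus>\<^bsub>S\<^esub>b\<in>B. h (c b) \<otimes>\<^bsub>S\<^esub> b)"
    using insert.IH[OF _ t] insert.prems by blast
  have cc: "c x \<in> carrier R" "x \<in> carrier S" if "x \<in> B" for x using c that insert.prems(1) by auto
  let ?c = "c(b := p)"
  have "(\<Oplus>\<^bsub>S\<^esub>b\<in>insert b B. h (?c b) \<otimes>\<^bsub>S\<^esub> b) = h (?c b) \<otimes>\<^bsub>S\<^esub> b \<oplus>\<^bsub>S\<^esub> (\<Oplus>\<^bsub>S\<^esub>b\<in>B. h (?c b) \<otimes>\<^bsub>S\<^esub> b)"
    using insert.hyps insert.prems(1) cc p by (intro S.finsum_insert) auto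
  also have "(\<Oplus>\<^bsub>S\<^esub>b\<in>B. h (?c b) \<otimes>\<^bsub>S\<^esub> b) = t"
    unfolding tc using insert.hyps cc by (intro S.finsum_cong') auto
  finally show ?case using cc p s by (intro bexI[of _ ?c]) auto
qed

text \<open>
  A generator can be dropped because it equals a combination of generators whose coefficient at
  the generator itself is \<open>x c\<close>, and \<open>1 - x c\<close> is a unit.
\<close>

lemma nakayama_hom:
  assumes x: "x \<in> carrier R" and unit: "\<And>c. c \<in> carrier R \<Longrightarrow> \<exists>u\<in>carrier R. (\<one> \<ominus> x \<otimes> c) \<otimes> u = \<one>"
    and v: "v \<in> carrier S" "h x \<otimes>\<^bsub>S\<^esub> v = \<one>\<^bsub>S\<^esub>"
    and B: "finite B" "B \<subseteq> carrier S" "carrier S \<subseteq> hspan B"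
  shows "\<one>\<^bsub>S\<^esub> = \<zero>\<^bsub>S\<^esub>"
  using B
proof (induction B rule: finite_induct)
  case empty
  then have "\<one>\<^bsub>S\<^esub> \<in> hspan {}" by blast
  then show ?case by (cases rule: hom_span.cases) auto
next
  case (insert b B)
  have bc: "b \<in> carrier S" and B: "B \<subseteq> carrier S" using insert.prems by auto
  \<comment> \<open>It is \<open>v b\<close>, not b, that is expanded: multiplication by
    \<open>h x\<close> turns the left side back into b and gives every coefficient on the right the
    factor x.\<close>
  have "v \<otimes>\<^bsub>S\<^esub> b \<in> hspan (insert b B)" using insert.prems v bc by blast
  then obtain c t where c: "c \<in> carrier R" and t: "t \<in> hspan B" and vb: "v \<otimes>\<^bsub>S\<^esub> b = h c \<otimes>\<^bsub>S\<^esub> b \<oplus>\<^bsub>S\<^esub> t"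
    using hspan_insert[OF insert.prems(1)] by blast
  have tc: "t \<in> carrier S" by (rule hspan_closed[OF B t])
  obtain u where u: "u \<in> carrier R" "(\<one> \<ominus> x \<otimes> c) \<otimes> u = \<one>" using unit[OF c] by blast
  have "b = h x \<otimes>\<^bsub>S\<^esub> v \<otimes>\<^bsub>S\<^esub> b" using v bc by simp
  also have "\<dots> = h x \<otimes>\<^bsub>S\<^esub> (v \<otimes>\<^bsub>S\<^esub> b)" by (rule S.m_assoc) (use x v bc in auto)
  also have "\<dots> = h (x \<otimes> c) \<otimes>\<^bsub>S\<^esub> b \<oplus>\<^bsub>S\<^esub> h x \<otimes>\<^bsub>S\<^esub> t" unfolding vb using x c bc tc by (simp add: S.r_distr S.m_assoc)
  finally have b: "b = h (x \<otimes> c) \<otimes>\<^bsub>S\<^esub> b \<oplus>\<^bsub>S\<^esub> h x \<otimes>\<^bsub>S\<^esub> t" .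
  have "h (\<one> \<ominus> x \<otimes> c) \<otimes>\<^bsub>S\<^esub> b = b \<oplus>\<^bsub>S\<^esub> \<ominus>\<^bsub>S\<^esub> (h (x \<otimes> c) \<otimes>\<^bsub>S\<^esub> b)"
    using x c bc by (simp add: R.minus_eq S.l_distr S.l_minus)
  also have "\<dots> = (h (x \<otimes> c) \<otimes>\<^bsub>S\<^esub> b \<oplus>\<^bsub>S\<^esub> h x \<otimes>\<^bsub>S\<^esub> t) \<oplus>\<^bsub>S\<^esub> \<ominus>\<^bsub>S\<^esub> (h (x \<otimes> c) \<otimes>\<^bsub>S\<^esub> b)"
    by (rule arg_cong[where f = "\<lambda>z. z \<oplus>\<^bsub>S\<^esub> \<ominus>\<^bsub>S\<^esub> (h (x \<otimes> c) \<otimes>\<^bsub>S\<^esub> b)"]) (rule b)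
  also have "\<dots> = h x \<otimes>\<^bsub>S\<^esub> t"
    using x c bc tc by (simp add: S.a_comm[of "h x \<otimes>\<^bsub>S\<^esub> h c \<otimes>\<^bsub>S\<^esub> b"] S.a_assoc S.r_neg)
  finally have 1: "h (\<one> \<ominus> x \<otimes> c) \<otimes>\<^bsub>S\<^esub> b = h x \<otimes>\<^bsub>S\<^esub> t" .
  have "b = h ((\<one> \<ominus> x \<otimes> c) \<otimes> u) \<otimes>\<^bsub>S\<^esub> b" using u(2) bc by simp
  also have "\<dots> = h u \<otimes>\<^bsub>S\<^esub> (h (\<one> \<ominus> x \<otimes> c) \<otimes>\<^bsub>S\<^esub> b)"
    using u(1) x c bc by (simp only: hom_mult R.minus_closed R.one_closed R.m_closed hom_closed S.m_ac)
  also have "\<dots> = h u \<otimes>\<^bsub>S\<^esub> (h x \<otimes>\<^bsub>S\<^esub> t)" unfolding 1 ..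
  finally have "b \<in> hspan B" using hspan_smult[OF B u(1) hspan_smult[OF B x t]] by simp
  then have "insert b B \<subseteq> hspan B" using hspan_base[OF B] by blast
  then have "carrier S \<subseteq> hspan B" using hspan_trans[OF B] insert.prems(2) by blast
  then show ?case by (rule insert.IH[OF B])
qed

end

text \<open>Gaussian elimination modulo Q. Coefficients in M act as zero and all others are
  invertible, so more vectors than there are generators have a nontrivial relation, nontrivial
  meaning that some coefficient lies outside M.\<close>

lemma (in ring_hom_cring) linear_dependence:
  assumes Q: "ideal Q S" and M: "\<And>a. \<lbrakk>a \<in> carrier R; a \<in> M\<rbrakk> \<Longrightarrow> h a \<in> Q"
    and unit: "\<And>a. \<lbrakk>a \<in> carrier R; a \<notin> M\<rbrakk> \<Longrightarrow> \<exists>u\<in>carrier R. a \<otimes> u = \<one>" and one: "\<one> \<notin> M"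
    and B: "finite B" "B \<subseteq> carrier S" and I: "finite I" "card B < card I"
    and v: "\<And>i. i \<in> I \<Longrightarrow> v i \<in> carrier S" "\<And>i. i \<in> I \<Longrightarrow> \<exists>s\<in>hspan B. v i \<ominus>\<^bsub>S\<^esub> s \<in> Q"
  shows "\<exists>c\<in>I \<rightarrow> carrier R. (\<exists>i\<in>I. c i \<notin> M) \<and> (\<Oplus>\<^bsub>S\<^esub>i\<in>I. h (c i) \<otimes>\<^bsub>S\<^esub> v i) \<in> Q"
proof -
  interpret Q: ideal Q S by fact
  show ?thesis using B I v
  proof (induction B arbitrary: I v rule: finite_induct)
    case empty
    have "v i \<in> Q" if i: "i \<in> I" for i
    proof -
      obtain s where s: "s \<in> hspan {}" "v i \<ominus>\<^bsub>S\<^esub> s \<in> Q" using empty.prems(5)[OF i] by blast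
      from s(1) have "s = \<zero>\<^bsub>S\<^esub>" by induction auto
      then show ?thesis using s(2) empty.prems(4)[OF i] by (simp add: S.minus_eq)
    qed
    then have "(\<Oplus>\<^bsub>S\<^esub>i\<in>I. h \<one> \<otimes>\<^bsub>S\<^esub> v i) \<in> Q"
      by (intro Q.finsum_mem S.ring_axioms Q.I_l_closed) auto
    moreover obtain i where "i \<in> I" using empty.prems(3) by fastforce
    ultimately show ?case using one by (intro bexI[of _ "\<lambda>_. \<one>"]) auto
  next
    case (insert b B)
    note prems = insert.prems
    have bc: "b \<in> carrier S" and B: "B \<subseteq> carrier S" using prems by auto
    have "\<forall>i\<in>I. \<exists>p. fst p \<in> carrier R \<and> snd p \<in> hspan B \<and> v i \<ominus>\<^bsub>S\<^esub> (h (fst p) \<otimes>\<^bsub>S\<^esub> b \<oplus>\<^bsub>S\<^esub> snd p) \<in> Q"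
    proof
      fix i assume "i \<in> I"
      then obtain s where s: "s \<in> hspan (insert b B)" "v i \<ominus>\<^bsub>S\<^esub> s \<in> Q" using prems(5) by blast
      obtain p t where "p \<in> carrier R" "t \<in> hspan B" "s = h p \<otimes>\<^bsub>S\<^esub> b \<oplus>\<^bsub>S\<^esub> t"
        using hspan_insert[OF prems(1) s(1)] by blast
      then show "\<exists>p. fst p \<in> carrier R \<and> snd p \<in> hspan B \<and> v i \<ominus>\<^bsub>S\<^esub> (h (fst p) \<otimes>\<^bsub>S\<^esub> b \<oplus>\<^bsub>S\<^esub> snd p) \<in> Q"
        using s(2) by (intro exI[of _ "(p, t)"]) simp
    qed
    then obtain f where f: "\<forall>i\<in>I. fst (f i) \<in> carrier R \<and> snd (f i) \<in> hspan B \<and>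
        v i \<ominus>\<^bsub>S\<^esub> (h (fst (f i)) \<otimes>\<^bsub>S\<^esub> b \<oplus>\<^bsub>S\<^esub> snd (f i)) \<in> Q"
      by (rule bchoice[THEN exE])
    define k t where "k i = fst (f i)" and "t i = snd (f i)" for i
    have k: "k i \<in> carrier R" and t: "t i \<in> hspan B"
      and q: "v i \<ominus>\<^bsub>S\<^esub> (h (k i) \<otimes>\<^bsub>S\<^esub> b \<oplus>\<^bsub>S\<^esub> t i) \<in> Q" if "i \<in> I" for i
      using f that by (auto simp: k_def t_def)
    have tc: "t i \<in> carrier S" if "i \<in> I" for i using hspan_closed[OF B t[OF that]] .
    note vc = prems(4)
    show ?case
    proof (cases "\<forall>i\<in>I. k i \<in> M")
      \<comment> \<open>The generator b enters only with coefficients whose images lie in Q, so the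
        vectors already lie in the span of B modulo Q.\<close>
      case True
      show ?thesis
      proof (rule insert.IH[OF B prems(2)])
        show "card B < card I" using prems(3) insert.hyps by simp
        fix i assume i: "i \<in> I"
        show "v i \<in> carrier S" using vc i .
        have "x \<ominus>\<^bsub>S\<^esub> z = (x \<ominus>\<^bsub>S\<^esub> (y \<oplus>\<^bsub>S\<^esub> z)) \<oplus>\<^bsub>S\<^esub> y"
          if [simp]: "x \<in> carrier S" "y \<in> carrier S" "z \<in> carrier S" for x y z
          by (simp add: S.ring_identity_simps)
        from this[OF vc[OF i] _ tc[OF i], of "h (k i) \<otimes>\<^bsub>S\<^esub> b"]
        have "v i \<ominus>\<^bsub>S\<^esub> t i = (v i \<ominus>\<^bsub>S\<^esub> (h (k i) \<otimes>\<^bsub>S\<^esub> b \<oplus>\<^bsub>S\<^esub> t i)) \<oplus>\<^bsub>S\<^esub> h (k i) \<otimes>\<^bsub>S\<^esub> b"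
          using k[OF i] bc by simp
        moreover have "h (k i) \<otimes>\<^bsub>S\<^esub> b \<in> Q" using M True k i bc by (intro Q.I_r_closed) auto
        ultimately have "v i \<ominus>\<^bsub>S\<^esub> t i \<in> Q" using q[OF i] Q.a_closed by simp
        then show "\<exists>s\<in>hspan B. v i \<ominus>\<^bsub>S\<^esub> s \<in> Q" using t[OF i] by blast
      qed
    next
      case False
      then obtain j where j: "j \<in> I" "k j \<notin> M" by blast
      then obtain u where u: "u \<in> carrier R" "k j \<otimes> u = \<one>" using unit k by blast
      let ?I = "I - {j}"
      \<comment> \<open>Row j is the pivot: subtracting \<open>g i\<close> times \<open>v j\<close>
        cancels the coefficient of b in row i, leaving one vector and one generator fewer.\<close>
      define g where "g i = k i \<otimes> u" for i
      have g: "g i \<in> carrier R" if "i \<in> I" for i using k that u by (simp add: g_def)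
      define w where "w i = v i \<ominus>\<^bsub>S\<^esub> h (g i) \<otimes>\<^bsub>S\<^esub> v j" for i
      have wc: "w i \<in> carrier S" if "i \<in> I" for i using vc g j that by (simp add: w_def)
      have "\<exists>c\<in>?I \<rightarrow> carrier R. (\<exists>i\<in>?I. c i \<notin> M) \<and> (\<Oplus>\<^bsub>S\<^esub>i\<in>?I. h (c i) \<otimes>\<^bsub>S\<^esub> w i) \<in> Q"
      proof (rule insert.IH[OF B])
        show "finite ?I" using prems(2) by simp
        show "card B < card ?I" using prems(2,3) insert.hyps j by simp
        fix i assume "i \<in> ?I"
        then have i: "i \<in> I" by simp
        show "w i \<in> carrier S" using wc i .
        have gj: "h (g i) \<otimes>\<^bsub>S\<^esub> h (k j) = h (k i)"
        proof -
          have "g i \<otimes> k j = k i \<otimes> (k j \<otimes> u)" unfolding g_def using k i j u(1) by (simp add: R.m_ac)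
          then have "g i \<otimes> k j = k i" using u(2) k i by simp
          then show ?thesis using g[OF i] k[OF j(1)] hom_mult by metis
        qed
        have "(x \<ominus>\<^bsub>S\<^esub> z \<otimes>\<^bsub>S\<^esub> y) \<ominus>\<^bsub>S\<^esub> (p \<ominus>\<^bsub>S\<^esub> z \<otimes>\<^bsub>S\<^esub> q)
            = (x \<ominus>\<^bsub>S\<^esub> (z \<otimes>\<^bsub>S\<^esub> n \<otimes>\<^bsub>S\<^esub> b \<oplus>\<^bsub>S\<^esub> p)) \<ominus>\<^bsub>S\<^esub> z \<otimes>\<^bsub>S\<^esub> (y \<ominus>\<^bsub>S\<^esub> (n \<otimes>\<^bsub>S\<^esub> b \<oplus>\<^bsub>S\<^esub> q))"
          if [simp]: "x \<in> carrier S" "y \<in> carrier S" "z \<in> carrier S" "p \<in> carrier S" "q \<in> carrier S" "n \<in> carrier S"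
          for x y z p q n
          using bc[simp] by (simp add: S.ring_identity_simps)
        from this[OF vc[OF i] vc[OF j(1)] hom_closed[OF g[OF i]] tc[OF i] tc[OF j(1)] hom_closed[OF k[OF j(1)]]]
        have eq: "w i \<ominus>\<^bsub>S\<^esub> (t i \<ominus>\<^bsub>S\<^esub> h (g i) \<otimes>\<^bsub>S\<^esub> t j) = (v i \<ominus>\<^bsub>S\<^esub> (h (k i) \<otimes>\<^bsub>S\<^esub> b \<oplus>\<^bsub>S\<^esub> t i))
            \<ominus>\<^bsub>S\<^esub> h (g i) \<otimes>\<^bsub>S\<^esub> (v j \<ominus>\<^bsub>S\<^esub> (h (k j) \<otimes>\<^bsub>S\<^esub> b \<oplus>\<^bsub>S\<^esub> t j))"
          unfolding gj w_def .
        have "w i \<ominus>\<^bsub>S\<^esub> (t i \<ominus>\<^bsub>S\<^esub> h (g i) \<otimes>\<^bsub>S\<^esub> t j) \<in> Q"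
          unfolding eq S.minus_eq[of "v i \<ominus>\<^bsub>S\<^esub> (h (k i) \<otimes>\<^bsub>S\<^esub> b \<oplus>\<^bsub>S\<^esub> t i)"]
          by (rule Q.a_closed[OF q[OF i] Q.a_inv_closed[OF Q.I_l_closed[OF q[OF j(1)] hom_closed[OF g[OF i]]]]])
        moreover have "t i \<ominus>\<^bsub>S\<^esub> h (g i) \<otimes>\<^bsub>S\<^esub> t j \<in> hspan B"
          unfolding S.minus_eq
          by (rule hspan_plus[OF B t[OF i] hspan_uminus[OF B hspan_smult[OF B g[OF i] t[OF j(1)]]]])
        ultimately show "\<exists>s\<in>hspan B. w i \<ominus>\<^bsub>S\<^esub> s \<in> Q" by blast
      qed
      then obtain c where c: "c \<in> ?I \<rightarrow> carrier R" and cM: "\<exists>i\<in>?I. c i \<notin> M"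
        and cQ: "(\<Oplus>\<^bsub>S\<^esub>i\<in>?I. h (c i) \<otimes>\<^bsub>S\<^esub> w i) \<in> Q" by blast
      have cc: "c i \<in> carrier R" if "i \<in> ?I" for i by (rule PiE[OF c, of i]) (use that in auto)
      \<comment> \<open>The coefficient that \<open>v j\<close> acquires when the reduced vectors
        are expanded again.\<close>
      define e where "e = \<ominus> (\<Oplus>i\<in>?I. c i \<otimes> g i)"
      have sc: "(\<Oplus>i\<in>?I. c i \<otimes> g i) \<in> carrier R" using cc g by (intro R.finsum_closed) auto
      have ec: "e \<in> carrier R" using sc by (simp add: e_def)
      let ?c = "c(j := e)"
      have "(\<Oplus>\<^bsub>S\<^esub>i\<in>?I. h (c i) \<otimes>\<^bsub>S\<^esub> w i)
          = (\<Oplus>\<^bsub>S\<^esub>i\<in>?I. h (c i) \<otimes>\<^bsub>S\<^esub> v i \<ominus>\<^bsub>S\<^esub> h (c i \<otimes> g i) \<otimes>\<^bsub>S\<^esub> v j)"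
        using cc g vc j by (intro S.finsum_cong') (auto simp: w_def S.minus_eq S.r_distr S.r_minus S.m_assoc)
      also have "\<dots> = (\<Oplus>\<^bsub>S\<^esub>i\<in>?I. h (c i) \<otimes>\<^bsub>S\<^esub> v i) \<ominus>\<^bsub>S\<^esub> (\<Oplus>\<^bsub>S\<^esub>i\<in>?I. h (c i \<otimes> g i) \<otimes>\<^bsub>S\<^esub> v j)"
        using cc g vc j prems(2) by (intro S.finsum_minus[symmetric]) auto
      also have "(\<Oplus>\<^bsub>S\<^esub>i\<in>?I. h (c i \<otimes> g i) \<otimes>\<^bsub>S\<^esub> v j) = (\<Oplus>\<^bsub>S\<^esub>i\<in>?I. h (c i \<otimes> g i)) \<otimes>\<^bsub>S\<^esub> v j"
        using cc g vc j prems(2) by (intro S.finsum_ldistr[symmetric]) auto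
      also have "(\<Oplus>\<^bsub>S\<^esub>i\<in>?I. h (c i \<otimes> g i)) = h (\<Oplus>i\<in>?I. c i \<otimes> g i)"
        using cc g by (subst hom_finsum) (auto simp: o_def)
      finally have 1: "(\<Oplus>\<^bsub>S\<^esub>i\<in>?I. h (c i) \<otimes>\<^bsub>S\<^esub> w i)
          = (\<Oplus>\<^bsub>S\<^esub>i\<in>?I. h (c i) \<otimes>\<^bsub>S\<^esub> v i) \<ominus>\<^bsub>S\<^esub> h (\<Oplus>i\<in>?I. c i \<otimes> g i) \<otimes>\<^bsub>S\<^esub> v j" .
      have vsum: "(\<Oplus>\<^bsub>S\<^esub>i\<in>?I. h (c i) \<otimes>\<^bsub>S\<^esub> v i) \<in> carrier S"
        using cc vc by (intro S.finsum_closed) auto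
      have "(\<Oplus>\<^bsub>S\<^esub>i\<in>I. h (?c i) \<otimes>\<^bsub>S\<^esub> v i) = (\<Oplus>\<^bsub>S\<^esub>i\<in>insert j ?I. h (?c i) \<otimes>\<^bsub>S\<^esub> v i)"
        using j by (simp add: insert_absorb)
      also have "\<dots> = h (?c j) \<otimes>\<^bsub>S\<^esub> v j \<oplus>\<^bsub>S\<^esub> (\<Oplus>\<^bsub>S\<^esub>i\<in>?I. h (?c i) \<otimes>\<^bsub>S\<^esub> v i)"
        using cc vc ec j prems(2) by (intro S.finsum_insert) auto
      also have "(\<Oplus>\<^bsub>S\<^esub>i\<in>?I. h (?c i) \<otimes>\<^bsub>S\<^esub> v i) = (\<Oplus>\<^bsub>S\<^esub>i\<in>?I. h (c i) \<otimes>\<^bsub>S\<^esub> v i)"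
        using cc vc by (intro S.finsum_cong') auto
      also have "h (?c j) \<otimes>\<^bsub>S\<^esub> v j \<oplus>\<^bsub>S\<^esub> (\<Oplus>\<^bsub>S\<^esub>i\<in>?I. h (c i) \<otimes>\<^bsub>S\<^esub> v i) = (\<Oplus>\<^bsub>S\<^esub>i\<in>?I. h (c i) \<otimes>\<^bsub>S\<^esub> w i)"
        unfolding 1 using sc vc[OF j(1)] vsum by (simp add: e_def S.l_minus S.minus_eq S.a_comm)
      finally have "(\<Oplus>\<^bsub>S\<^esub>i\<in>I. h (?c i) \<otimes>\<^bsub>S\<^esub> v i) \<in> Q" using cQ by simp
      moreover have "?c \<in> I \<rightarrow> carrier R" using cc ec by auto
      moreover have "\<exists>i\<in>I. ?c i \<notin> M" using cM by auto
      ultimately show ?thesis by blast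
    qed
  qed
qed

text \<open>The ideal generated by finitely many elements, given as a list because generators may
  coincide and because their indices are matched with indeterminates.\<close>

definition (in ring) lincomb :: "nat \<Rightarrow> (nat \<Rightarrow> 'a) \<Rightarrow> 'a set" where
  "lincomb n x = {\<Oplus>i\<in>{..<n}. x i \<otimes> a i |a. a \<in> {..<n} \<rightarrow> carrier R}"

lemma (in cring) lincomb_closed: "\<lbrakk>x \<in> {..<n} \<rightarrow> carrier R; y \<in> lincomb n x\<rbrakk> \<Longrightarrow> y \<in> carrier R"
  by (auto simp: lincomb_def intro!: finsum_closed)

lemma (in cring) lincomb_0: "lincomb 0 x = {\<zero>}"
  by (auto simp: lincomb_def)

lemma (in cring) lincomb_Suc:
  assumes "x \<in> {..<Suc n} \<rightarrow> carrier R" "y \<in> lincomb (Suc n) x"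
  shows "\<exists>a\<in>carrier R. \<exists>z\<in>lincomb n x. y = x n \<otimes> a \<oplus> z"
proof -
  obtain a where a: "a \<in> {..<Suc n} \<rightarrow> carrier R" and y: "y = (\<Oplus>i\<in>{..<Suc n}. x i \<otimes> a i)"
    using assms(2) by (auto simp: lincomb_def)
  have "y = x n \<otimes> a n \<oplus> (\<Oplus>i\<in>{..<n}. x i \<otimes> a i)"
    unfolding y lessThan_Suc using a assms(1) by (intro finsum_insert) (auto simp: Pi_def)
  moreover have "a n \<in> carrier R" "a \<in> {..<n} \<rightarrow> carrier R" using a by auto
  ultimately show ?thesis unfolding lincomb_def by blast
qed

lemma (in cring) lincomb_ideal:
  assumes x: "x \<in> {..<n} \<rightarrow> carrier R"
  shows "ideal (lincomb n x) R"
proof -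
  have xc: "x i \<in> carrier R" if "i < n" for i using x that by auto
  have smult: "r \<otimes> y \<in> lincomb n x" if r: "r \<in> carrier R" and y: "y \<in> lincomb n x" for r y
  proof -
    obtain a where a: "a \<in> {..<n} \<rightarrow> carrier R" and y: "y = (\<Oplus>i\<in>{..<n}. x i \<otimes> a i)"
      using y by (auto simp: lincomb_def)
    have ac: "a i \<in> carrier R" if "i < n" for i using a that by auto
    have "r \<otimes> y = (\<Oplus>i\<in>{..<n}. r \<otimes> (x i \<otimes> a i))"
      unfolding y using r ac xc by (intro finsum_rdistr) auto
    also have "\<dots> = (\<Oplus>i\<in>{..<n}. x i \<otimes> (r \<otimes> a i))"
      using r ac xc by (intro finsum_cong') (auto simp: m_lcomm)
    finally show ?thesis using r ac by (auto simp: lincomb_def)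
  qed
  show ?thesis
  proof (rule idealI[OF ring_axioms])
    show "subgroup (lincomb n x) (add_monoid R)"
    proof (rule add.subgroupI)
      show "lincomb n x \<subseteq> carrier R" using lincomb_closed[OF x] by blast
      show "lincomb n x \<noteq> {}" by (auto simp: lincomb_def)
      fix y assume y: "y \<in> lincomb n x"
      have "\<ominus> y = \<ominus> \<one> \<otimes> y" using lincomb_closed[OF x y] by (simp add: l_minus)
      then show "\<ominus> y \<in> lincomb n x" using smult[OF _ y, of "\<ominus> \<one>"] by simp
      fix z assume z: "z \<in> lincomb n x"
      obtain a where a: "a \<in> {..<n} \<rightarrow> carrier R" and y: "y = (\<Oplus>i\<in>{..<n}. x i \<otimes> a i)"
        using y by (auto simp: lincomb_def)
      obtain b where b: "b \<in> {..<n} \<rightarrow> carrier R" and z: "z = (\<Oplus>i\<in>{..<n}. x i \<otimes> b i)"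
        using z by (auto simp: lincomb_def)
      have ac: "a i \<in> carrier R" "b i \<in> carrier R" if "i < n" for i using a b that by auto
      have "y \<oplus> z = (\<Oplus>i\<in>{..<n}. x i \<otimes> a i \<oplus> x i \<otimes> b i)"
        unfolding y z using ac xc by (intro finsum_addf[symmetric]) auto
      also have "\<dots> = (\<Oplus>i\<in>{..<n}. x i \<otimes> (a i \<oplus> b i))"
        using ac xc by (intro finsum_cong') (auto simp: r_distr)
      finally show "y \<oplus> z \<in> lincomb n x" using ac by (auto simp: lincomb_def)
    qed
    fix y r assume y: "y \<in> lincomb n x" and r: "r \<in> carrier R"
    show "r \<otimes> y \<in> lincomb n x" by (rule smult[OF r y])
    then show "y \<otimes> r \<in> lincomb n x" using m_comm[OF r lincomb_closed[OF x y]] by simp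
  qed
qed

lemma (in cring) lincomb_base:
  assumes x: "x \<in> {..<n} \<rightarrow> carrier R" and i: "i < n"
  shows "x i \<in> lincomb n x"
proof -
  have xc: "x i \<in> carrier R" if "i < n" for i using x that by auto
  have "(\<Oplus>j\<in>{..<n}. x j \<otimes> (if i = j then \<one> else \<zero>)) = (\<Oplus>j\<in>{..<n}. if i = j then x j else \<zero>)"
    using xc by (intro finsum_cong') auto
  also have "\<dots> = x i" using i xc by (intro add.finprod_singleton) auto
  finally have "x i = (\<Oplus>j\<in>{..<n}. x j \<otimes> (if i = j then \<one> else \<zero>))" ..
  then show ?thesis unfolding lincomb_def by (intro CollectI exI[of _ "\<lambda>j. if i = j then \<one> else \<zero>"]) auto
qed

lemma (in cring) lincomb_subset:
  assumes "ideal J R" "\<And>i. i < n \<Longrightarrow> x i \<in> J"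
  shows "lincomb n x \<subseteq> J"
proof
  interpret J: ideal J R by fact
  fix y assume "y \<in> lincomb n x"
  then obtain a where a: "a \<in> {..<n} \<rightarrow> carrier R" and y: "y = (\<Oplus>i\<in>{..<n}. x i \<otimes> a i)"
    by (auto simp: lincomb_def)
  show "y \<in> J" unfolding y
  proof (rule J.finsum_mem[OF ring_axioms])
    fix i assume "i \<in> {..<n}"
    then show "x i \<otimes> a i \<in> J" using a assms(2) by (intro J.I_r_closed) auto
  qed
qed

lemma (in cring) finitely_generated_ideal:
  assumes "noetherian_ring R" "ideal J R"
  shows "\<exists>n x. x \<in> {..<n} \<rightarrow> carrier R \<and> J = lincomb n x"
proof -
  interpret noetherian_ring R by fact
  obtain C where C: "C \<subseteq> carrier R" "finite C" "J = Idl C" using finetely_gen[OF assms(2)] by blast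
  obtain n x where nx: "C = x ` {i::nat. i < n}" using C(2) unfolding finite_conv_nat_seg_image by blast
  have x: "x \<in> {..<n} \<rightarrow> carrier R" using C(1) nx by auto
  have "Idl C \<subseteq> lincomb n x"
    by (rule genideal_minimal[OF lincomb_ideal[OF x]]) (use lincomb_base[OF x] nx in auto)
  moreover have "lincomb n x \<subseteq> Idl C"
    by (rule lincomb_subset[OF genideal_ideal[OF C(1)]]) (use genideal_self[OF C(1)] nx in auto)
  ultimately show ?thesis using C(3) x by blast
qed

text \<open>Substituting the decomposition into its own cofactor k - 1 times replaces z by z^k and
  adds the generators z B, ..., z^(k-1) B. At k = e the remaining multiple of z^e is absorbed by
  Q.\<close>

lemma (in ring_hom_cring) hspan_reduce:
  assumes Q: "ideal Q S" and z: "z \<in> carrier S" "z [^]\<^bsub>S\<^esub> (e::nat) \<in> Q"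
    and B: "finite B" "B \<subseteq> carrier S"
    and gen: "\<And>f. f \<in> carrier S \<Longrightarrow> \<exists>s\<in>hspan B. \<exists>g\<in>carrier S. \<exists>q\<in>Q. f = s \<oplus>\<^bsub>S\<^esub> z \<otimes>\<^bsub>S\<^esub> g \<oplus>\<^bsub>S\<^esub> q"
  shows "\<exists>B'. finite B' \<and> B' \<subseteq> carrier S \<and> (\<forall>f\<in>carrier S. \<exists>s\<in>hspan B'. \<exists>q\<in>Q. f = s \<oplus>\<^bsub>S\<^esub> q)"
proof -
  interpret Q: ideal Q S by fact
  have "\<exists>B'. finite B' \<and> B' \<subseteq> carrier S \<and>
      (\<forall>f\<in>carrier S. \<exists>s\<in>hspan B'. \<exists>g\<in>carrier S. \<exists>q\<in>Q. f = s \<oplus>\<^bsub>S\<^esub> z [^]\<^bsub>S\<^esub> k \<otimes>\<^bsub>S\<^esub> g \<oplus>\<^bsub>S\<^esub> q)" for k :: nat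
  proof (induction k)
    case 0
    have "\<exists>s\<in>hspan {}. \<exists>g\<in>carrier S. \<exists>q\<in>Q. f = s \<oplus>\<^bsub>S\<^esub> z [^]\<^bsub>S\<^esub> (0::nat) \<otimes>\<^bsub>S\<^esub> g \<oplus>\<^bsub>S\<^esub> q"
      if f: "f \<in> carrier S" for f
      using f Q.zero_closed
      by (intro bexI[of _ "\<zero>\<^bsub>S\<^esub>"] bexI[of _ f]) (auto simp: hom_span.zero)
    then show ?case by (intro exI[of _ "{}"]) auto
  next
    case (Suc k)
    then obtain B' where IH: "finite B' \<and> B' \<subseteq> carrier S \<and> (\<forall>f\<in>carrier S.
        \<exists>s\<in>hspan B'. \<exists>g\<in>carrier S. \<exists>q\<in>Q. f = s \<oplus>\<^bsub>S\<^esub> z [^]\<^bsub>S\<^esub> k \<otimes>\<^bsub>S\<^esub> g \<oplus>\<^bsub>S\<^esub> q)" ..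
    then have B': "finite B'" "B' \<subseteq> carrier S" by simp_all
    note dec = IH[THEN conjunct2, THEN conjunct2, THEN bspec]
    let ?z = "z [^]\<^bsub>S\<^esub> k"
    have zk: "?z \<in> carrier S" using z by simp
    let ?C = "B' \<union> (\<lambda>b. ?z \<otimes>\<^bsub>S\<^esub> b) ` B"
    have C: "finite ?C" "?C \<subseteq> carrier S" using B B' zk by auto
    have "\<exists>s\<in>hspan ?C. \<exists>g\<in>carrier S. \<exists>q\<in>Q. f = s \<oplus>\<^bsub>S\<^esub> z [^]\<^bsub>S\<^esub> Suc k \<otimes>\<^bsub>S\<^esub> g \<oplus>\<^bsub>S\<^esub> q"
      if f: "f \<in> carrier S" for f
    proof -
      obtain s g q where s: "s \<in> hspan B'" and g: "g \<in> carrier S" and q: "q \<in> Q"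
        and f_eq: "f = s \<oplus>\<^bsub>S\<^esub> ?z \<otimes>\<^bsub>S\<^esub> g \<oplus>\<^bsub>S\<^esub> q" using dec[OF f] by blast
      obtain s' g' q' where s': "s' \<in> hspan B" and g': "g' \<in> carrier S" and q': "q' \<in> Q"
        and g_eq: "g = s' \<oplus>\<^bsub>S\<^esub> z \<otimes>\<^bsub>S\<^esub> g' \<oplus>\<^bsub>S\<^esub> q'" using gen[OF g] by blast
      note c = hspan_closed[OF B'(2) s] hspan_closed[OF B(2) s'] g' Q.Icarr[OF q] Q.Icarr[OF q'] zk z(1)
      have "a \<oplus>\<^bsub>S\<^esub> x \<otimes>\<^bsub>S\<^esub> (a' \<oplus>\<^bsub>S\<^esub> y \<otimes>\<^bsub>S\<^esub> b \<oplus>\<^bsub>S\<^esub> p') \<oplus>\<^bsub>S\<^esub> p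
          = (a \<oplus>\<^bsub>S\<^esub> x \<otimes>\<^bsub>S\<^esub> a') \<oplus>\<^bsub>S\<^esub> x \<otimes>\<^bsub>S\<^esub> y \<otimes>\<^bsub>S\<^esub> b \<oplus>\<^bsub>S\<^esub> (x \<otimes>\<^bsub>S\<^esub> p' \<oplus>\<^bsub>S\<^esub> p)"
        if [simp]: "a \<in> carrier S" "a' \<in> carrier S" "b \<in> carrier S" "p \<in> carrier S" "p' \<in> carrier S"
          "x \<in> carrier S" "y \<in> carrier S" for a a' b p p' x y
        by (simp add: S.ring_identity_simps)
      from this[OF c] have "f = (s \<oplus>\<^bsub>S\<^esub> ?z \<otimes>\<^bsub>S\<^esub> s') \<oplus>\<^bsub>S\<^esub> z [^]\<^bsub>S\<^esub> Suc k \<otimes>\<^bsub>S\<^esub> g' \<oplus>\<^bsub>S\<^esub> (?z \<otimes>\<^bsub>S\<^esub> q' \<oplus>\<^bsub>S\<^esub> q)"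
        unfolding f_eq g_eq by simp
      moreover have "s \<oplus>\<^bsub>S\<^esub> ?z \<otimes>\<^bsub>S\<^esub> s' \<in> hspan ?C"
        using hspan_mono[OF C(2) _ s] hspan_mono[OF C(2) _ hspan_mult[OF B(2) zk s']]
        by (intro hspan_plus[OF C(2)]) auto
      moreover have "?z \<otimes>\<^bsub>S\<^esub> q' \<oplus>\<^bsub>S\<^esub> q \<in> Q" using q q' zk by (intro Q.a_closed Q.I_l_closed)
      ultimately show ?thesis using g' by blast
    qed
    then show ?case using C by (intro exI[of _ ?C]) simp
  qed
  then obtain B' where B'e: "finite B' \<and> B' \<subseteq> carrier S \<and> (\<forall>f\<in>carrier S.
      \<exists>s\<in>hspan B'. \<exists>g\<in>carrier S. \<exists>q\<in>Q. f = s \<oplus>\<^bsub>S\<^esub> z [^]\<^bsub>S\<^esub> e \<otimes>\<^bsub>S\<^esub> g \<oplus>\<^bsub>S\<^esub> q)" ..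
  then have B': "finite B'" "B' \<subseteq> carrier S" by simp_all
  note dec = B'e[THEN conjunct2, THEN conjunct2, THEN bspec]
  have "\<exists>s\<in>hspan B'. \<exists>q\<in>Q. f = s \<oplus>\<^bsub>S\<^esub> q" if f: "f \<in> carrier S" for f
  proof -
    obtain s g q where s: "s \<in> hspan B'" and g: "g \<in> carrier S" and q: "q \<in> Q"
      and f_eq: "f = s \<oplus>\<^bsub>S\<^esub> z [^]\<^bsub>S\<^esub> e \<otimes>\<^bsub>S\<^esub> g \<oplus>\<^bsub>S\<^esub> q" using dec[OF f] by blast
    have "f = s \<oplus>\<^bsub>S\<^esub> (z [^]\<^bsub>S\<^esub> e \<otimes>\<^bsub>S\<^esub> g \<oplus>\<^bsub>S\<^esub> q)"
      unfolding f_eq using hspan_closed[OF B'(2) s] g Q.Icarr[OF q] z(1) by (simp add: S.a_assoc)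
    moreover have "z [^]\<^bsub>S\<^esub> e \<otimes>\<^bsub>S\<^esub> g \<oplus>\<^bsub>S\<^esub> q \<in> Q" using q z(2) g by (intro Q.a_closed Q.I_r_closed)
    ultimately show ?thesis using s by blast
  qed
  then show ?thesis using B' by (intro exI[of _ B']) simp
qed

section \<open>Adic filtrations, coefficient fields and finite self maps of complete local
  rings\<close>

lemma (in cring) adic_filtration:
  assumes I: "ideal I R" and complete: "adic_complete R I"
  shows "complete_filtered_ring R (\<lambda>n. I [^]\<^bsub>ideals_set R\<^esub> (n::nat))"
proof -
  interpret M: comm_monoid "ideals_set R" by (rule ideals_set_is_comm_monoid)
  define G where "G n = I [^]\<^bsub>ideals_set R\<^esub> n" for n :: nat
  have IM: "I \<in> carrier (ideals_set R)" using I by (simp add: ideals_set_def)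
  have ideal: "ideal (G n) R" for n
    using M.nat_pow_closed[OF IM, of n] by (simp add: ideals_set_def G_def)
  have G0: "G 0 = carrier R" by (simp add: G_def) (simp add: ideals_set_def)
  have prod: "ideal_prod R (G i) (G j) = G (i + j)" for i j
    using M.nat_pow_mult[OF IM, of i j] by (simp add: G_def ideals_set_def)
  have GSuc: "G (Suc n) \<subseteq> G n" for n
    using ideal_prod_inter[OF ideal[of n] ideal[of 1]] prod[of n 1] by simp
  have mono: "G n \<subseteq> G m" if "m \<le> n" for m n using lift_Suc_antimono_le[of G] GSuc that by blast
  show ?thesis unfolding G_def[symmetric]
  proof (rule complete_filtered_ring.intro[OF is_cring], rule complete_filtered_ring_axioms.intro)
    show "\<And>n. ideal (G n) R" "G 0 = carrier R" "\<And>n. G (Suc n) \<subseteq> G n" by fact+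
    show "x \<otimes> y \<in> G (i + j)" if "x \<in> G i" "y \<in> G j" for x y i j
      unfolding prod[symmetric] by (rule ideal_prod.prod[OF that])
    show "(\<Inter>n. G n) \<subseteq> {\<zero>}"
      using complete unfolding adic_complete_def adic_separated_def G_def by blast
    fix s :: "nat \<Rightarrow> 'a" assume sc: "\<And>k. s k \<in> carrier R" and s: "\<And>k. s (Suc k) \<ominus> s k \<in> G k"
    have add: "x \<oplus> y \<in> G n" if "x \<in> G n" "y \<in> G n" for x y n
      by (rule additive_subgroup.a_closed[OF ideal.axioms(1)[OF ideal] that])
    have neg: "\<ominus> x \<in> G n" if "x \<in> G n" for x n
      by (rule additive_subgroup.a_inv_closed[OF ideal.axioms(1)[OF ideal] that])
    have tele: "(a \<ominus> b) \<oplus> (b \<ominus> c) = a \<ominus> c" "\<ominus> (a \<ominus> b) = b \<ominus> a"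
      if [simp]: "a \<in> carrier R" "b \<in> carrier R" "c \<in> carrier R" for a b c
      by (simp_all add: ring_identity_simps)
    have cauchy: "s k \<ominus> s j \<in> G j" if "j \<le> k" for j k
      using that
    proof (induction k rule: dec_induct)
      case base
      show ?case using sc[of j] additive_subgroup.zero_closed[OF ideal.axioms(1)[OF ideal[of j]]]
        by (simp add: minus_eq r_neg)
    next
      case (step k)
      have "(s (Suc k) \<ominus> s k) \<oplus> (s k \<ominus> s j) \<in> G j"
        using s[of k] mono[OF step.hyps(1)] step.IH by (intro add) auto
      then show ?case unfolding tele[OF sc sc sc] .
    qed
    have "adic_cauchy R I s"
      unfolding adic_cauchy_def G_def[symmetric]
    proof (intro allI exI impI)
      fix n i j :: nat assume i: "n \<le> i" and j: "n \<le> j"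
      have "(s i \<ominus> s n) \<oplus> \<ominus> (s j \<ominus> s n) \<in> G n" by (intro add neg cauchy i j)
      then show "s i \<ominus> s j \<in> G n" unfolding tele(2)[OF sc sc sc] tele(1)[OF sc sc sc] .
    qed
    moreover have "range s \<subseteq> carrier R" using sc by blast
    ultimately obtain x where x: "x \<in> carrier R" "adic_limit R I s x"
      using complete unfolding adic_complete_def by blast
    have "x \<ominus> s k \<in> G k" for k
    proof -
      obtain M where M: "\<And>i. M \<le> i \<Longrightarrow> s i \<ominus> x \<in> G k"
        using x(2) unfolding adic_limit_def G_def by blast
      \<comment> \<open>The limit given by \<open>adic_limit\<close> comes without a rate. Comparing
        at an index beyond both M and k restores it, since from index k on the sequence stays within
        \<open>G k\<close> of \<open>s k\<close>.\<close>
      have "\<ominus> (s (max M k) \<ominus> x) \<oplus> (s (max M k) \<ominus> s k) \<in> G k"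
        by (rule add[OF neg[OF M] cauchy]) auto
      then show ?thesis unfolding tele(2)[OF sc x(1) x(1)] tele(1)[OF x(1) sc sc] .
    qed
    then show "\<exists>x\<in>carrier R. \<forall>k. x \<ominus> s k \<in> G k" using x(1) by blast
  qed
qed

text \<open>The least positive q with q times 1 zero is prime: the factors of q give elements of K
  with product zero, and K has no zero divisors.\<close>

lemma (in ring) subfield_char:
  assumes K: "subfield K R"
  shows "(\<forall>n::nat. 0 < n \<longrightarrow> [n] \<cdot> \<one> \<noteq> \<zero>) \<or> (\<exists>q::nat. Factorial_Ring.prime q \<and> [q] \<cdot> \<one> = \<zero>)"
proof (cases "\<exists>n::nat. 0 < n \<and> [n] \<cdot> \<one> = \<zero>")
  case True
  define q where "q = (LEAST n::nat. 0 < n \<and> [n] \<cdot> \<one> = \<zero>)"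
  have q: "0 < q" "[q] \<cdot> \<one> = \<zero>" using LeastI_ex[OF True] unfolding q_def by auto
  have least: "q \<le> n" if "0 < n" "[n] \<cdot> \<one> = \<zero>" for n :: nat
    unfolding q_def using that by (intro Least_le) simp
  have K_mem: "[n] \<cdot> \<one> \<in> K" for n :: nat
    by (induction n) (use subringE(2,3,7)[OF subfieldE(1)[OF K]] in auto)
  have "q \<noteq> 1" using q subfieldE(6)[OF K] by auto
  have "m = 1 \<or> m = q" if dvd: "m dvd q" for m
  proof -
    obtain k where k: "q = m * k" using dvd by (rule dvdE)
    then have pos: "0 < m" "0 < k" using q(1) by auto
    have "[m] \<cdot> \<one> \<otimes> [k] \<cdot> \<one> = [m] \<cdot> ([k] \<cdot> \<one>)" by (simp add: add_pow_ldistr)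
    also have "\<dots> = [(k * m)] \<cdot> \<one>" by (rule add.nat_pow_pow) simp
    finally have "[m] \<cdot> \<one> \<otimes> [k] \<cdot> \<one> = \<zero>" using q(2) k by (simp add: mult.commute)
    then have "[m] \<cdot> \<one> = \<zero> \<or> [k] \<cdot> \<one> = \<zero>" using subfieldE(5)[OF K K_mem K_mem] by blast
    then have "q \<le> m \<or> q \<le> k" using least pos by blast
    moreover have "m \<le> q" "k \<le> q" using k pos by auto
    ultimately show ?thesis using k pos by auto
  qed
  then have "Factorial_Ring.prime q" unfolding prime_nat_iff using q(1) \<open>q \<noteq> 1\<close> by auto
  then show ?thesis using q by blast
next
  case False
  then show ?thesis by blast
qed

text \<open>A complete local ring with maximal ideal \<open>G 1\<close> and coefficient field K, in
  the form A = K + \<open>G 1\<close>. The sum is direct because nonzero elements of K are units and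
  \<open>G 1\<close> is proper.\<close>

locale complete_ring_over_field = complete_filtered_ring A G
  for A :: "('a, 'b) ring_scheme" (structure) and G :: "nat \<Rightarrow> 'a set" +
  fixes K :: "'a set"
  assumes K: "subfield K A"
    and residue: "a \<in> carrier A \<Longrightarrow> \<exists>k\<in>K. \<exists>x\<in>G 1. a = k \<oplus> x"
    and one: "\<one> \<notin> G 1"
begin

lemma K_carrier: "k \<in> K \<Longrightarrow> k \<in> carrier A"
  using subfieldE(3)[OF K] by blast

lemma K_inverse: "\<lbrakk>k \<in> K; k \<noteq> \<zero>\<rbrakk> \<Longrightarrow> \<exists>u\<in>K. k \<otimes> u = \<one>"
  using subfield_m_inv[OF K, of k] by blast

lemma K_G: "\<lbrakk>k \<in> K; k \<in> G 1\<rbrakk> \<Longrightarrow> k = \<zero>"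
  using K_inverse[of k] G_rmult[of _ k 1] K_carrier one by metis

text \<open>Such an element is k + x = k (1 + x/k) with k nonzero in K, and the second factor is
  inverted by the geometric series.\<close>

lemma unit_outside_G:
  assumes a: "a \<in> carrier A" "a \<notin> G 1"
  shows "\<exists>u\<in>carrier A. a \<otimes> u = \<one>"
proof -
  obtain k x where k: "k \<in> K" and x: "x \<in> G 1" and a_eq: "a = k \<oplus> x" using residue[OF a(1)] by blast
  have xc: "x \<in> carrier A" by (rule G_carrier[OF x])
  have "k \<noteq> \<zero>" using a(2) x xc unfolding a_eq by auto
  then obtain u where u: "u \<in> K" "k \<otimes> u = \<one>" using K_inverse k by blast
  have kc: "k \<in> carrier A" "u \<in> carrier A" using k u K_carrier by auto
  have "u \<otimes> x \<in> G 1" using G_lmult kc x by blast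
  then obtain v where v: "v \<in> carrier A" "(\<one> \<oplus> u \<otimes> x) \<otimes> v = \<one>" using one_plus_G_Units by blast
  have "a \<otimes> u = \<one> \<oplus> u \<otimes> x" unfolding a_eq using kc xc u(2) by (simp add: l_distr m_comm[of x u])
  then have "a \<otimes> (u \<otimes> v) = \<one>" using v kc a(1) by (simp add: m_assoc[symmetric])
  then show ?thesis using kc v by blast
qed

lemma one_minus_unit:
  assumes "x \<in> G 1" "c \<in> carrier A"
  shows "\<exists>u\<in>carrier A. (\<one> \<ominus> x \<otimes> c) \<otimes> u = \<one>"
proof -
  have "\<ominus> (x \<otimes> c) \<in> G 1" using assms G_rmult G_uminus by blast
  then show ?thesis using one_plus_G_Units unfolding minus_eq by blast
qed

text \<open>If \<phi>(x) were a unit, multiplication by x would be surjective on A viewed as a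
  finitely generated module through \<phi>. As x lies in the maximal ideal, Nakayama's lemma would
  make A the zero ring.\<close>

lemma finite_hom_local:
  assumes \<phi>: "\<phi> \<in> ring_hom A A" and B: "finite B" "B \<subseteq> carrier A" "carrier A \<subseteq> hom_span A A \<phi> B"
    and x: "x \<in> G 1"
  shows "\<phi> x \<in> G 1"
proof (rule ccontr)
  interpret \<phi>: ring_hom_cring A A \<phi> by unfold_locales fact
  assume "\<phi> x \<notin> G 1"
  then obtain v where "v \<in> carrier A" "\<phi> x \<otimes> v = \<one>" using unit_outside_G[OF \<phi>.hom_closed[OF G_carrier[OF x]]] by blast
  then have "\<one> = \<zero>"
    using \<phi>.nakayama_hom[OF G_carrier[OF x] one_minus_unit[OF x] _ _ B] by blast
  then show False using one G_zero[of 1] by simp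
qed

lemma nilpotent_of_relation:
  fixes c :: "nat \<Rightarrow> 'a" and d e :: nat
  assumes \<phi>: "\<phi> \<in> ring_hom A A" and \<phi>_local: "\<And>a. a \<in> G 1 \<Longrightarrow> \<phi> a \<in> G 1"
    and Q: "ideal Q A" and \<phi>_Q: "\<And>a. a \<in> G 1 \<Longrightarrow> \<phi> a \<in> Q" and x: "x \<in> G 1"
  shows "\<lbrakk>\<And>i. c i \<in> carrier A; i \<le> d; c i \<notin> G 1;
      x [^] (e::nat) \<otimes> (\<Oplus>i\<in>{..d}. \<phi> (c i) \<otimes> x [^] i) \<in> Q\<rbrakk> \<Longrightarrow> \<exists>e::nat. x [^] e \<in> Q"
proof (induction d arbitrary: c e i)
  interpret \<phi>: ring_hom_cring A A \<phi> by unfold_locales fact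
  interpret Q: ideal Q A by fact
  have xc: "x \<in> carrier A" by (rule G_carrier[OF x])
  have unit: "x [^] e \<in> Q" if s: "s \<in> carrier A" "s \<notin> G 1" "x [^] e \<otimes> s \<in> Q" for s and e :: nat
  proof -
    obtain u where u: "u \<in> carrier A" "s \<otimes> u = \<one>" using unit_outside_G s by blast
    have "x [^] e \<otimes> s \<otimes> u \<in> Q" using Q.I_r_closed s(3) u(1) by blast
    then show ?thesis using u s(1) xc by (simp add: m_assoc)
  qed
  have \<phi>_unit: "\<phi> a \<notin> G 1" if a: "a \<in> carrier A" "a \<notin> G 1" for a
  proof
    assume "\<phi> a \<in> G 1"
    obtain u where u: "u \<in> carrier A" "a \<otimes> u = \<one>" using unit_outside_G a by blast
    have "\<phi> a \<otimes> \<phi> u = \<one>" using u a(1) \<phi>.hom_mult[of a u] by simp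
    then show False using G_rmult[OF \<phi>.hom_closed[OF u(1)] \<open>\<phi> a \<in> G 1\<close>] one by simp
  qed
  {
    case 0
    then show ?case using unit[of "\<phi> (c 0)" e] \<phi>_unit[of "c 0"] by auto
  next
    case (Suc d)
    let ?S = "\<Oplus>i\<in>{..d}. \<phi> (c (Suc i)) \<otimes> x [^] i"
    have Sc: "?S \<in> carrier A" using Suc.prems(1) xc by (intro finsum_closed) auto
    have "(\<Oplus>i\<in>{..Suc d}. \<phi> (c i) \<otimes> x [^] i)
        = (\<Oplus>i\<in>{..d}. \<phi> (c (Suc i)) \<otimes> x [^] Suc i) \<oplus> \<phi> (c 0) \<otimes> x [^] (0::nat)"
      using Suc.prems(1) xc by (intro finsum_Suc2) auto
    also have "(\<Oplus>i\<in>{..d}. \<phi> (c (Suc i)) \<otimes> x [^] Suc i) = ?S \<otimes> x"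
      using Suc.prems(1) xc by (subst finsum_ldistr) (auto simp: m_assoc intro!: finsum_cong')
    finally have eq: "(\<Oplus>i\<in>{..Suc d}. \<phi> (c i) \<otimes> x [^] i) = ?S \<otimes> x \<oplus> \<phi> (c 0)"
      using Suc.prems(1) by simp
    show ?case
    proof (cases "c 0 \<in> G 1")
      case False
      have SxG: "?S \<otimes> x \<in> G 1" using G_lmult Sc x by blast
      have "?S \<otimes> x \<oplus> \<phi> (c 0) \<notin> G 1"
      proof
        assume "?S \<otimes> x \<oplus> \<phi> (c 0) \<in> G 1"
        then have "\<ominus> (?S \<otimes> x) \<oplus> (?S \<otimes> x \<oplus> \<phi> (c 0)) \<in> G 1" using G_add G_uminus SxG by blast
        then have "\<phi> (c 0) \<in> G 1" using Sc xc Suc.prems(1)[of 0] by (simp add: r_neg1)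
        then show False using \<phi>_unit False Suc.prems(1) by blast
      qed
      then show ?thesis using unit[of "?S \<otimes> x \<oplus> \<phi> (c 0)" e] Suc.prems(1,4) Sc xc unfolding eq by auto
    next
      case True
      have "x [^] e \<otimes> (?S \<otimes> x \<oplus> \<phi> (c 0)) \<oplus> \<ominus> (x [^] e \<otimes> \<phi> (c 0)) \<in> Q"
        using Q.a_closed[OF Suc.prems(4)[unfolded eq] Q.a_inv_closed[OF Q.I_l_closed[OF \<phi>_Q[OF True]]]] xc
        by simp
      moreover have "x [^] e \<otimes> (?S \<otimes> x \<oplus> \<phi> (c 0)) \<oplus> \<ominus> (x [^] e \<otimes> \<phi> (c 0)) = x [^] Suc e \<otimes> ?S"
        using Sc xc Suc.prems(1)[of 0] by (simp add: r_distr a_assoc r_neg m_ac)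
      ultimately have "x [^] Suc e \<otimes> ?S \<in> Q" by simp
      moreover obtain j where "i = Suc j" using True Suc.prems(3) by (cases i) auto
      ultimately show ?thesis
        using Suc.IH[of "\<lambda>i. c (Suc i)" j "Suc e"] Suc.prems(1,2,3) by simp
    qed
  }
qed

text \<open>Through \<phi>, the quotient A/Q is a vector space over the residue field of A, spanned
  by the classes of B. Hence the powers of x up to exponent \<open>card B\<close>, one more than
  there are generators, satisfy a nontrivial relation.\<close>

lemma power_in_extended_ideal:
  assumes \<phi>: "\<phi> \<in> ring_hom A A" and B: "finite B" "B \<subseteq> carrier A" "carrier A \<subseteq> hom_span A A \<phi> B"
    and Q: "ideal Q A" and \<phi>_Q: "\<And>a. a \<in> G 1 \<Longrightarrow> \<phi> a \<in> Q" and x: "x \<in> G 1"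
  shows "\<exists>e::nat. x [^] e \<in> Q"
proof -
  interpret \<phi>: ring_hom_cring A A \<phi> by unfold_locales fact
  interpret Q: ideal Q A by fact
  have xc: "x \<in> carrier A" by (rule G_carrier[OF x])
  have "\<exists>c\<in>{..card B} \<rightarrow> carrier A. (\<exists>i\<in>{..card B}. c i \<notin> G 1) \<and>
      (\<Oplus>i\<in>{..card B}. \<phi> (c i) \<otimes> x [^] i) \<in> Q"
  proof (rule \<phi>.linear_dependence[OF Q _ unit_outside_G one B(1,2)])
    fix i assume "i \<in> {..card B}"
    show "x [^] i \<in> carrier A" using xc by simp
    then show "\<exists>s\<in>hom_span A A \<phi> B. x [^] i \<ominus> s \<in> Q"
      using B(3) Q.zero_closed by (intro bexI[of _ "x [^] i"]) (auto simp: minus_eq r_neg)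
  qed (use \<phi>_Q in auto)
  then obtain c i where c: "c \<in> {..card B} \<rightarrow> carrier A" and i: "i \<le> card B" "c i \<notin> G 1"
    and rel: "(\<Oplus>i\<in>{..card B}. \<phi> (c i) \<otimes> x [^] i) \<in> Q" by auto
  define c' where "c' i = (if i \<le> card B then c i else \<zero>)" for i
  have c': "c' i \<in> carrier A" for i using c by (auto simp: c'_def)
  have eq: "(\<Oplus>i\<in>{..card B}. \<phi> (c' i) \<otimes> x [^] i) = (\<Oplus>i\<in>{..card B}. \<phi> (c i) \<otimes> x [^] i)"
    using c xc by (intro finsum_cong') (auto simp: c'_def)
  have "x [^] (0::nat) \<otimes> (\<Oplus>i\<in>{..card B}. \<phi> (c' i) \<otimes> x [^] i) \<in> Q"
    unfolding eq using rel Q.Icarr[OF rel] by simp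
  then show ?thesis
    using nilpotent_of_relation[OF \<phi> finite_hom_local[OF \<phi> B] Q \<phi>_Q x, of c' i "card B" 0] c' i
    by (simp add: c'_def)
qed

end

section \<open>Lifting self maps\<close>

lemma finsum_module_via: "finsum (module_via S \<phi>) f B = finsum S f B"
  by (simp add: finsum_def finprod_def module_via_def)

lemma finite_self_map_iff:
  fixes R (structure)
  shows "finite_self_map R h \<longleftrightarrow> h \<in> ring_hom R R \<and> (\<exists>B. finite B \<and> B \<subseteq> carrier R \<and>
    (\<forall>x\<in>carrier R. \<exists>c\<in>B \<rightarrow> carrier R. x = (\<Oplus>b\<in>B. h (c b) \<otimes> b)))"
  by (simp add: finite_self_map_def finitely_generated_module_def finsum_module_via)
    (simp add: module_via_def)

lemma coefficient_field_decomp: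
  assumes "cring A" "ideal \<mm> A" "coefficient_field A \<mm> K" "a \<in> carrier A"
  shows "\<exists>k\<in>K. \<exists>x\<in>\<mm>. a = k \<oplus>\<^bsub>A\<^esub> x"
proof -
  interpret A: cring A by fact
  interpret I: ideal \<mm> A by fact
  have K: "K \<subseteq> carrier A" using assms(3) subfieldE(3) unfolding coefficient_field_def by blast
  have "(\<lambda>k. \<mm> +>\<^bsub>A\<^esub> k) ` K = carrier (A Quot \<mm>)"
    using assms(3) unfolding coefficient_field_def ring_iso_def bij_betw_def by simp
  moreover have "\<mm> +>\<^bsub>A\<^esub> a \<in> carrier (A Quot \<mm>)"
    using assms(4) by (auto simp: FactRing_def A_RCOSETS_def')
  ultimately obtain k where k: "k \<in> K" "\<mm> +>\<^bsub>A\<^esub> a = \<mm> +>\<^bsub>A\<^esub> k" by (metis (no_types, lifting) imageE)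
  have "a \<in> \<mm> +>\<^bsub>A\<^esub> k" using I.a_rcos_self[OF assms(4)] k(2) by simp
  then obtain x where "x \<in> \<mm>" "a = x \<oplus>\<^bsub>A\<^esub> k" unfolding a_r_coset_def' by blast
  then show ?thesis using k K I.Icarr A.a_comm by blast
qed

text \<open>
  The second half of the indeterminates makes room for lifting: \<open>\<psi>\<close> maps \<open>X\<^sub>i\<close> to \<open>y\<^sub>i + X\<^sub>n\<^sub>+\<^sub>i\<close> and
  \<open>X\<^sub>n\<^sub>+\<^sub>j\<close> to \<open>X\<^sub>j\<^sup>e - \<Sum>\<^sub>l b\<^sub>j\<^sub>l (y\<^sub>l + X\<^sub>n\<^sub>+\<^sub>l)\<close>, where \<open>y\<^sub>i \<in> (X\<^sub>0, \<dots>, X\<^sub>n\<^sub>-\<^sub>1)\<close> lifts \<open>\<phi> x\<^sub>i\<close>. The ideal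
  generated by these images contains \<open>X\<^sub>j\<^sup>e\<close>, hence is primary to the maximal ideal.
\<close>

theorem (in complete_ring_over_field) self_map_lift:
  assumes x: "x \<in> {..<n} \<rightarrow> carrier A" and gen: "G 1 = lincomb n x"
  defines "R \<equiv> power_series_ring (A\<lparr>carrier := K\<rparr>) (n + n)"
  shows "\<exists>\<pi>\<in>ring_hom R A. \<pi> ` carrier R = carrier A \<and>
    (\<forall>\<phi>. finite_self_map A \<phi> \<longrightarrow> (\<exists>\<psi>. finite_self_map R \<psi> \<and> (\<forall>f\<in>carrier R. \<phi> (\<pi> f) = \<pi> (\<psi> f))))"
proof -
  let ?N = "n + n"
  define F where "F = A\<lparr>carrier := K\<rparr>"
  interpret F: field F unfolding F_def by (rule subfield_iff(2)[OF K])
  interpret S: power_series F ?N by unfold_locales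
  have R: "R = S.P" by (simp add: R_def F_def)
  have F_simps: "carrier F = K" "\<one>\<^bsub>F\<^esub> = \<one>" "\<zero>\<^bsub>F\<^esub> = \<zero>" "ring.add F = ring.add A" "monoid.mult F = monoid.mult A"
    by (simp_all add: F_def)
  have Aloc: "complete_filtered_ring A G" by unfold_locales
  have xc: "x i \<in> carrier A" if "i < n" for i using x that by auto
  have xG: "x i \<in> G 1" if "i < n" for i unfolding gen by (rule lincomb_base[OF x that])
  have incl: "g \<in> ring_hom F A" if "g \<in> ring_hom A A" for g
    using that K_carrier by (auto simp: ring_hom_def F_simps Pi_def)
  have id: "(\<lambda>a. a) \<in> ring_hom F A" by (rule incl) (auto simp: ring_hom_def)
  define x' where "x' i = (if i < n then x i else \<zero>)" for i
  have x'G: "x' i \<in> G 1" for i using xG G_zero by (simp add: x'_def)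
  obtain \<pi> where \<pi>: "\<pi> \<in> ring_hom S.P A"
    and \<pi>_const: "\<And>c. c \<in> K \<Longrightarrow> \<pi> (S.const c) = c" and \<pi>_indet: "\<And>i. i < ?N \<Longrightarrow> \<pi> (S.indet i) = x' i"
    using S.eval_exists[OF Aloc id, of x'] x'G unfolding F_simps(1) by blast
  interpret \<pi>: ring_hom_cring S.P A \<pi> by unfold_locales (rule \<pi>)
  have \<pi>_indet_G: "\<pi> (S.indet i) \<in> G 1" if "i < ?N" for i using \<pi>_indet[OF that] x'G by simp
  have \<pi>_surj: "\<exists>f\<in>carrier S.P. \<pi> f = a" if a: "a \<in> carrier A" for a
  proof -
    \<comment> \<open>Surjectivity as an instance of the approximation lemma: with 1 as the only
      generator, A = K + (x_0, ..., x_(n-1)) is the required decomposition.\<close>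
    have "\<exists>c\<in>{\<one>} \<rightarrow> carrier S.P. a = (\<Oplus>b\<in>{\<one>}. \<pi> (c b) \<otimes> b)"
    proof (rule S.generate_by_approximation[OF Aloc \<pi> \<pi>_indet_G _ _ _ a])
      fix t assume t: "t \<in> carrier A"
      obtain k y where k: "k \<in> K" and y: "y \<in> G 1" and t_eq: "t = k \<oplus> y" using residue[OF t] by blast
      obtain d where d: "d \<in> {..<n} \<rightarrow> carrier A" and y_eq: "y = (\<Oplus>i\<in>{..<n}. x i \<otimes> d i)"
        using y unfolding gen lincomb_def by blast
      have dc: "d i \<in> carrier A" if "i < n" for i using d that by auto
      define d' where "d' i = (if i < n then d i else \<zero>)" for i
      have d'c: "d' i \<in> carrier A" for i using d by (auto simp: d'_def)
      have "(\<Oplus>i\<in>{..<?N}. \<pi> (S.indet i) \<otimes> d' i) = y"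
        unfolding y_eq using xc dc
        by (intro add.finprod_mono_neutral_cong_right) (auto simp: \<pi>_indet x'_def d'_def)
      moreover have "(\<Oplus>b\<in>{\<one>}. \<pi> (S.const k) \<otimes> b) = k"
        using k K_carrier[OF k] \<pi>_const by simp
      ultimately show "\<exists>c\<in>{\<one>} \<rightarrow> carrier S.P. \<exists>d\<in>{..<?N} \<rightarrow> carrier A.
          t = (\<Oplus>b\<in>{\<one>}. \<pi> (c b) \<otimes> b) \<oplus> (\<Oplus>i\<in>{..<?N}. \<pi> (S.indet i) \<otimes> d i)"
        using t_eq S.const_closed k K_carrier[OF k] d'c F_simps(1)
        by (intro bexI[of _ "\<lambda>_. S.const k"] bexI[of _ d']) auto
    qed auto
    then obtain c where "c \<in> {\<one>} \<rightarrow> carrier S.P" "a = (\<Oplus>b\<in>{\<one>}. \<pi> (c b) \<otimes> b)" by blast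
    then show ?thesis by (intro bexI[of _ "c \<one>"]) auto
  qed
  have \<pi>_G: "\<pi> f \<in> G k" if "f \<in> S.order_ge k" for f k
    by (rule S.hom_order_ge[OF Aloc \<pi> \<pi>_indet_G that])
  \<comment> \<open>If \<pi> f = 0, the constant coefficient of f lies both in K and in the maximal
    ideal, hence is zero.\<close>
  have ker: "f \<in> S.order_ge 1" if f: "f \<in> carrier S.P" "\<pi> f = \<zero>" for f
  proof -
    let ?c = "f {#}"
    have c: "?c \<in> K" using S.P_coeff[OF f(1)] by (simp add: F_simps)
    have cc: "S.const ?c \<in> carrier S.P" using S.const_closed c by (simp add: F_simps)
    have g: "f \<ominus>\<^bsub>S.P\<^esub> S.const ?c \<in> S.order_ge 1" by (rule S.minus_const_order[OF f(1)])
    have "\<pi> (f \<ominus>\<^bsub>S.P\<^esub> S.const ?c) = \<ominus> ?c"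
      using f cc \<pi>_const[OF c] K_carrier[OF c] by (simp add: S.P.minus_eq)
    then have "\<ominus> ?c \<in> G 1" using \<pi>_G[OF g] by simp
    then have "?c \<in> G 1" using G_uminus[of "\<ominus> ?c"] K_carrier[OF c] by simp
    then have "?c = \<zero>" using K_G c by blast
    then show ?thesis using f(1) by (simp add: S.order_ge_def F_simps)
  qed
  have char: "(\<forall>n::nat. 0 < n \<longrightarrow> [n] \<cdot> \<one> \<noteq> \<zero>) \<or> (\<exists>q::nat. Factorial_Ring.prime q \<and> [q] \<cdot>\<^bsub>S.P\<^esub> \<one>\<^bsub>S.P\<^esub> = \<zero>\<^bsub>S.P\<^esub>)"
  proof -
    interpret c: ring_hom_cring F S.P S.const by unfold_locales (rule S.const_ring_hom)
    have "[q] \<cdot>\<^bsub>F\<^esub> \<one>\<^bsub>F\<^esub> = [q] \<cdot> \<one>" for q :: nat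
      by (simp add: F_def add_pow_def nat_pow_def)
    then have "[q] \<cdot>\<^bsub>S.P\<^esub> \<one>\<^bsub>S.P\<^esub> = \<zero>\<^bsub>S.P\<^esub>" if "[q] \<cdot> \<one> = \<zero>" for q :: nat
      using c.hom_add_pow_one[of q] that c.hom_zero by (simp add: F_simps)
    then show ?thesis using subfield_char[OF K] by blast
  qed
  have "\<exists>\<psi>. finite_self_map S.P \<psi> \<and> (\<forall>f\<in>carrier S.P. \<phi> (\<pi> f) = \<pi> (\<psi> f))"
    if fin: "finite_self_map A \<phi>" for \<phi>
  proof -
    have \<phi>: "\<phi> \<in> ring_hom A A" using fin by (simp add: finite_self_map_def)
    interpret \<phi>: ring_hom_cring A A \<phi> by unfold_locales (rule \<phi>)
    obtain B where B: "finite B" "B \<subseteq> carrier A"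
      and spanB: "\<And>a. a \<in> carrier A \<Longrightarrow> \<exists>c\<in>B \<rightarrow> carrier A. a = (\<Oplus>b\<in>B. \<phi> (c b) \<otimes> b)"
      using fin unfolding finite_self_map_iff by blast
    have span: "carrier A \<subseteq> hom_span A A \<phi> B"
      using spanB \<phi>.finsum_in_hspan[OF B(2,1)] by fastforce
    have \<phi>_G: "\<phi> a \<in> G 1" if "a \<in> G 1" for a by (rule finite_hom_local[OF \<phi> B span that])
    have "\<exists>\<tau>\<in>ring_hom F S.P. \<forall>k\<in>carrier F. \<pi> (\<tau> k) = \<phi> k"
    proof (rule S.P.field_hom_lift[OF Aloc F.field_axioms incl[OF \<phi>] \<pi> \<pi>_G _ _ ker char])
      show "\<phi> ` carrier F \<subseteq> \<pi> ` carrier S.P"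
      proof
        fix a assume "a \<in> \<phi> ` carrier F"
        then have "a \<in> carrier A" using K_carrier by (auto simp: F_simps)
        then show "a \<in> \<pi> ` carrier S.P" using \<pi>_surj by blast
      qed
      show "\<one> \<noteq> \<zero>" using one G_zero[of 1] by auto
    qed
    then obtain \<tau> where \<tau>: "\<tau> \<in> ring_hom F S.P" "\<And>k. k \<in> K \<Longrightarrow> \<pi> (\<tau> k) = \<phi> k"
      unfolding F_simps by blast
    define Q where "Q = lincomb n (\<lambda>i. \<phi> (x i))"
    have \<phi>x: "(\<lambda>i. \<phi> (x i)) \<in> {..<n} \<rightarrow> carrier A" using xc by auto
    have Q: "ideal Q A" unfolding Q_def by (rule lincomb_ideal[OF \<phi>x])
    have \<phi>_Q: "\<phi> a \<in> Q" if aG: "a \<in> G 1" for a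
    proof -
      obtain d where d: "d \<in> {..<n} \<rightarrow> carrier A" and a: "a = (\<Oplus>i\<in>{..<n}. x i \<otimes> d i)"
        using aG unfolding gen lincomb_def by blast
      have dc: "d i \<in> carrier A" if "i < n" for i using d that by auto
      have "\<phi> a = (\<Oplus>i\<in>{..<n}. \<phi> (x i) \<otimes> \<phi> (d i))"
        unfolding a using xc dc by (subst \<phi>.hom_finsum) (auto simp: o_def intro!: finsum_cong')
      then show ?thesis unfolding Q_def lincomb_def using dc by (intro CollectI exI[of _ "\<lambda>i. \<phi> (d i)"]) auto
    qed
    have "\<forall>i\<in>{..<n}. \<exists>e::nat. x i [^] e \<in> Q"
      using power_in_extended_ideal[OF \<phi> B span Q \<phi>_Q xG] by blast
    then obtain e where e: "\<forall>i\<in>{..<n}. x i [^] (e i :: nat) \<in> Q" by (rule bchoice[THEN exE])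
    \<comment> \<open>Raising the exponent by one makes it visibly positive, so that the
      corresponding power of the indeterminate has order at least 1.\<close>
    have "\<forall>j\<in>{..<n}. \<exists>b. b \<in> {..<n} \<rightarrow> carrier A \<and> x j [^] Suc (e j) = (\<Oplus>l\<in>{..<n}. \<phi> (x l) \<otimes> b l)"
    proof
      fix j assume j: "j \<in> {..<n}"
      then have "x j [^] Suc (e j) \<in> Q" using e xc ideal.I_r_closed[OF Q] by simp
      then show "\<exists>b. b \<in> {..<n} \<rightarrow> carrier A \<and> x j [^] Suc (e j) = (\<Oplus>l\<in>{..<n}. \<phi> (x l) \<otimes> b l)"
        unfolding Q_def lincomb_def by blast
    qed
    then obtain b where b: "\<forall>j\<in>{..<n}. b j \<in> {..<n} \<rightarrow> carrier A \<and>
        x j [^] Suc (e j) = (\<Oplus>l\<in>{..<n}. \<phi> (x l) \<otimes> b j l)" by (rule bchoice[THEN exE])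
    have bc: "b j l \<in> carrier A" if "j < n" "l < n" for j l using b that by auto
    have "\<forall>i\<in>{..<n}. \<exists>a. a \<in> {..<n} \<rightarrow> carrier A \<and> \<phi> (x i) = (\<Oplus>j\<in>{..<n}. x j \<otimes> a j)"
    proof
      fix i assume "i \<in> {..<n}"
      then have "\<phi> (x i) \<in> lincomb n x" using \<phi>_G[OF xG[of i]] unfolding gen by simp
      then show "\<exists>a. a \<in> {..<n} \<rightarrow> carrier A \<and> \<phi> (x i) = (\<Oplus>j\<in>{..<n}. x j \<otimes> a j)"
        unfolding lincomb_def by blast
    qed
    then obtain a where a: "\<forall>i\<in>{..<n}. a i \<in> {..<n} \<rightarrow> carrier A \<and> \<phi> (x i) = (\<Oplus>j\<in>{..<n}. x j \<otimes> a i j)"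
      by (rule bchoice[THEN exE])
    have ac: "a i j \<in> carrier A" if "i < n" "j < n" for i j using a that by auto
    have "\<forall>a\<in>carrier A. \<exists>f. f \<in> carrier S.P \<and> \<pi> f = a" using \<pi>_surj by blast
    then obtain L where L: "\<forall>a\<in>carrier A. L a \<in> carrier S.P \<and> \<pi> (L a) = a" by (rule bchoice[THEN exE])
    have Lc: "L a \<in> carrier S.P" and \<pi>L: "\<pi> (L a) = a" if "a \<in> carrier A" for a using L that by auto
    have Xc: "S.indet i \<in> carrier S.P" if "i < ?N" for i by (rule S.indet_closed[OF that])
    have Xn: "S.indet \<in> {..<k} \<rightarrow> carrier S.P" if "k \<le> ?N" for k using Xc that by auto
    have \<pi>X: "\<pi> (S.indet i) = x i" if "i < n" for i using \<pi>_indet[of i] that by (simp add: x'_def)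
    \<comment> \<open>An arbitrary lift of \<phi>(x_i) would not do, since it might involve the
      extra indeterminates and cancel the one added to it in \<open>v i\<close>. Lifting only the
      coefficients keeps \<open>y i\<close> in the ideal of the first n indeterminates.\<close>
    define y where "y i = (\<Oplus>\<^bsub>S.P\<^esub>j\<in>{..<n}. S.indet j \<otimes>\<^bsub>S.P\<^esub> L (a i j))" for i
    have y_lin: "y i \<in> S.P.lincomb n S.indet" if "i < n" for i
      unfolding y_def S.P.lincomb_def using Lc ac that by (intro CollectI exI[of _ "\<lambda>j. L (a i j)"]) auto
    have yc: "y i \<in> carrier S.P" if "i < n" for i
      by (rule S.P.lincomb_closed[OF Xn y_lin[OF that]]) simp
    have \<pi>y: "\<pi> (y i) = \<phi> (x i)" if i: "i < n" for i
    proof -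
      have "\<pi> (y i) = (\<Oplus>j\<in>{..<n}. x j \<otimes> a i j)"
        unfolding y_def using Xc Lc \<pi>L \<pi>X ac i xc
        by (subst \<pi>.hom_finsum) (auto simp: o_def intro!: finsum_cong')
      then show ?thesis using a i by simp
    qed
    have yG: "y i \<in> S.order_ge 1" if i: "i < n" for i
      unfolding y_def using S.indet_order Lc ac i by (intro S.P.G_finsum S.P.G_rmult) auto
    define v where "v i = y i \<oplus>\<^bsub>S.P\<^esub> S.indet (n + i)" for i
    have vc: "v i \<in> carrier S.P" if "i < n" for i using yc Xc that by (simp add: v_def)
    have \<pi>v: "\<pi> (v i) = \<phi> (x i)" if i: "i < n" for i
      using \<pi>y yc Xc \<pi>_indet[of "n + i"] i xc by (simp add: v_def x'_def)
    have vG: "v i \<in> S.order_ge 1" if i: "i < n" for i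
      unfolding v_def using yG S.indet_order i by (intro S.P.G_add) auto
    \<comment> \<open>The relation for the power of x_j is lifted through the \<open>v l\<close>.
      Thus \<open>r j\<close> lies in the ideal they generate and has the same image under \<pi> as
      the power of the indeterminate, so their difference \<open>z j\<close> is in the
      kernel.\<close>
    define r where "r j = (\<Oplus>\<^bsub>S.P\<^esub>l\<in>{..<n}. v l \<otimes>\<^bsub>S.P\<^esub> L (b j l))" for j
    have rc: "r j \<in> carrier S.P" if "j < n" for j
      unfolding r_def using vc Lc bc that by (intro S.P.finsum_closed) auto
    have \<pi>r: "\<pi> (r j) = x j [^] Suc (e j)" if j: "j < n" for j
    proof -
      have "\<pi> (r j) = (\<Oplus>l\<in>{..<n}. \<phi> (x l) \<otimes> b j l)"
        unfolding r_def using vc Lc bc \<pi>v \<pi>L j xc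
        by (subst \<pi>.hom_finsum) (auto simp: o_def intro!: finsum_cong')
      then show ?thesis using b j by simp
    qed
    have rG: "r j \<in> S.order_ge 1" if j: "j < n" for j
      unfolding r_def using vG Lc bc j by (intro S.P.G_finsum S.P.G_rmult) auto
    define z where "z j = S.indet j [^]\<^bsub>S.P\<^esub> Suc (e j) \<ominus>\<^bsub>S.P\<^esub> r j" for j
    have zc: "z j \<in> carrier S.P" if "j < n" for j using Xc rc that by (simp add: z_def)
    have \<pi>_pow: "\<pi> (f [^]\<^bsub>S.P\<^esub> (k::nat)) = \<pi> f [^] k" if "f \<in> carrier S.P" for f k
      using that by (induction k) auto
    have \<pi>z: "\<pi> (z j) = \<zero>" if j: "j < n" for j
    proof -
      have "\<pi> (z j) = \<pi> (S.indet j [^]\<^bsub>S.P\<^esub> Suc (e j)) \<ominus> \<pi> (r j)"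
        unfolding z_def S.P.minus_eq minus_eq using Xc[of j] rc j by simp
      also have "\<dots> = \<zero>"
        using \<pi>_pow[of "S.indet j" "Suc (e j)"] \<pi>X[OF j] Xc[of j] \<pi>r[OF j] xc[OF j] j by simp
      finally show ?thesis .
    qed
    have zG: "z j \<in> S.order_ge 1" if j: "j < n" for j
    proof -
      have "S.indet j [^]\<^bsub>S.P\<^esub> Suc (e j) \<in> S.order_ge 1"
        using S.P.G_lmult[OF _ S.indet_order, of "S.indet j [^]\<^bsub>S.P\<^esub> e j" j] Xc[of j] j by simp
      then show ?thesis unfolding z_def using rG[OF j] by (rule S.P.G_minus)
    qed
    define w where "w i = (if i < n then v i else z (i - n))" for i
    have w1: "w i = v i" if "i < n" for i using that by (simp add: w_def)
    have w2: "w (n + j) = z j" for j by (simp add: w_def)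
    have wG: "w i \<in> S.order_ge 1" if "i < ?N" for i using vG zG that by (simp add: w_def)
    have wc: "w i \<in> carrier S.P" if "i < ?N" for i using S.P.G_carrier[OF wG[OF that]] .
    have \<pi>w: "\<pi> (w i) = \<phi> (x' i)" if "i < ?N" for i
      using \<pi>v \<pi>z that by (simp add: w_def x'_def)
    obtain \<psi> where \<psi>: "\<psi> \<in> ring_hom S.P S.P"
      and \<psi>_const: "\<And>c. c \<in> K \<Longrightarrow> \<psi> (S.const c) = \<tau> c" and \<psi>_indet: "\<And>i. i < ?N \<Longrightarrow> \<psi> (S.indet i) = w i"
      using S.eval_exists[OF S.P_complete \<tau>(1), of w] wG unfolding F_simps(1) by blast
    interpret \<psi>: ring_hom_cring S.P S.P \<psi> by unfold_locales (rule \<psi>)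
    have \<psi>_indet_G: "\<psi> (S.indet i) \<in> S.order_ge 1" if "i < ?N" for i
      using \<psi>_indet[OF that] wG[OF that] by simp
    have commute: "\<phi> (\<pi> f) = \<pi> (\<psi> f)" if f: "f \<in> carrier S.P" for f
    proof -
      have "(\<phi> \<circ> \<pi>) f = (\<pi> \<circ> \<psi>) f"
      proof (rule S.hom_eqI[OF Aloc ring_hom_trans[OF \<pi> \<phi>] ring_hom_trans[OF \<psi> \<pi>] _ _ _ f])
        fix i assume i: "i < ?N"
        show "(\<phi> \<circ> \<pi>) (S.indet i) \<in> G 1" using \<phi>_G[OF \<pi>_indet_G[OF i]] by simp
        show "(\<phi> \<circ> \<pi>) (S.indet i) = (\<pi> \<circ> \<psi>) (S.indet i)"
          using \<pi>_indet[OF i] \<psi>_indet[OF i] \<pi>w[OF i] by simp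
      next
        fix c assume "c \<in> carrier F"
        then show "(\<phi> \<circ> \<pi>) (S.const c) = (\<pi> \<circ> \<psi>) (S.const c)"
          using \<pi>_const[of c] \<psi>_const[of c] \<tau>(2)[of c] by (simp add: F_simps)
      qed
      then show ?thesis by simp
    qed
    define W where "W = S.P.lincomb ?N w"
    have w_Pi: "w \<in> {..<?N} \<rightarrow> carrier S.P" using wc by auto
    have W: "ideal W S.P" unfolding W_def by (rule S.P.lincomb_ideal[OF w_Pi])
    interpret W: ideal W S.P by (rule W)
    have wW: "w i \<in> W" if "i < ?N" for i unfolding W_def by (rule S.P.lincomb_base[OF w_Pi that])
    have powW: "S.indet j [^]\<^bsub>S.P\<^esub> Suc (e j) \<in> W" if j: "j < n" for j
    proof -
      have vW: "v l \<in> W" if "l < n" for l using wW[of l] w1[OF that] that by simp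
      have "r j \<in> W" unfolding r_def
        by (rule W.finsum_mem[OF S.P.ring_axioms]) (use vW Lc bc j in \<open>auto intro: W.I_r_closed\<close>)
      moreover have "z j \<in> W" using wW[of "n + j"] w2 j by simp
      ultimately have "z j \<oplus>\<^bsub>S.P\<^esub> r j \<in> W" by (intro W.a_closed)
      moreover have "z j \<oplus>\<^bsub>S.P\<^esub> r j = S.indet j [^]\<^bsub>S.P\<^esub> Suc (e j)"
        unfolding z_def S.P.minus_eq using Xc[of j] rc[OF j] j by (simp add: S.P.a_assoc S.P.l_neg)
      ultimately show ?thesis by simp
    qed
    \<comment> \<open>These ideals interpolate between V 0, which is W, and V n, which contains
      every series without constant term. Descending from n to 0 removes one indeterminate at a
      time.\<close>
    define V where "V k = S.P.lincomb k S.indet <+>\<^bsub>S.P\<^esub> W" for k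
    have V: "ideal (V k) S.P" if "k \<le> ?N" for k
      unfolding V_def by (rule S.P.add_ideals[OF S.P.lincomb_ideal[OF Xn[OF that]] W])
    have V_iff: "q \<in> V k \<longleftrightarrow> (\<exists>p\<in>S.P.lincomb k S.indet. \<exists>s\<in>W. q = p \<oplus>\<^bsub>S.P\<^esub> s)" for q k
      unfolding V_def set_add_def' by auto
    have lin0: "\<zero>\<^bsub>S.P\<^esub> \<in> S.P.lincomb k S.indet" if "k \<le> ?N" for k
      by (rule additive_subgroup.zero_closed[OF ideal.axioms(1)[OF S.P.lincomb_ideal[OF Xn[OF that]]]])
    have W_V: "s \<in> V k" if "s \<in> W" "k \<le> ?N" for s k
      unfolding V_iff using lin0[OF that(2)] that(1) W.Icarr[OF that(1)]
      by (intro bexI[of _ "\<zero>\<^bsub>S.P\<^esub>"] bexI[of _ s]) auto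
    \<comment> \<open>Modulo W, each extra indeterminate equals the negative of the corresponding
      \<open>y j\<close>, which involves only the first n as generators.\<close>
    have XV: "S.indet i \<in> V n" if i: "i < ?N" for i
    proof (cases "i < n")
      case True
      then have "S.indet i \<in> S.P.lincomb n S.indet" by (intro S.P.lincomb_base Xn) auto
      then show ?thesis unfolding V_iff using Xc[OF i] W.zero_closed
        by (intro bexI[of _ "S.indet i"] bexI[of _ "\<zero>\<^bsub>S.P\<^esub>"]) auto
    next
      case False
      then obtain j where j: "i = n + j" "j < n" using i by (metis add_less_cancel_left le_add_diff_inverse not_less)
      have "\<ominus>\<^bsub>S.P\<^esub> y j \<in> S.P.lincomb n S.indet"
        by (rule additive_subgroup.a_inv_closed[OF ideal.axioms(1)[OF S.P.lincomb_ideal[OF Xn]] y_lin[OF j(2)]]) simp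
      moreover have "v j \<in> W" using wW[of j] w1[OF j(2)] j(2) by simp
      moreover have "S.indet i = \<ominus>\<^bsub>S.P\<^esub> y j \<oplus>\<^bsub>S.P\<^esub> v j"
        unfolding v_def j(1) using yc[OF j(2)] Xc[of "n + j"] j(2) by (simp add: S.P.r_neg1)
      ultimately show ?thesis unfolding V_iff by blast
    qed
    have order_V: "f \<in> V n" if f: "f \<in> S.order_ge 1" for f
    proof -
      obtain d where d: "\<forall>i<?N. d i \<in> S.order_ge 0"
        and f_eq: "f = (\<Oplus>\<^bsub>S.P\<^esub>i\<in>{..<?N}. S.indet i \<otimes>\<^bsub>S.P\<^esub> d i)"
        using S.order_ge_Suc_decomp[of f 0] f by auto
      have dc: "d i \<in> carrier S.P" if "i < ?N" for i using d that S.P.G_carrier by blast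
      show ?thesis unfolding f_eq
      proof (rule additive_subgroup.finsum_mem[OF ideal.axioms(1)[OF V] S.P.ring_axioms])
        fix i assume "i \<in> {..<?N}"
        then show "S.indet i \<otimes>\<^bsub>S.P\<^esub> d i \<in> V n"
          by (intro ideal.I_r_closed[OF V] XV dc) auto
      qed simp
    qed
    have "\<exists>B'. finite B' \<and> B' \<subseteq> carrier S.P \<and> (\<forall>f\<in>carrier S.P. \<exists>s\<in>\<psi>.hspan B'. \<exists>q\<in>V k. f = s \<oplus>\<^bsub>S.P\<^esub> q)"
      if "k \<le> n" for k
      using that
    proof (induction k rule: inc_induct)
      case base
      have LB: "finite (L ` B)" "L ` B \<subseteq> carrier S.P" using B Lc by auto
      \<comment> \<open>Combinations of B through \<phi> lift to combinations of \<open>L\<close>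
        through \<psi>; this uses that \<phi>\<pi> = \<pi>\<psi>. What a lift misses lies in the
        kernel of \<pi>, hence in V n.\<close>
      have lift: "\<exists>s\<in>\<psi>.hspan (L ` B). \<pi> s = a" if "a \<in> hom_span A A \<phi> B" for a
        using that
      proof induction
        case zero
        then show ?case by (intro bexI[of _ "\<zero>\<^bsub>S.P\<^esub>"] hom_span.zero) auto
      next
        case (add b p s)
        then obtain s' where s': "s' \<in> \<psi>.hspan (L ` B)" "\<pi> s' = s" by blast
        have bc: "b \<in> carrier A" using add(1) B by blast
        have "\<pi> (\<psi> (L p) \<otimes>\<^bsub>S.P\<^esub> L b \<oplus>\<^bsub>S.P\<^esub> s') = \<phi> p \<otimes> b \<oplus> s"
          using commute[OF Lc[OF add(2)]] Lc[OF add(2)] Lc[OF bc] \<pi>L[OF add(2)] \<pi>L[OF bc] s' \<psi>.hspan_closed[OF LB(2) s'(1)]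
          by simp
        moreover have "\<psi> (L p) \<otimes>\<^bsub>S.P\<^esub> L b \<oplus>\<^bsub>S.P\<^esub> s' \<in> \<psi>.hspan (L ` B)"
          by (rule hom_span.add[OF imageI[OF add(1)] Lc[OF add(2)] s'(1)])
        ultimately show ?case by blast
      qed
      have "\<exists>s\<in>\<psi>.hspan (L ` B). \<exists>q\<in>V n. f = s \<oplus>\<^bsub>S.P\<^esub> q" if f: "f \<in> carrier S.P" for f
      proof -
        obtain s where s: "s \<in> \<psi>.hspan (L ` B)" "\<pi> s = \<pi> f" 
          using lift[OF subsetD[OF span \<pi>.hom_closed[OF f]]] by blast
        have sc: "s \<in> carrier S.P" by (rule \<psi>.hspan_closed[OF LB(2) s(1)])
        have "\<pi> (f \<ominus>\<^bsub>S.P\<^esub> s) = \<zero>" using s(2) f sc by (simp add: S.P.minus_eq r_neg)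
        then have "f \<ominus>\<^bsub>S.P\<^esub> s \<in> V n" by (rule order_V[OF ker[OF S.P.minus_closed[OF f sc]]])
        moreover have "f = s \<oplus>\<^bsub>S.P\<^esub> (f \<ominus>\<^bsub>S.P\<^esub> s)"
          using f sc by (simp add: S.P.minus_eq S.P.a_lcomm[of s] S.P.r_neg)
        ultimately show ?thesis using s(1) by blast
      qed
      then show ?case using LB by (intro exI[of _ "L ` B"]) simp
    next
      case (step k)
      from step.IH obtain B' where IH: "finite B' \<and> B' \<subseteq> carrier S.P \<and>
        (\<forall>f\<in>carrier S.P. \<exists>s\<in>\<psi>.hspan B'. \<exists>q\<in>V (Suc k). f = s \<oplus>\<^bsub>S.P\<^esub> q)" ..
      then have B': "finite B'" "B' \<subseteq> carrier S.P" by simp_all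
      have kN: "k < ?N" "Suc k \<le> ?N" "k < n" using step.hyps by auto
      show ?case
      \<comment> \<open>Elements of V (k + 1) are multiples of the indeterminate of index k modulo V
        k, and a power of this indeterminate lies in W, hence in V k.\<close>
      proof (rule \<psi>.hspan_reduce[OF V Xc[OF kN(1)] W_V[OF powW[OF kN(3)]] B'])
        fix f assume f: "f \<in> carrier S.P"
        obtain s q where s: "s \<in> \<psi>.hspan B'" and q: "q \<in> V (Suc k)" and f_eq: "f = s \<oplus>\<^bsub>S.P\<^esub> q"
          using IH f by blast
        obtain p u where p: "p \<in> S.P.lincomb (Suc k) S.indet" and u: "u \<in> W" and q_eq: "q = p \<oplus>\<^bsub>S.P\<^esub> u"
          using q unfolding V_iff by blast
        obtain g p' where g: "g \<in> carrier S.P" and p': "p' \<in> S.P.lincomb k S.indet"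
          and p_eq: "p = S.indet k \<otimes>\<^bsub>S.P\<^esub> g \<oplus>\<^bsub>S.P\<^esub> p'"
          using S.P.lincomb_Suc[OF Xn[OF kN(2)] p] by blast
        have "p' \<in> carrier S.P" using S.P.lincomb_closed[OF Xn p'] kN by simp
        then have "f = s \<oplus>\<^bsub>S.P\<^esub> S.indet k \<otimes>\<^bsub>S.P\<^esub> g \<oplus>\<^bsub>S.P\<^esub> (p' \<oplus>\<^bsub>S.P\<^esub> u)"
          unfolding f_eq q_eq p_eq using \<psi>.hspan_closed[OF B'(2) s] Xc[OF kN(1)] g W.Icarr[OF u]
          by (simp add: S.P.a_assoc)
        moreover have "p' \<oplus>\<^bsub>S.P\<^esub> u \<in> V k" unfolding V_iff using p' u by blast
        ultimately show "\<exists>s\<in>\<psi>.hspan B'. \<exists>g\<in>carrier S.P. \<exists>q\<in>V k.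
            f = s \<oplus>\<^bsub>S.P\<^esub> S.indet k \<otimes>\<^bsub>S.P\<^esub> g \<oplus>\<^bsub>S.P\<^esub> q" using s g by blast
      qed (use kN in simp_all)
    qed
    from this[OF le0] obtain B' where B'0: "finite B' \<and> B' \<subseteq> carrier S.P \<and>
        (\<forall>f\<in>carrier S.P. \<exists>s\<in>\<psi>.hspan B'. \<exists>q\<in>V 0. f = s \<oplus>\<^bsub>S.P\<^esub> q)" ..
    then have B': "finite B'" "B' \<subseteq> carrier S.P" by simp_all
    \<comment> \<open>Since V 0 is W, what is left over is a combination of the images of the
      indeterminates under \<psi>, exactly the decomposition that the approximation lemma
      iterates.\<close>
    have dec: "\<exists>c\<in>B' \<rightarrow> carrier S.P. \<exists>d\<in>{..<?N} \<rightarrow> carrier S.P.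
      f = (\<Oplus>\<^bsub>S.P\<^esub>b\<in>B'. \<psi> (c b) \<otimes>\<^bsub>S.P\<^esub> b) \<oplus>\<^bsub>S.P\<^esub> (\<Oplus>\<^bsub>S.P\<^esub>i\<in>{..<?N}. \<psi> (S.indet i) \<otimes>\<^bsub>S.P\<^esub> d i)"
      if f: "f \<in> carrier S.P" for f
    proof -
      obtain s q where s: "s \<in> \<psi>.hspan B'" and q: "q \<in> V 0" and f_eq: "f = s \<oplus>\<^bsub>S.P\<^esub> q"
        using B'0 f by blast
      obtain c where c: "c \<in> B' \<rightarrow> carrier S.P" "s = (\<Oplus>\<^bsub>S.P\<^esub>b\<in>B'. \<psi> (c b) \<otimes>\<^bsub>S.P\<^esub> b)"
        using \<psi>.hspan_imp_finsum[OF B' s] by blast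
      obtain u where u: "u \<in> W" and "q = \<zero>\<^bsub>S.P\<^esub> \<oplus>\<^bsub>S.P\<^esub> u"
        using q unfolding V_iff S.P.lincomb_0 by blast
      then have "q = u" using W.Icarr[OF u] by simp
      then obtain d where d: "d \<in> {..<?N} \<rightarrow> carrier S.P" and q_eq: "q = (\<Oplus>\<^bsub>S.P\<^esub>i\<in>{..<?N}. w i \<otimes>\<^bsub>S.P\<^esub> d i)"
        using u unfolding W_def S.P.lincomb_def by blast
      have dc: "d i \<in> carrier S.P" if "i < ?N" for i using d that by auto
      have "q = (\<Oplus>\<^bsub>S.P\<^esub>i\<in>{..<?N}. \<psi> (S.indet i) \<otimes>\<^bsub>S.P\<^esub> d i)"
        unfolding q_eq using dc wc \<psi>_indet by (intro S.P.finsum_cong') auto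
      then show ?thesis using c d f_eq by blast
    qed
    have "\<exists>c\<in>B' \<rightarrow> carrier S.P. f = (\<Oplus>\<^bsub>S.P\<^esub>b\<in>B'. \<psi> (c b) \<otimes>\<^bsub>S.P\<^esub> b)" if f: "f \<in> carrier S.P" for f
      by (rule S.generate_by_approximation[OF S.P_complete \<psi> \<psi>_indet_G B' dec f])
    then have "finite_self_map S.P \<psi>" unfolding finite_self_map_iff using \<psi> B' by blast
    then show ?thesis using commute by blast
  qed
  moreover have "\<pi> ` carrier S.P = carrier A"
  proof
    show "\<pi> ` carrier S.P \<subseteq> carrier A" using \<pi>.hom_closed by blast
    show "carrier A \<subseteq> \<pi> ` carrier S.P"
    proof
      fix a assume "a \<in> carrier A"
      then obtain f where "f \<in> carrier S.P" "\<pi> f = a" using \<pi>_surj by blast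
      then show "a \<in> \<pi> ` carrier S.P" by blast
    qed
  qed
  ultimately show ?thesis unfolding R using \<pi> by blast
qed

lemma (in cring) local_ring_over_coefficient_field:
  assumes "is_local_ring R \<mm>" "adic_complete R \<mm>" "coefficient_field R \<mm> K"
  shows "complete_ring_over_field R (\<lambda>n. \<mm> [^]\<^bsub>ideals_set R\<^esub> (n::nat)) K" "\<mm> [^]\<^bsub>ideals_set R\<^esub> (1::nat) = \<mm>"
proof -
  interpret M: comm_monoid "ideals_set R" by (rule ideals_set_is_comm_monoid)
  have max: "maximalideal \<mm> R" using assms(1) by (simp add: is_local_ring_def)
  then have \<mm>: "ideal \<mm> R" by (rule maximalideal.axioms(1))
  have "\<mm> \<in> carrier (ideals_set R)" using \<mm> by (simp add: ideals_set_def)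
  then show 1: "\<mm> [^]\<^bsub>ideals_set R\<^esub> (1::nat) = \<mm>" by (rule M.nat_pow_eone)
  have "\<one> \<notin> \<mm>" using ideal.one_imp_carrier[OF \<mm>] maximalideal.I_notcarr[OF max] by blast
  then show "complete_ring_over_field R (\<lambda>n. \<mm> [^]\<^bsub>ideals_set R\<^esub> (n::nat)) K"
    using adic_filtration[OF \<mm> assms(2)] coefficient_field_decomp[OF is_cring \<mm> assms(3)] assms(3) 1
    by (intro complete_ring_over_field.intro complete_ring_over_field_axioms.intro)
      (auto simp: coefficient_field_def)
qed

theorem corollary2p3:
  fixes A :: "('a, 'b) ring_scheme" and \<mm> K :: "'a set"
  assumes "is_local_ring A \<mm>"
    and "noetherian_ring A"
    and "adic_complete A \<mm>"
    and "equicharacteristic A \<mm>"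
    and "coefficient_field A \<mm> K"
  shows "\<exists>(N::nat) (R :: (nat multiset \<Rightarrow> 'a) ring) (\<pi> :: (nat multiset \<Rightarrow> 'a) \<Rightarrow> 'a).
           R = power_series_ring (A\<lparr>carrier := K\<rparr>) N \<and>
           \<pi> \<in> ring_hom R A \<and> \<pi> ` carrier R = carrier A \<and>
           (\<forall>\<phi>. finite_self_map A \<phi> \<longrightarrow>
             (\<exists>\<psi>. finite_self_map R \<psi> \<and> (\<forall>f\<in>carrier R. \<phi> (\<pi> f) = \<pi> (\<psi> f))))"
proof -
  interpret cring A using assms(1) by (simp add: is_local_ring_def)
  interpret L: complete_ring_over_field A "\<lambda>n. \<mm> [^]\<^bsub>ideals_set A\<^esub> (n::nat)" K
    by (rule local_ring_over_coefficient_field[OF assms(1,3,5)])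
  have "ideal \<mm> A" using assms(1) by (simp add: is_local_ring_def maximalideal.axioms(1))
  then obtain n x where x: "x \<in> {..<n} \<rightarrow> carrier A" "\<mm> = lincomb n x"
    using finitely_generated_ideal[OF assms(2)] by blast
  then have "\<mm> [^]\<^bsub>ideals_set A\<^esub> (1::nat) = lincomb n x"
    using local_ring_over_coefficient_field(2)[OF assms(1,3,5)] by simp
  from L.self_map_lift[OF x(1) this] show ?thesis by blast
qed

end
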